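(* Let $f\in\mathbb{R}[z_1,\dots,z_n]$ be homogeneous of degree $d\ge 1$. Then the number of distinct hyperbolicity cones of $f$, and hence the number of connected components of $\mathbb{R}^n\setminus\mathcal{I}(f)$, is at most $$\begin{cases}2^d & \text{if } d\le n,\\ 2\sum_{k=0}^{n-1}\binom{d-1}{k} & \text{if } d>n.\end{cases}$$ This maximum is attained if and only if $f=c\,\ell_1\cdots\ell_d$ with $c\in\mathbb{R}\setminus\{0\}$ and real linear forms $\ell_1,\dots,\ell_d$ that are independent in the sense that any $\min(n,d)$ of them are linearly independent.
   Context: For $f\in\mathbb{C}[z_1,\dots,z_n]$, $\mathcal{V}(f)\subseteq\mathbb{C}^n$ denotes its complex zero set and the imaginary projection of $f$ is $\mathcal{I}(f)=\{\Im(\mathbf z):\mathbf z\in\mathcal V(f)\}\subseteq\mathbb{R}^n$, where $\Im$ is taken componentwise. A homogeneous polynomial $f$ is hyperbolic in direction $\mathbf e\in\mathbb{R}^n$ if $f(\mathbf e)\neq 0$ and for every $\mathbf x\in\mathbb{R}^n$ the univariate polynomial $t\mapsto f(\mathbf x+t\mathbf e)$ has only real roots. In that case the hyperbolicity cone of $f$ with respect to $\mathbf e$ is $C(\mathbf e)=\{\mathbf x\in\mathbb{R}^n: f(\mathbf x+t\mathbf e)=0\Rightarrow t<0\}$. The hyperbolicity cones of $f$ are the sets $C(\mathbf e)$ for all directions $\mathbf e$ in which $f$ is hyperbolic. *)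

theory Defs
  imports "HOL-Analysis.Analysis" "HOL-Library.Poly_Mapping"
begin

text \<open>Real polynomials in the variables indexed by the finite type 'n:
  finitely supported maps from monomials (exponent vectors 'n =>0 nat) to real coefficients.
  This is a commutative ring (multiplication = convolution).\<close>
type_synonym 'n rpoly = "('n \<Rightarrow>\<^sub>0 nat) \<Rightarrow>\<^sub>0 real"

definition ceval :: "'n::finite rpoly \<Rightarrow> complex ^ 'n \<Rightarrow> complex" where
  "ceval f z = (\<Sum>m\<in>Poly_Mapping.keys f. of_real (Poly_Mapping.lookup f m) * (\<Prod>i\<in>UNIV. (z $ i) ^ Poly_Mapping.lookup m i))"

definition cvec :: "real ^ 'n \<Rightarrow> complex ^ 'n" where
  "cvec x = (\<chi> i. complex_of_real (x $ i))"

definition homogeneous_deg :: "'n::finite rpoly \<Rightarrow> nat \<Rightarrow> bool" where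
  "homogeneous_deg f d \<longleftrightarrow> f \<noteq> 0 \<and> (\<forall>\<alpha>\<in>Poly_Mapping.keys f. (\<Sum>i\<in>UNIV. Poly_Mapping.lookup \<alpha> i) = d)"

definition zero_set :: "'n::finite rpoly \<Rightarrow> (complex ^ 'n) set" where
  "zero_set f = {z. ceval f z = 0}"

definition imag_proj :: "'n::finite rpoly \<Rightarrow> (real ^ 'n) set" where
  "imag_proj f = {(\<chi> i. Im (z $ i)) | z. z \<in> zero_set f}"

definition hyperbolic :: "'n::finite rpoly \<Rightarrow> real ^ 'n \<Rightarrow> bool" where
  "hyperbolic f e \<longleftrightarrow> ceval f (cvec e) \<noteq> 0 \<and>
     (\<forall>x. \<forall>t::complex. ceval f (cvec x + t *s cvec e) = 0 \<longrightarrow> t \<in> \<real>)"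

definition hyp_cone :: "'n::finite rpoly \<Rightarrow> real ^ 'n \<Rightarrow> (real ^ 'n) set" where
  "hyp_cone f e = {x. \<forall>t::real. ceval f (cvec (x + t *\<^sub>R e)) = 0 \<longrightarrow> t < 0}"

definition hyp_cones :: "'n::finite rpoly \<Rightarrow> (real ^ 'n) set set" where
  "hyp_cones f = {hyp_cone f e | e. hyperbolic f e}"

definition linform :: "real ^ 'n::finite \<Rightarrow> 'n rpoly" where
  "linform a = (\<Sum>i\<in>UNIV. Poly_Mapping.single (Poly_Mapping.single i 1) (a $ i))"

definition cone_bound :: "nat \<Rightarrow> nat \<Rightarrow> nat" where
  "cone_bound n d = (if d \<le> n then 2 ^ d else 2 * (\<Sum>k=0..n-1. (d - 1) choose k))"

end

theory Submission
  imports Defs "HOL-Complex_Analysis.Complex_Analysis"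
    "HOL-Computational_Algebra.Fundamental_Theorem_Algebra"
begin

text \<open>
  The hyperbolic directions form the complement of the imaginary projection, and the hyperbolicity
  cones are its (open, convex) connected components.

  Let \<open>e\<close> and \<open>a\<close> be hyperbolic directions. If \<open>Im z\<close> lies in the cone of \<open>a\<close>, no root \<open>t\<close> of
  \<open>f (z + t e)\<close> is real, so the number \<open>k\<close> of roots in the upper half plane is constant. The product
  \<open>P z\<close> of these roots is holomorphic with \<open>Im (P z) = O (Im z)\<close> locally, hence extends continuously to
  real \<open>z\<close> with real values; by Schwarz reflection and Liouville it is polynomial along every line in
  a direction of the cone, and so a polynomial. The lower roots give the complementary factor of \<open>f\<close>.
  The factorization is trivial only if \<open>k = 0\<close>, when \<open>a\<close> and \<open>e\<close> share a cone, or \<open>k = d\<close>, when \<open>a\<close> and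
  \<open>- e\<close> do. Thus a hyperbolic \<open>f\<close> is a product of \<open>m \<le> d\<close> factors with exactly two opposite cones each.

  Separating the two cones of every factor by a hyperplane injects the cones of \<open>f\<close> into the regions
  of a central arrangement of \<open>m\<close> hyperplanes, which are counted by deletion and restriction.
\<close>

section \<open>Evaluation of real polynomials\<close>

text \<open>No factorization into irreducibles is used: whenever two hyperbolic directions lie in
  different, non-opposite cones, a splitting of \<open>f\<close> is built from the position of its
  roots. The obstacle is the real space: there upper and lower roots may meet on the real axis, so
  the product of the upper roots has to be recovered as a boundary value. Two facts make this work.
  A whole ball of directions around \<open>e\<close> is hyperbolic, which by homogeneity gives |Im
  r| <= K |Im z| for every root r. And a holomorphic function whose imaginary part on a ball is at
  most a multiple of the radius has a derivative bounded independently of the radius, so it is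
  Lipschitz up to the boundary. In the case of equality the factors have positive degrees with sum
  \<open>d\<close>, so \<open>d\<close> of them are all linear, and fewer than \<open>d\<close> give
  strictly fewer regions. This strictness holds for n >= 2; for n = 1 the bound is 2 for every d >=
  1, and f = c x^d is treated by hand.\<close>

lemma ceval_superset:
  assumes "finite A" "Poly_Mapping.keys f \<subseteq> A"
  shows "ceval f z = (\<Sum>m\<in>A. of_real (Poly_Mapping.lookup f m) * (\<Prod>i\<in>UNIV. (z $ i) ^ Poly_Mapping.lookup m i))"
  unfolding ceval_def
  by (rule sum.mono_neutral_left) (use assms in \<open>auto simp: in_keys_iff\<close>)

lemma ceval_0 [simp]: "ceval 0 z = 0"
  by (simp add: ceval_def)

lemma ceval_single:
  "ceval (Poly_Mapping.single m c) z = of_real c * (\<Prod>i\<in>UNIV. (z $ i) ^ Poly_Mapping.lookup m i)"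
  by (subst ceval_superset[of "{m}"]) (auto simp: lookup_single)

lemma ceval_add: "ceval (f + g) z = ceval f z + ceval g z"
proof -
  let ?A = "Poly_Mapping.keys f \<union> Poly_Mapping.keys g"
  have "Poly_Mapping.keys (f + g) \<subseteq> ?A"
    by (rule keys_add)
  then show ?thesis
    by (subst (1 2 3) ceval_superset[of ?A])
       (auto simp: lookup_add algebra_simps simp flip: sum.distrib)
qed

lemma ceval_sum: "ceval (sum f A) z = (\<Sum>a\<in>A. ceval (f a) z)"
  by (induction A rule: infinite_finite_induct) (auto simp: ceval_add)

lemma poly_mapping_sum_single:
  "f = (\<Sum>m\<in>Poly_Mapping.keys f. Poly_Mapping.single m (Poly_Mapping.lookup f m))"
proof (rule poly_mapping_eqI)
  fix k
  have "Poly_Mapping.lookup (\<Sum>m\<in>Poly_Mapping.keys f. Poly_Mapping.single m (Poly_Mapping.lookup f m)) k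
      = (\<Sum>m\<in>Poly_Mapping.keys f. if m = k then Poly_Mapping.lookup f m else 0)"
    by (simp add: lookup_sum lookup_single when_def)
  also have "\<dots> = Poly_Mapping.lookup f k"
    by (simp add: in_keys_iff)
  finally show "Poly_Mapping.lookup f k
      = Poly_Mapping.lookup (\<Sum>m\<in>Poly_Mapping.keys f. Poly_Mapping.single m (Poly_Mapping.lookup f m)) k"
    by simp
qed

lemma ceval_mult: "ceval (f * g) z = ceval f z * ceval g z"
proof -
  let ?F = "Poly_Mapping.keys f" and ?G = "Poly_Mapping.keys g"
  have "f * g = (\<Sum>a\<in>?F. Poly_Mapping.single a (Poly_Mapping.lookup f a))
              * (\<Sum>b\<in>?G. Poly_Mapping.single b (Poly_Mapping.lookup g b))"
    using poly_mapping_sum_single[of f] poly_mapping_sum_single[of g] by simp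
  also have "\<dots> = (\<Sum>a\<in>?F. \<Sum>b\<in>?G. Poly_Mapping.single (a + b) (Poly_Mapping.lookup f a * Poly_Mapping.lookup g b))"
    by (simp add: sum_product mult_single)
  finally have "ceval (f * g) z = (\<Sum>a\<in>?F. \<Sum>b\<in>?G.
      (of_real (Poly_Mapping.lookup f a) * (\<Prod>i\<in>UNIV. (z $ i) ^ Poly_Mapping.lookup a i)) *
      (of_real (Poly_Mapping.lookup g b) * (\<Prod>i\<in>UNIV. (z $ i) ^ Poly_Mapping.lookup b i)))"
    by (simp add: ceval_sum ceval_single lookup_add power_add prod.distrib mult_ac)
  then show ?thesis
    by (simp add: ceval_def sum_product)
qed

lemma ceval_1 [simp]: "ceval 1 z = 1"
  using ceval_single[of 0 1 z] by simp

lemma ceval_prod: "ceval (prod f A) z = (\<Prod>a\<in>A. ceval (f a) z)"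
  by (induction A rule: infinite_finite_induct) (auto simp: ceval_mult)

lemma ceval_linform: "ceval (linform a) z = (\<Sum>i\<in>UNIV. of_real (a $ i) * z $ i)"
proof -
  have "(\<Prod>j\<in>UNIV. (z $ j) ^ Poly_Mapping.lookup (Poly_Mapping.single i (1::nat)) j) = z $ i" for i
    by (subst prod.remove[of _ i])
       (auto simp: lookup_single when_def intro!: prod.neutral)
  then show ?thesis
    by (simp add: linform_def ceval_sum ceval_single)
qed

lemma ceval_linform_cvec: "ceval (linform a) (cvec x) = of_real (a \<bullet> x)"
  by (simp add: ceval_linform cvec_def inner_vec_def)

lemma cvec_add: "cvec (x + y) = cvec x + cvec y"
  and cvec_scaleR: "cvec (c *\<^sub>R x) = of_real c *s cvec x"
  and cvec_0 [simp]: "cvec 0 = 0"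
  by (simp_all add: cvec_def vec_eq_iff)

lemma ceval_scale:
  assumes "homogeneous_deg f d"
  shows "ceval f (c *s z) = c ^ d * ceval f z"
proof -
  have "(\<Prod>i\<in>UNIV. (c * z $ i) ^ Poly_Mapping.lookup m i)
      = c ^ d * (\<Prod>i\<in>UNIV. (z $ i) ^ Poly_Mapping.lookup m i)"
    if "m \<in> Poly_Mapping.keys f" for m
    using assms that
    by (simp add: homogeneous_deg_def power_mult_distrib prod.distrib flip: power_sum)
  then show ?thesis
    by (simp add: ceval_def sum_distrib_left mult_ac)
qed

lemma ceval_cnj: "ceval f (\<chi> i. cnj (z $ i)) = cnj (ceval f z)"
  by (simp add: ceval_def)

lemma ceval_cvec_real: "ceval f (cvec x) \<in> \<real>"
  unfolding ceval_def cvec_def by (intro sum_in_Reals Reals_mult prod_in_Reals Reals_power) auto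

lemma continuous_ceval [continuous_intros]:
  assumes "continuous_on S g"
  shows "continuous_on S (\<lambda>x. ceval f (g x))"
  unfolding ceval_def by (intro continuous_intros assms)

lemma continuous_cvec [continuous_intros]:
  assumes "continuous_on S g"
  shows "continuous_on S (\<lambda>x. cvec (g x))"
  unfolding cvec_def by (intro continuous_intros assms)

section \<open>Polynomials are determined by their values at real points\<close>

lemma base_expansion_inj:
  fixes a b :: "nat \<Rightarrow> nat"
  assumes "\<And>i. i < n \<Longrightarrow> a i < N" "\<And>i. i < n \<Longrightarrow> b i < N"
    and "(\<Sum>i<n. a i * N ^ i) = (\<Sum>i<n. b i * N ^ i)" "i < n"
  shows "a i = b i"
  using assms
proof (induction n arbitrary: a b i)
  case (Suc n)
  have split: "(\<Sum>i<Suc n. c i * N ^ i) = c 0 + N * (\<Sum>i<n. c (Suc i) * N ^ i)" for c :: "nat \<Rightarrow> nat"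
    unfolding sum.lessThan_Suc_shift by (simp add: sum_distrib_left mult_ac)
  have eq: "a 0 + N * (\<Sum>i<n. a (Suc i) * N ^ i) = b 0 + N * (\<Sum>i<n. b (Suc i) * N ^ i)"
    using Suc.prems(3) unfolding split .
  have lt: "a 0 < N" "b 0 < N"
    using Suc.prems by auto
  have 0: "a 0 = b 0"
    using arg_cong[OF eq, of "\<lambda>k. k mod N"] lt by simp
  with eq lt have tail: "(\<Sum>i<n. a (Suc i) * N ^ i) = (\<Sum>i<n. b (Suc i) * N ^ i)"
    by simp
  show ?case
  proof (cases i)
    case (Suc j)
    show ?thesis
      using Suc.IH[of "\<lambda>i. a (Suc i)" "\<lambda>i. b (Suc i)" j] Suc.prems tail Suc by simp
  qed (simp add: 0)
qed simp

text \<open>Kronecker substitution \<open>x\<^sub>i = T ^ (N ^ i)\<close> sends distinct monomials of small degree to distinct powers of \<open>T\<close>.\<close>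

lemma ceval_eq_0_imp_eq_0:
  fixes p :: "'n::finite rpoly"
  assumes zero: "\<And>x. ceval p (cvec x) = 0"
  shows "p = 0"
proof -
  obtain h :: "'n \<Rightarrow> nat" where h: "bij_betw h UNIV {..<CARD('n)}"
    using ex_bij_betw_finite_nat[of "UNIV :: 'n set"] by (auto simp: atLeast0LessThan)
  \<comment> \<open>\<open>N\<close> exceeds every exponent occurring in \<open>p\<close>, so
    exponents are base-\<open>N\<close> digits; the inserted 0 keeps \<open>Max\<close> meaningful
    when \<open>p = 0\<close>.\<close>
  define E where "E = insert 0 ((\<lambda>(m, i). Poly_Mapping.lookup m i) ` (Poly_Mapping.keys p \<times> UNIV))"
  define N where "N = Suc (Max E)"
  have "finite E"
    by (simp add: E_def)
  have N: "Poly_Mapping.lookup m i < N" if "m \<in> Poly_Mapping.keys p" for m i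
  proof -
    have "Poly_Mapping.lookup m i \<in> E"
      using that by (force simp: E_def)
    then show ?thesis
      using Max_ge[OF \<open>finite E\<close>] by (simp add: N_def less_Suc_eq_le)
  qed
  define code where "code m = (\<Sum>i\<in>UNIV. Poly_Mapping.lookup m i * N ^ h i)" for m :: "'n \<Rightarrow>\<^sub>0 nat"
  have code_alt: "code m = (\<Sum>j<CARD('n). Poly_Mapping.lookup m (inv h j) * N ^ j)" for m
    using sum.reindex_bij_betw[OF h, of "\<lambda>j. Poly_Mapping.lookup m (inv h j) * N ^ j"] h
    by (simp add: code_def bij_betw_def)
  have inj: "inj_on code (Poly_Mapping.keys p)"
  proof (intro inj_onI poly_mapping_eqI)
    fix m m' i assume m: "m \<in> Poly_Mapping.keys p" "m' \<in> Poly_Mapping.keys p" "code m = code m'"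
    have "Poly_Mapping.lookup m (inv h (h i)) = Poly_Mapping.lookup m' (inv h (h i))"
      by (rule base_expansion_inj[of "CARD('n)" "\<lambda>j. Poly_Mapping.lookup m (inv h j)" N
            "\<lambda>j. Poly_Mapping.lookup m' (inv h j)"])
         (use m h N in \<open>auto simp flip: code_alt dest: bij_betwE\<close>)
    then show "Poly_Mapping.lookup m i = Poly_Mapping.lookup m' i"
      using h by (simp add: bij_betw_def)
  qed
  define q where "q = (\<Sum>m\<in>Poly_Mapping.keys p. monom (Poly_Mapping.lookup p m) (code m))"
  have "poly q T = 0" for T
  proof -
    have "complex_of_real (poly q T) = ceval p (cvec (\<chi> i. T ^ (N ^ h i)))"
      by (simp add: q_def poly_sum poly_monom ceval_def cvec_def code_def power_sum mult.commute flip: power_mult)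
    then show ?thesis
      using zero by simp
  qed
  then have "q = 0"
    using poly_all_0_iff_0 by blast
  have "Poly_Mapping.lookup p m = 0" if m: "m \<in> Poly_Mapping.keys p" for m
  proof -
    have "poly.coeff q (code m) = (\<Sum>m'\<in>Poly_Mapping.keys p. if m' = m then Poly_Mapping.lookup p m' else 0)"
      unfolding q_def coeff_sum coeff_monom
      by (intro sum.cong refl) (use inj m in \<open>auto dest: inj_onD\<close>)
    then show ?thesis
      using m \<open>q = 0\<close> by simp
  qed
  then show ?thesis
    by (metis in_keys_iff keys_eq_empty equals0I)
qed

text \<open>Identities found by passing to limits at real points can thus be read as identities of
  formal polynomials.\<close>

lemma rpoly_eqI:
  fixes p q :: "'n::finite rpoly"
  assumes "\<And>x. ceval p (cvec x) = ceval q (cvec x)"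
  shows "p = q"
proof -
  have "ceval (Poly_Mapping.single 0 (-1) * q) z = - ceval q z" for z
    by (simp add: ceval_mult ceval_single)
  then have "p + Poly_Mapping.single 0 (-1) * q = 0"
    by (intro ceval_eq_0_imp_eq_0) (simp add: ceval_add assms)
  moreover have "Poly_Mapping.single 0 (-1) * q = - q"
    by (simp add: single_uminus)
  ultimately show ?thesis
    by simp
qed

text \<open>Polynomial behaviour of boundary values is first established for functions; this turns
  them back into formal polynomials.\<close>

lemma real_polynomial_function_imp_rpoly:
  fixes g :: "real ^ 'n::finite \<Rightarrow> real"
  assumes "real_polynomial_function g"
  shows "\<exists>p. \<forall>x. ceval p (cvec x) = of_real (g x)"
  using assms
proof (induction rule: real_polynomial_function.induct)
  case (linear g)
  \<comment> \<open>Riesz representation: the functional \<open>g\<close> is the inner product with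
    \<open>adjoint g 1\<close>.\<close>
  then have a: "g x = adjoint g 1 \<bullet> x" for x
    using adjoint_works[OF bounded_linear.linear, of g x 1] by (simp add: inner_commute)
  show ?case
    by (intro exI[of _ "linform (adjoint g 1)"]) (simp add: ceval_linform_cvec a)
next
  case (const c)
  show ?case
    by (intro exI[of _ "Poly_Mapping.single 0 c"]) (simp add: ceval_single)
next
  case (add f g)
  then obtain p q where "\<forall>x. ceval p (cvec x) = of_real (f x)" "\<forall>x. ceval q (cvec x) = of_real (g x)"
    by auto
  then show ?case
    by (intro exI[of _ "p + q"]) (simp add: ceval_add)
next
  case (mult f g)
  then obtain p q where "\<forall>x. ceval p (cvec x) = of_real (f x)" "\<forall>x. ceval q (cvec x) = of_real (g x)"
    by auto
  then show ?case
    by (intro exI[of _ "p * q"]) (simp add: ceval_mult)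
qed

text \<open>The single factor 2 is enough: comparing coefficients gives 2^j = 2^k for the degree j
  of each monomial, and powers of 2 are distinct.\<close>

lemma homogeneous_degI:
  fixes p :: "'n::finite rpoly"
  assumes "p \<noteq> 0" and scale: "\<And>x. ceval p (cvec (2 *\<^sub>R x)) = 2 ^ k * ceval p (cvec x)"
  shows "homogeneous_deg p k"
  unfolding homogeneous_deg_def
proof (intro conjI ballI)
  fix m assume m: "m \<in> Poly_Mapping.keys p"
  let ?deg = "\<lambda>m. \<Sum>i\<in>UNIV. Poly_Mapping.lookup m i"
  define q where "q = (\<Sum>m\<in>Poly_Mapping.keys p. Poly_Mapping.single m (2 ^ ?deg m * Poly_Mapping.lookup p m))"
  have "ceval q (cvec x) = ceval p (cvec (2 *\<^sub>R x))" for x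
    by (simp add: q_def ceval_sum ceval_single) (simp add: ceval_def cvec_def power_mult_distrib prod.distrib power_sum mult_ac)
  then have "q = Poly_Mapping.single 0 (2 ^ k) * p"
    by (intro rpoly_eqI) (simp add: scale ceval_mult ceval_single)
  then have "Poly_Mapping.lookup q m = 2 ^ k * Poly_Mapping.lookup p m"
    by (simp add: Poly_Mapping.map.rep_eq when_def flip: mult_map_scale_conv_mult)
  moreover have "Poly_Mapping.lookup q m = 2 ^ ?deg m * Poly_Mapping.lookup p m"
    using m by (simp add: q_def lookup_sum lookup_single when_def)
  ultimately show "?deg m = k"
    using m by (auto simp: in_keys_iff)
qed (use assms in auto)

section \<open>Hyperbolicity cones\<close>

text \<open>A nonreal root \<open>t\<close> can be normalized: dividing by \<open>Im t\<close> turns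
  the imaginary part into \<open>e\<close>, and the real part is absorbed into
  \<open>x\<close>.\<close>

lemma hyperbolic_iff_nonzero:
  assumes f: "homogeneous_deg f d"
  shows "hyperbolic f e \<longleftrightarrow> (\<forall>x. ceval f (cvec x + \<i> *s cvec e) \<noteq> 0)"
proof
  assume "hyperbolic f e"
  then show "\<forall>x. ceval f (cvec x + \<i> *s cvec e) \<noteq> 0"
    unfolding hyperbolic_def by (metis complex_is_Real_iff imaginary_unit.sel(2) zero_neq_one)
next
  assume nz: "\<forall>x. ceval f (cvec x + \<i> *s cvec e) \<noteq> 0"
  show "hyperbolic f e"
    unfolding hyperbolic_def
  proof (intro conjI allI impI)
    have "ceval f (\<i> *s cvec e) \<noteq> 0"
      using nz[rule_format, of 0] by simp
    then show "ceval f (cvec e) \<noteq> 0"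
      by (simp add: ceval_scale[OF f])
  next
    fix x and t :: complex
    assume t: "ceval f (cvec x + t *s cvec e) = 0"
    show "t \<in> \<real>"
    proof (rule ccontr)
      assume "t \<notin> \<real>"
      then have im: "Im t \<noteq> 0"
        by (simp add: complex_is_Real_iff)
      define y where "y = (1 / Im t) *\<^sub>R (x + Re t *\<^sub>R e)"
      have "cvec x + t *s cvec e = of_real (Im t) *s (cvec y + \<i> *s cvec e)"
        using im by (auto simp: y_def cvec_def vec_eq_iff complex_eq_iff)
      then have "of_real (Im t) ^ d * ceval f (cvec y + \<i> *s cvec e) = 0"
        using t by (simp only: ceval_scale[OF f])
      then show False
        using nz im by simp
    qed
  qed
qed

lemma compl_imag_proj:
  assumes f: "homogeneous_deg f d"
  shows "UNIV - imag_proj f = {e. hyperbolic f e}"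
proof -
  have "(\<exists>z. e = (\<chi> i. Im (z $ i)) \<and> ceval f z = 0) \<longleftrightarrow> (\<exists>x. ceval f (cvec x + \<i> *s cvec e) = 0)" for e
  proof
    assume "\<exists>z. e = (\<chi> i. Im (z $ i)) \<and> ceval f z = 0"
    then obtain z where z: "e = (\<chi> i. Im (z $ i))" "ceval f z = 0"
      by blast
    have "cvec (\<chi> i. Re (z $ i)) + \<i> *s cvec e = z"
      by (simp add: z cvec_def vec_eq_iff complex_eq_iff)
    with z show "\<exists>x. ceval f (cvec x + \<i> *s cvec e) = 0"
      by metis
  next
    assume "\<exists>x. ceval f (cvec x + \<i> *s cvec e) = 0"
    then obtain x where x: "ceval f (cvec x + \<i> *s cvec e) = 0" ..
    then show "\<exists>z. e = (\<chi> i. Im (z $ i)) \<and> ceval f z = 0"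
      by (intro exI[of _ "cvec x + \<i> *s cvec e"]) (simp add: cvec_def vec_eq_iff)
  qed
  then show ?thesis
    by (auto simp: imag_proj_def zero_set_def hyperbolic_iff_nonzero[OF f])
qed

lemma hyperbolic_scaleR:
  assumes f: "homogeneous_deg f d" and "hyperbolic f e" "c \<noteq> 0"
  shows "hyperbolic f (c *\<^sub>R e)"
  unfolding hyperbolic_iff_nonzero[OF f]
proof
  fix x
  have "cvec x + \<i> *s cvec (c *\<^sub>R e) = of_real c *s (cvec ((1 / c) *\<^sub>R x) + \<i> *s cvec e)"
    using \<open>c \<noteq> 0\<close> by (simp add: cvec_def vec_eq_iff field_simps)
  then have "ceval f (cvec x + \<i> *s cvec (c *\<^sub>R e)) = of_real c ^ d * ceval f (cvec ((1 / c) *\<^sub>R x) + \<i> *s cvec e)"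
    by (simp only: ceval_scale[OF f])
  then show "ceval f (cvec x + \<i> *s cvec (c *\<^sub>R e)) \<noteq> 0"
    using assms by (simp add: hyperbolic_iff_nonzero[OF f])
qed

lemma hyperbolic_uminus:
  assumes "homogeneous_deg f d" "hyperbolic f e"
  shows "hyperbolic f (- e)"
  using hyperbolic_scaleR[OF assms, of "-1"] by simp

lemma hyperbolic_nonzero: "hyperbolic f e \<Longrightarrow> ceval f (cvec e) \<noteq> 0"
  by (simp add: hyperbolic_def)

text \<open>For t >= 0 one has x + t e = (1 + t) u with \<open>u\<close> on the segment, so by
  homogeneity zeros on the half-line correspond to zeros on the segment. In this form the cone is
  visibly star-shaped about \<open>e\<close>.\<close>

lemma hyp_cone_eq_segment:
  assumes f: "homogeneous_deg f d" and e: "ceval f (cvec e) \<noteq> 0"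
  shows "hyp_cone f e = {x. \<forall>u\<in>closed_segment e x. ceval f (cvec u) \<noteq> 0}"
proof (intro set_eqI iffI CollectI ballI)
  fix x u assume x: "x \<in> hyp_cone f e" and "u \<in> closed_segment e x"
  then obtain l where l: "0 \<le> l" "l \<le> 1" and u: "u = (1 - l) *\<^sub>R e + l *\<^sub>R x"
    by (auto simp: in_segment)
  show "ceval f (cvec u) \<noteq> 0"
  proof (cases "l = 0")
    case False
    then have "u = l *\<^sub>R (x + ((1 - l) / l) *\<^sub>R e)"
      by (simp add: u scaleR_add_right)
    then have "ceval f (cvec u) = of_real l ^ d * ceval f (cvec (x + ((1 - l) / l) *\<^sub>R e))"
      by (simp add: cvec_scaleR ceval_scale[OF f])
    moreover have "(1 - l) / l \<ge> 0"
      using l by simp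
    ultimately show ?thesis
      using x False unfolding hyp_cone_def by force
  qed (use e u in simp)
next
  fix x assume "x \<in> {x. \<forall>u\<in>closed_segment e x. ceval f (cvec u) \<noteq> 0}"
  then have x: "\<And>u. u \<in> closed_segment e x \<Longrightarrow> ceval f (cvec u) \<noteq> 0"
    by blast
  show "x \<in> hyp_cone f e"
    unfolding hyp_cone_def
  proof (intro CollectI allI impI)
    fix t assume t: "ceval f (cvec (x + t *\<^sub>R e)) = 0"
    show "t < 0"
    proof (rule ccontr)
      assume "\<not> t < 0"
      then have t0: "t \<ge> 0" by simp
      define u where "u = (1 / (1 + t)) *\<^sub>R (x + t *\<^sub>R e)"
      have "u \<in> closed_segment e x"
        unfolding in_segment u_def using t0
        by (intro exI[of _ "1 / (1 + t)"]) (auto simp: algebra_simps field_simps simp flip: scaleR_add_left)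
      moreover have "ceval f (cvec u) = 0"
        by (simp only: u_def cvec_scaleR[of "1 / (1 + t)"] ceval_scale[OF f] t mult_zero_right)
      ultimately show False
        using x by blast
    qed
  qed
qed

lemma hyp_cone_self: "homogeneous_deg f d \<Longrightarrow> ceval f (cvec e) \<noteq> 0 \<Longrightarrow> e \<in> hyp_cone f e"
  by (simp add: hyp_cone_eq_segment)

lemma hyp_cone_nonzero:
  "homogeneous_deg f d \<Longrightarrow> ceval f (cvec e) \<noteq> 0 \<Longrightarrow> x \<in> hyp_cone f e \<Longrightarrow> ceval f (cvec x) \<noteq> 0"
  by (simp add: hyp_cone_eq_segment)

lemma hyp_cone_starlike:
  assumes "homogeneous_deg f d" "ceval f (cvec e) \<noteq> 0" "x \<in> hyp_cone f e"
  shows "closed_segment e x \<subseteq> hyp_cone f e"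
proof
  fix u assume "u \<in> closed_segment e x"
  then have "closed_segment e u \<subseteq> closed_segment e x"
    by (simp add: closed_segment_subset)
  then show "u \<in> hyp_cone f e"
    using assms by (auto simp: hyp_cone_eq_segment)
qed

lemma hyp_cone_uminus:
  assumes f: "homogeneous_deg f d" and e: "ceval f (cvec e) \<noteq> 0"
  shows "x \<in> hyp_cone f (- e) \<longleftrightarrow> - x \<in> hyp_cone f e"
proof -
  have neg: "ceval f (cvec (- u)) = (-1) ^ d * ceval f (cvec u)" for u
    using ceval_scale[OF f, of "-1" "cvec u"] by (simp add: cvec_def vec_eq_iff vector_scalar_mult_def)
  have "u \<in> closed_segment (- e) x \<longleftrightarrow> - u \<in> closed_segment e (- x)" for u
    using closed_segment_linear_image[of uminus "-e" x] by (auto simp: linear_uminus image_iff minus_equation_iff)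
  then have "(\<forall>u\<in>closed_segment (- e) x. ceval f (cvec u) \<noteq> 0) \<longleftrightarrow>
      (\<forall>u\<in>closed_segment e (- x). ceval f (cvec (- u)) \<noteq> 0)"
    by (metis minus_minus)
  then show ?thesis
    using e by (simp add: hyp_cone_eq_segment[OF f] neg)
qed

section \<open>Roots of \<open>f\<close> along complex lines\<close>

lemma coeff_mult_degree_bound:
  assumes "degree p \<le> m" "degree q \<le> n"
  shows "poly.coeff (p * q) (m + n) = poly.coeff p m * poly.coeff q n"
proof (cases "degree p = m \<and> degree q = n")
  case False
  then have "degree p + degree q < m + n"
    using assms by linarith
  then have "degree (p * q) < m + n"
    using degree_mult_le[of p q] by linarith
  then show ?thesis
    using False assms by (auto simp: coeff_eq_0)
qed (auto simp: coeff_mult_degree_sum)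

lemma coeff_power_degree_bound:
  fixes p :: "'a::comm_semiring_1 poly"
  assumes "degree p \<le> m"
  shows "degree (p ^ k) \<le> m * k \<and> poly.coeff (p ^ k) (m * k) = poly.coeff p m ^ k"
proof (induction k)
  case (Suc k)
  have "degree (p * p ^ k) \<le> m + m * k"
    using degree_mult_le[of p "p ^ k"] Suc assms by linarith
  then show ?case
    using coeff_mult_degree_bound[OF assms, of "p ^ k" "m * k"] Suc by simp
qed simp

text \<open>The coefficient is taken at the degree bound, not at the degree, because the factors z_i
  + t b_i of a line polynomial may be constant.\<close>

lemma coeff_prod_degree_bound:
  fixes p :: "'i \<Rightarrow> 'a::comm_semiring_1 poly"
  assumes "finite S" "\<And>i. i \<in> S \<Longrightarrow> degree (p i) \<le> m i"
  shows "degree (\<Prod>i\<in>S. p i) \<le> (\<Sum>i\<in>S. m i) \<and>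
    poly.coeff (\<Prod>i\<in>S. p i) (\<Sum>i\<in>S. m i) = (\<Prod>i\<in>S. poly.coeff (p i) (m i))"
  using assms
proof (induction S rule: finite_induct)
  case (insert i S)
  have i: "degree (p i) \<le> m i"
    and S: "degree (prod p S) \<le> sum m S" "poly.coeff (prod p S) (sum m S) = (\<Prod>i\<in>S. poly.coeff (p i) (m i))"
    using insert by auto
  have "degree (p i * prod p S) \<le> m i + sum m S"
    by (rule order_trans[OF degree_mult_le add_mono[OF i S(1)]])
  then show ?case
    by (simp add: insert.hyps coeff_mult_degree_bound[OF i S(1)] S(2))
qed simp

text \<open>A formal polynomial in \<open>t\<close> rather than a function: its root multiset keeps
  multiplicities, and its coefficients can be followed as holomorphic functions of
  \<open>z\<close>.\<close>

definition line_poly :: "'n::finite rpoly \<Rightarrow> complex ^ 'n \<Rightarrow> complex ^ 'n \<Rightarrow> complex poly" where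
  "line_poly f b z = (\<Sum>m\<in>Poly_Mapping.keys f.
     smult (of_real (Poly_Mapping.lookup f m)) (\<Prod>i\<in>UNIV. [:z $ i, b $ i:] ^ Poly_Mapping.lookup m i))"

definition line_roots :: "'n::finite rpoly \<Rightarrow> complex ^ 'n \<Rightarrow> complex ^ 'n \<Rightarrow> complex multiset" where
  "line_roots f b z = proots (line_poly f b z)"

lemma poly_line_poly: "poly (line_poly f b z) t = ceval f (z + t *s b)"
  by (simp add: line_poly_def ceval_def poly_sum poly_prod)

lemma line_poly_degree:
  assumes f: "homogeneous_deg f d"
  shows "degree (line_poly f b z) \<le> d" and "poly.coeff (line_poly f b z) d = ceval f b"
proof -
  have m: "degree (\<Prod>i\<in>UNIV. [:z $ i, b $ i:] ^ Poly_Mapping.lookup m i) \<le> d \<and>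
    poly.coeff (\<Prod>i\<in>UNIV. [:z $ i, b $ i:] ^ Poly_Mapping.lookup m i) d = (\<Prod>i\<in>UNIV. (b $ i) ^ Poly_Mapping.lookup m i)"
    if "m \<in> Poly_Mapping.keys f" for m
  proof -
    have pw: "degree ([:z $ i, b $ i:] ^ k) \<le> k \<and> poly.coeff ([:z $ i, b $ i:] ^ k) k = (b $ i) ^ k" for i k
      using coeff_power_degree_bound[of "[:z $ i, b $ i:]" 1 k] by simp
    show ?thesis
      using coeff_prod_degree_bound[of UNIV "\<lambda>i. [:z $ i, b $ i:] ^ Poly_Mapping.lookup m i" "Poly_Mapping.lookup m"]
        that f by (simp add: pw homogeneous_deg_def)
  qed
  show "degree (line_poly f b z) \<le> d"
    unfolding line_poly_def by (intro degree_sum_le) (use m in \<open>auto intro: order_trans[OF degree_smult_le]\<close>)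
  show "poly.coeff (line_poly f b z) d = ceval f b"
    unfolding line_poly_def ceval_def by (simp add: coeff_sum m)
qed

lemma line_roots_factorization:
  assumes f: "homogeneous_deg f d" and b: "ceval f b \<noteq> 0"
  shows "size (line_roots f b z) = d"
    and "ceval f (z + t *s b) = ceval f b * (\<Prod>r\<in>#line_roots f b z. t - r)"
    and "r \<in># line_roots f b z \<longleftrightarrow> ceval f (z + r *s b) = 0"
proof -
  note lp = line_poly_degree[OF f, of b z]
  have deg: "degree (line_poly f b z) = d"
    using lp b by (metis le_antisym le_degree)
  show "size (line_roots f b z) = d"
    by (simp add: line_roots_def size_proots_complex deg)
  have "line_poly f b z \<noteq> 0"
    using lp b by auto
  then show "r \<in># line_roots f b z \<longleftrightarrow> ceval f (z + r *s b) = 0"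
    by (simp add: line_roots_def poly_line_poly)
  have "line_poly f b z = smult (ceval f b) (\<Prod>x\<in>#line_roots f b z. [:-x, 1:])"
    using complex_poly_decompose_multiset[of "line_poly f b z"] lp deg by (simp add: line_roots_def)
  then have "ceval f (z + t *s b) = poly (smult (ceval f b) (\<Prod>x\<in>#line_roots f b z. [:-x, 1:])) t"
    using poly_line_poly by metis
  then show "ceval f (z + t *s b) = ceval f b * (\<Prod>r\<in>#line_roots f b z. t - r)"
    by (simp add: poly_prod_mset image_mset.compositionality o_def)
qed

lemma norm_prod_mset_ge:
  fixes A :: "complex multiset"
  assumes "\<And>r. r \<in># A \<Longrightarrow> c \<le> cmod (t - r)" "c \<ge> 0"
  shows "c ^ size A \<le> cmod (\<Prod>r\<in>#A. t - r)"
  using assms(1)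
proof (induction A)
  case (add x A)
  then show ?case
    using assms(2) by (auto simp: norm_mult intro!: mult_mono)
qed simp

lemma vector_norm_scale: "norm (c *s (z :: complex ^ 'n::finite)) = cmod c * norm z"
  by (simp add: norm_vec_def norm_mult L2_set_right_distrib)

text \<open>For a root t \<noteq> 0 homogeneity gives f(b + z/t) = 0, while \<open>f\<close> has no
  zero in some ball of radius \<rho> about \<open>b\<close>; hence |z| / |t| >= \<rho>.\<close>

lemma line_root_bound:
  assumes f: "homogeneous_deg f d" and b: "ceval f b \<noteq> 0"
  obtains K where "K > 0" "\<And>z t. ceval f (z + t *s b) = 0 \<Longrightarrow> cmod t \<le> K * norm z"
proof -
  have "open {w. ceval f w \<noteq> 0}"
    by (intro open_Collect_neq continuous_intros)
  then obtain \<rho> where \<rho>: "\<rho> > 0" "\<And>w. dist w b < \<rho> \<Longrightarrow> ceval f w \<noteq> 0"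
    using b unfolding open_dist by auto
  show thesis
  proof (rule that[of "1 / \<rho>"])
    fix z t assume t: "ceval f (z + t *s b) = 0"
    show "cmod t \<le> 1 / \<rho> * norm z"
    proof (cases "t = 0")
      case False
      then have "z + t *s b = t *s (b + (1 / t) *s z)"
        by (simp add: vec_eq_iff algebra_simps)
      then have "t ^ d * ceval f (b + (1 / t) *s z) = 0"
        using t by (simp only: ceval_scale[OF f])
      then have "ceval f (b + (1 / t) *s z) = 0"
        using False by simp
      then have "\<rho> \<le> dist (b + (1 / t) *s z) b"
        using \<rho>(2) not_less by blast
      also have "\<dots> = norm z / cmod t"
        by (simp add: dist_norm vector_norm_scale norm_divide)
      finally show ?thesis
        using False \<rho>(1) by (simp add: field_simps)
    qed (use \<rho> in simp)
  qed (use \<rho> in simp)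
qed

text \<open>Along the segment from \<open>0\<close> to \<open>x\<close> the roots of \<open>t \<mapsto> f (s x + i \<delta> e + t a)\<close> cannot cross the
  real axis because \<open>e\<close> is hyperbolic, and at \<open>s = 0\<close> they lie below it because \<open>a\<close> is in the cone.\<close>

lemma hyp_cone_upper_nonzero:
  assumes f: "homogeneous_deg f d" and e: "hyperbolic f e" and a: "a \<in> hyp_cone f e"
    and "\<delta> > 0" "Im t \<ge> 0"
  shows "ceval f (cvec x + (\<i> * of_real \<delta>) *s cvec e + t *s cvec a) \<noteq> 0"
proof -
  have fa: "ceval f (cvec a) \<noteq> 0"
    using hyp_cone_nonzero[OF f hyperbolic_nonzero[OF e] a] .
  define z where "z s = cvec (s *\<^sub>R x) + (\<i> * of_real \<delta>) *s cvec e" for s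
  have contz: "continuous_on S z" for S
    unfolding z_def vector_scalar_mult_def by (intro continuous_intros)
  have conts: "continuous_on S (\<lambda>p. ceval f (z (fst p) + snd p *s cvec a))" for S
    unfolding vector_scalar_mult_def
    by (intro continuous_intros continuous_on_compose2[OF contz[of UNIV]]) auto
  have noreal: "ceval f (z s + t *s cvec a) \<noteq> 0" if "Im t = 0" for s t
  proof -
    have "z s + t *s cvec a = cvec (s *\<^sub>R x + Re t *\<^sub>R a) + \<i> *s cvec (\<delta> *\<^sub>R e)"
      using that by (simp add: z_def cvec_def vec_eq_iff complex_eq_iff)
    then show ?thesis
      using hyperbolic_scaleR[OF f e, of \<delta>] \<open>\<delta> > 0\<close> by (simp add: hyperbolic_iff_nonzero[OF f])
  qed
  obtain K where K: "K > 0" "\<And>z t. ceval f (z + t *s cvec a) = 0 \<Longrightarrow> cmod t \<le> K * norm z"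
    using line_root_bound[OF f fa] by metis
  have "compact (z ` {0..1})"
    by (intro compact_continuous_image contz) auto
  then obtain M where M: "\<And>s. s \<in> {0..1} \<Longrightarrow> norm (z s) \<le> M"
    by (metis bounded_iff compact_imp_bounded imageI)
  \<comment> \<open>The root bound confines all relevant \<open>t\<close> to a compact half disc, so
    \<open>S\<close> is a projection of a compact set and therefore closed.\<close>
  define T where "T = cball 0 (K * M) \<inter> {t. Im t \<ge> 0}"
  define S where "S = {s \<in> {0..1}. \<exists>t. Im t \<ge> 0 \<and> ceval f (z s + t *s cvec a) = 0}"
  have "compact T"
    unfolding T_def by (intro compact_Int_closed closed_halfspace_Im_ge compact_cball)
  then have "compact ({0..1::real} \<times> T)"
    by (intro compact_Times) auto
  then have "compact (({0..1} \<times> T) \<inter> {p. ceval f (z (fst p) + snd p *s cvec a) = 0})"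
    by (intro compact_Int_closed closed_Collect_eq conts continuous_intros)
  then have "compact (fst ` (({0..1} \<times> T) \<inter> {p. ceval f (z (fst p) + snd p *s cvec a) = 0}))"
    by (intro compact_continuous_image continuous_intros)
  also have "fst ` (({0..1} \<times> T) \<inter> {p. ceval f (z (fst p) + snd p *s cvec a) = 0}) = S"
  proof -
    have "t \<in> T" if "s \<in> {0..1}" "Im t \<ge> 0" "ceval f (z s + t *s cvec a) = 0" for s t
      using order_trans[OF K(2)[OF that(3)] mult_left_mono[OF M[OF that(1)], of K]] K(1) that by (simp add: T_def)
    then show ?thesis
      by (force simp: S_def T_def)
  qed
  finally have "closed S"
    by (rule compact_imp_closed)
  moreover have "closed ({0..1} - S)"
  proof -
    \<comment> \<open>If all roots lie strictly below the real axis, each factor satisfies |t - r|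
      >= Im t. The resulting inequalities are closed conditions on \<open>s\<close>, and conversely
      they exclude upper roots; so the complement of \<open>S\<close> is closed too.\<close>
    define V where "V = {s \<in> {0..1}. \<forall>t. Im t > 0 \<longrightarrow> cmod (ceval f (cvec a)) * Im t ^ d \<le> cmod (ceval f (z s + t *s cvec a))}"
    have "{0..1} - S = V"
    proof (intro set_eqI iffI)
      fix s assume s: "s \<in> {0..1} - S"
      have "Im t ^ d \<le> cmod (\<Prod>r\<in>#line_roots f (cvec a) (z s). t - r)" if "Im t > 0" for t
      proof -
        have "Im t \<le> cmod (t - r)" if "r \<in># line_roots f (cvec a) (z s)" for r
        proof -
          have "Im r < 0"
            using that s line_roots_factorization(3)[OF f fa] by (auto simp: S_def not_le)
          then show ?thesis
            using abs_Im_le_cmod[of "t - r"] by simp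
        qed
        then show ?thesis
          using norm_prod_mset_ge[of "line_roots f (cvec a) (z s)" "Im t" t] that
          by (simp add: line_roots_factorization(1)[OF f fa])
      qed
      then show "s \<in> V"
        using s by (auto simp: V_def line_roots_factorization(2)[OF f fa] norm_mult intro!: mult_left_mono)
    next
      fix s assume s: "s \<in> V"
      have False if "Im t \<ge> 0" "ceval f (z s + t *s cvec a) = 0" for t
      proof -
        have "Im t > 0"
          using that noreal[of t s] by force
        then have "cmod (ceval f (cvec a)) * Im t ^ d \<le> 0"
          using s that(2) by (force simp: V_def)
        moreover have "cmod (ceval f (cvec a)) * Im t ^ d > 0"
          using fa \<open>Im t > 0\<close> by simp
        ultimately show False
          by simp
      qed
      then show "s \<in> {0..1} - S"
        using s by (auto simp: V_def S_def)
    qed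
    moreover have "closed V"
    proof -
      have "continuous_on UNIV (\<lambda>s. ceval f (z s + t *s cvec a))" for t
        unfolding vector_scalar_mult_def by (intro continuous_intros contz)
      then have "closed {s. Im t > 0 \<longrightarrow> cmod (ceval f (cvec a)) * Im t ^ d \<le> cmod (ceval f (z s + t *s cvec a))}" for t
        by (intro closed_Collect_imp closed_Collect_le open_Collect_const continuous_on_const continuous_on_norm)
      then show ?thesis
        unfolding V_def by (intro closed_Collect_conj closed_Collect_all) (simp_all add: closed_real_atLeastAtMost del: atLeastAtMost_iff)
    qed
    ultimately show ?thesis
      by simp
  qed
  \<comment> \<open>At s = 0 dividing by \<open>t\<close> leaves a root u = i \<delta> / t of f(a +
    u e). It is real by hyperbolicity and negative because \<open>a\<close> is in the cone, which
    forces Im t < 0.\<close>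
  moreover have "0 \<notin> S"
  proof
    assume "0 \<in> S"
    then obtain t where t: "Im t \<ge> 0" "ceval f ((\<i> * of_real \<delta>) *s cvec e + t *s cvec a) = 0"
      by (auto simp: S_def z_def)
    then have "t \<noteq> 0"
      using hyperbolic_nonzero[OF e] \<open>\<delta> > 0\<close> by (auto simp: ceval_scale[OF f])
    define u where "u = \<i> * of_real \<delta> / t"
    have "(\<i> * of_real \<delta>) *s cvec e + t *s cvec a = t *s (cvec a + u *s cvec e)"
      using \<open>t \<noteq> 0\<close> by (simp add: u_def vec_eq_iff algebra_simps)
    then have "t ^ d * ceval f (cvec a + u *s cvec e) = 0"
      using t by (simp only: ceval_scale[OF f])
    then have u: "ceval f (cvec a + u *s cvec e) = 0"
      using \<open>t \<noteq> 0\<close> by simp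
    then have "u \<in> \<real>"
      using e by (simp add: hyperbolic_def)
    then obtain v where v: "u = of_real v"
      by (auto elim: Reals_cases)
    then have "v < 0"
      using u a by (simp add: hyp_cone_def cvec_add cvec_scaleR)
    have "\<i> * of_real \<delta> = of_real v * t"
      using \<open>t \<noteq> 0\<close> by (simp add: u_def flip: v)
    then have "\<delta> = v * Im t"
      by (simp add: complex_eq_iff)
    then show False
      using \<open>v < 0\<close> t(1) \<open>\<delta> > 0\<close> by (smt (verit) mult_nonpos_nonneg)
  qed
  ultimately have "S \<inter> {0..1} = {} \<or> ({0..1} - S) \<inter> {0..1} = {}" "0 \<in> ({0..1} - S) \<inter> {0..1}"
    using connected_closedD[OF connected_Icc[of 0 "1::real"], of S "{0..1} - S"] by auto
  moreover have "S \<subseteq> {0..1}"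
    by (auto simp: S_def)
  ultimately have "S = {}"
    by blast
  then have "ceval f (z 1 + t *s cvec a) \<noteq> 0"
    using \<open>Im t \<ge> 0\<close> by (auto simp: S_def)
  then show ?thesis
    by (simp add: z_def)
qed

text \<open>Let \<delta> tend to 0 in the preceding lemma. Nonvanishing alone could be lost in the
  limit, but having all roots below the real axis bounds the modulus at t = i from below by |f(a)|,
  uniformly in \<delta>.\<close>

lemma hyp_cone_imp_hyperbolic:
  assumes f: "homogeneous_deg f d" and e: "hyperbolic f e" and a: "a \<in> hyp_cone f e"
  shows "hyperbolic f a"
  unfolding hyperbolic_iff_nonzero[OF f]
proof
  fix x
  have fa: "ceval f (cvec a) \<noteq> 0"
    using hyp_cone_nonzero[OF f hyperbolic_nonzero[OF e] a] .
  let ?g = "\<lambda>\<delta>. ceval f (cvec x + (\<i> * of_real \<delta>) *s cvec e + \<i> *s cvec a)"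
  have "cmod (ceval f (cvec a)) \<le> cmod (?g \<delta>)" if "\<delta> > 0" for \<delta>
  proof -
    let ?R = "line_roots f (cvec a) (cvec x + (\<i> * of_real \<delta>) *s cvec e)"
    have "1 \<le> cmod (\<i> - r)" if "r \<in># ?R" for r
    proof -
      have "Im r < 0"
        using that hyp_cone_upper_nonzero[OF f e a \<open>\<delta> > 0\<close>] line_roots_factorization(3)[OF f fa] not_le by blast
      then show ?thesis
        using abs_Im_le_cmod[of "\<i> - r"] by simp
    qed
    then have "1 \<le> cmod (\<Prod>r\<in>#?R. \<i> - r)"
      using norm_prod_mset_ge[of ?R 1] by simp
    then show ?thesis
      using mult_left_mono[of 1 "cmod (\<Prod>r\<in>#?R. \<i> - r)" "cmod (ceval f (cvec a))"]
      by (simp add: line_roots_factorization(2)[OF f fa] norm_mult)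
  qed
  then have "\<forall>\<^sub>F \<delta> in at_right 0. cmod (ceval f (cvec a)) \<le> cmod (?g \<delta>)"
    by (auto simp: eventually_at_filter)
  moreover have "((\<lambda>\<delta>. cmod (?g \<delta>)) \<longlongrightarrow> cmod (?g 0)) (at_right 0)"
  proof -
    have "continuous_on UNIV (\<lambda>\<delta>. cmod (?g \<delta>))"
      unfolding vector_scalar_mult_def by (intro continuous_intros)
    then show ?thesis
      unfolding continuous_on_def by (metis UNIV_I at_le subset_UNIV tendsto_mono)
  qed
  ultimately have "cmod (ceval f (cvec a)) \<le> cmod (?g 0)"
    by (intro tendsto_lowerbound) auto
  then show "ceval f (cvec x + \<i> *s cvec a) \<noteq> 0"
    using fa by auto
qed

section \<open>Cones as connected components of the set of hyperbolic directions\<close>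

lemma hyp_cone_subset_hyperbolic:
  "homogeneous_deg f d \<Longrightarrow> hyperbolic f e \<Longrightarrow> hyp_cone f e \<subseteq> {e. hyperbolic f e}"
  using hyp_cone_imp_hyperbolic by blast

lemma open_hyp_cone:
  assumes f: "homogeneous_deg f d" and e: "ceval f (cvec e) \<noteq> 0"
  shows "open (hyp_cone f e)"
  unfolding open_contains_ball
proof
  fix x assume x: "x \<in> hyp_cone f e"
  have "open {w. ceval f (cvec w) \<noteq> 0}"
    by (intro open_Collect_neq continuous_intros)
  moreover have "closed_segment e x \<subseteq> {w. ceval f (cvec w) \<noteq> 0}"
    using x by (auto simp: hyp_cone_eq_segment[OF f e])
  ultimately obtain \<epsilon> where \<epsilon>: "\<epsilon> > 0" "(\<Union>u\<in>closed_segment e x. ball u \<epsilon>) \<subseteq> {w. ceval f (cvec w) \<noteq> 0}"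
    using compact_subset_open_imp_ball_epsilon_subset[OF compact_segment] by blast
  have "y \<in> hyp_cone f e" if y: "dist x y < \<epsilon>" for y
    unfolding hyp_cone_eq_segment[OF f e]
  proof (intro CollectI ballI)
    fix u assume "u \<in> closed_segment e y"
    then obtain l where l: "0 \<le> l" "l \<le> 1" and u: "u = (1 - l) *\<^sub>R e + l *\<^sub>R y"
      by (auto simp: in_segment)
    let ?v = "(1 - l) *\<^sub>R e + l *\<^sub>R x"
    have "dist ?v u = l * dist x y"
      using l by (simp add: u dist_norm flip: scaleR_diff_right)
    also have "\<dots> < \<epsilon>"
      using l y mult_left_le_one_le[of "dist x y" l] by simp
    finally have "u \<in> ball ?v \<epsilon>"
      by simp
    moreover have "?v \<in> closed_segment e x"
      using l by (auto simp: in_segment)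
    ultimately show "ceval f (cvec u) \<noteq> 0"
      using \<epsilon>(2) by blast
  qed
  then show "\<exists>\<epsilon>>0. ball x \<epsilon> \<subseteq> hyp_cone f e"
    using \<epsilon>(1) by (intro exI[of _ \<epsilon>]) auto
qed

text \<open>For \<open>c\<close> in the cone all roots of f(c + t e) are negative, so |f(c + t e)|
  >= |f(e)| t^d for t > 0. This closed condition passes to \<open>a\<close>, and the remaining value
  t = 0 is excluded by f(a) \<noteq> 0.\<close>

lemma closure_hyp_cone:
  assumes f: "homogeneous_deg f d" and e: "hyperbolic f e"
    and a: "a \<in> closure (hyp_cone f e)" "ceval f (cvec a) \<noteq> 0"
  shows "a \<in> hyp_cone f e"
  unfolding hyp_cone_def
proof (intro CollectI allI impI)
  fix t assume t: "ceval f (cvec (a + t *\<^sub>R e)) = 0"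
  note fe = hyperbolic_nonzero[OF e]
  show "t < 0"
  proof (rule ccontr)
    assume "\<not> t < 0"
    then have t0: "t > 0"
      using a(2) t by (cases "t = 0") auto
    let ?V = "{c. cmod (ceval f (cvec e)) * t ^ d \<le> cmod (ceval f (cvec (c + t *\<^sub>R e)))}"
    have "c \<in> ?V" if c: "c \<in> hyp_cone f e" for c
    proof -
      have "t \<le> cmod (of_real t - r)" if "r \<in># line_roots f (cvec e) (cvec c)" for r
      proof -
        have r: "ceval f (cvec c + r *s cvec e) = 0"
          using that line_roots_factorization(3)[OF f fe] by blast
        then obtain s where s: "r = of_real s"
          using e by (metis hyperbolic_def Reals_cases)
        then have "s < 0"
          using r c by (simp add: hyp_cone_def cvec_add cvec_scaleR)
        then show ?thesis
          by (simp add: s flip: of_real_diff)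
      qed
      then have "t ^ d \<le> cmod (\<Prod>r\<in>#line_roots f (cvec e) (cvec c). of_real t - r)"
        using norm_prod_mset_ge[of "line_roots f (cvec e) (cvec c)" t "of_real t"] t0
        by (simp add: line_roots_factorization(1)[OF f fe])
      then show ?thesis
        by (simp add: cvec_add cvec_scaleR line_roots_factorization(2)[OF f fe] norm_mult mult_left_mono)
    qed
    moreover have "closed ?V"
      by (intro closed_Collect_le continuous_intros)
    ultimately have "a \<in> ?V"
      using a(1) closure_minimal[of "hyp_cone f e" ?V] by blast
    then show False
      using t fe t0 zero_less_power[OF t0, of d] by (simp add: mult_le_0_iff del: zero_less_power)
  qed
qed

text \<open>Within the hyperbolic directions the cone is open and, by
  \<open>closure_hyp_cone\<close>, relatively closed; a connected set that meets it cannot leave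
  it.\<close>

lemma hyp_cone_absorb:
  assumes f: "homogeneous_deg f d" and e: "hyperbolic f e"
    and T: "connected T" "T \<subseteq> {e. hyperbolic f e}" "T \<inter> hyp_cone f e \<noteq> {}"
  shows "T \<subseteq> hyp_cone f e"
proof -
  have "openin (top_of_set T) (T \<inter> hyp_cone f e)"
    using open_hyp_cone[OF f hyperbolic_nonzero[OF e]] by (simp add: openin_open_Int)
  moreover have "T \<inter> hyp_cone f e = T \<inter> closure (hyp_cone f e)"
    using closure_hyp_cone[OF f e] T(2) closure_subset[of "hyp_cone f e"] hyperbolic_nonzero by blast
  then have "closedin (top_of_set T) (T \<inter> hyp_cone f e)"
    by (simp add: closedin_closed_Int)
  ultimately show ?thesis
    using T connected_clopen[of T] by blast
qed

lemma connected_hyp_cone: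
  assumes f: "homogeneous_deg f d" and e: "ceval f (cvec e) \<noteq> 0"
  shows "connected (hyp_cone f e)"
  by (rule starlike_imp_connected, unfold starlike_def)
     (intro bexI[OF _ hyp_cone_self[OF f e]] ballI hyp_cone_starlike[OF f e])

lemma hyp_cone_eqI:
  assumes f: "homogeneous_deg f d" and e: "hyperbolic f e" and a: "a \<in> hyp_cone f e"
  shows "hyp_cone f a = hyp_cone f e"
proof -
  have a': "hyperbolic f a"
    using hyp_cone_imp_hyperbolic[OF assms] .
  note ne = hyperbolic_nonzero[OF e] and na = hyperbolic_nonzero[OF a']
  have "a \<in> hyp_cone f a"
    using hyp_cone_self[OF f na] .
  show ?thesis
  proof
    show "hyp_cone f a \<subseteq> hyp_cone f e"
      using hyp_cone_absorb[OF f e connected_hyp_cone[OF f na] hyp_cone_subset_hyperbolic[OF f a']] a \<open>a \<in> hyp_cone f a\<close>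
      by blast
    show "hyp_cone f e \<subseteq> hyp_cone f a"
      using hyp_cone_absorb[OF f a' connected_hyp_cone[OF f ne] hyp_cone_subset_hyperbolic[OF f e]] a \<open>a \<in> hyp_cone f a\<close>
      by blast
  qed
qed

lemma hyp_cone_eq_of_connected:
  assumes f: "homogeneous_deg f d" and e: "hyperbolic f e"
    and T: "connected T" "T \<subseteq> {e. hyperbolic f e}" "e \<in> T" "a \<in> T"
  shows "a \<in> hyp_cone f e"
  using hyp_cone_absorb[OF f e T(1,2)] hyp_cone_self[OF f hyperbolic_nonzero[OF e]] T by blast

text \<open>The cone is star-shaped about \<open>e\<close>, and each of its points may replace
  \<open>e\<close> without changing the cone.\<close>

lemma convex_hyp_cone:
  assumes f: "homogeneous_deg f d" and e: "hyperbolic f e"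
  shows "convex (hyp_cone f e)"
  unfolding convex_contains_segment
proof (intro ballI)
  fix a b assume a: "a \<in> hyp_cone f e" and b: "b \<in> hyp_cone f e"
  have "hyperbolic f a"
    using hyp_cone_imp_hyperbolic[OF f e a] .
  then show "closed_segment a b \<subseteq> hyp_cone f e"
    using hyp_cone_starlike[OF f hyperbolic_nonzero, of a b] hyp_cone_eqI[OF f e a] b by simp
qed

lemma open_hyperbolic:
  assumes f: "homogeneous_deg f d"
  shows "open {e. hyperbolic f e}"
proof -
  have "{e. hyperbolic f e} = (\<Union>e\<in>{e. hyperbolic f e}. hyp_cone f e)"
    using hyp_cone_self[OF f] hyperbolic_nonzero hyp_cone_imp_hyperbolic[OF f] by blast
  then show ?thesis
    using open_hyp_cone[OF f] hyperbolic_nonzero by (metis (no_types, lifting) mem_Collect_eq open_UN)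
qed

text \<open>A component contains the whole cone of any of its points, so picking one such cone per
  component is injective.\<close>

lemma card_components_le_hyp_cones:
  assumes f: "homogeneous_deg f d" and fin: "finite (hyp_cones f)"
  shows "finite (components (UNIV - imag_proj f)) \<and> card (components (UNIV - imag_proj f)) \<le> card (hyp_cones f)"
proof -
  let ?\<Omega> = "{e. hyperbolic f e}"
  define h where "h c = hyp_cone f (SOME e. e \<in> c)" for c :: "(real ^ 'a) set"
  have h: "h c \<in> hyp_cones f \<and> h c \<subseteq> c \<and> h c \<noteq> {}" if c: "c \<in> components ?\<Omega>" for c
  proof -
    define e where "e = (SOME e. e \<in> c)"
    have ec: "e \<in> c"
      using in_components_nonempty[OF c] unfolding e_def by (simp add: some_in_eq)
    then have e: "hyperbolic f e"
      using in_components_subset[OF c] by auto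
    have "e \<in> hyp_cone f e"
      using hyp_cone_self[OF f hyperbolic_nonzero[OF e]] .
    moreover from this have "hyp_cone f e \<subseteq> c"
      using components_maximal[OF c connected_hyp_cone[OF f hyperbolic_nonzero[OF e]] hyp_cone_subset_hyperbolic[OF f e]] ec
      by blast
    ultimately show ?thesis
      using e by (auto simp: h_def hyp_cones_def simp flip: e_def)
  qed
  have "inj_on h (components ?\<Omega>)"
  proof (rule inj_onI)
    fix c c' assume "c \<in> components ?\<Omega>" "c' \<in> components ?\<Omega>" "h c = h c'"
    then have "c \<inter> c' \<noteq> {}"
      using h by blast
    then show "c = c'"
      using components_nonoverlap \<open>c \<in> _\<close> \<open>c' \<in> _\<close> by blast
  qed
  moreover have "h ` components ?\<Omega> \<subseteq> hyp_cones f"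
    using h by blast
  ultimately show ?thesis
    unfolding compl_imag_proj[OF f] using fin by (simp add: card_inj_on_le inj_on_finite)
qed

section \<open>Boundary values and roots in the upper half plane\<close>

text \<open>Cauchy's inequality applied to \<open>exp (- i g / M)\<close>, whose modulus only depends on \<open>Im g\<close>.\<close>

lemma deriv_bound_Im:
  assumes g: "g holomorphic_on ball z r" and "r > 0" "M > 0"
    and M: "\<And>w. w \<in> ball z r \<Longrightarrow> \<bar>Im (g w)\<bar> \<le> M"
  shows "cmod (deriv g z) \<le> 2 * exp 2 * M / r"
proof -
  define h where "h w = exp (- \<i> * g w / of_real M)" for w
  have h: "h holomorphic_on ball z r"
    unfolding h_def by (intro holomorphic_intros g) (use \<open>M > 0\<close> in auto)
  have norm_h: "cmod (h w) = exp (Im (g w) / M)" for w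
    using \<open>M > 0\<close> by (simp add: h_def Re_divide power2_eq_square)
  \<comment> \<open>The radius r / 2 keeps the closed disc inside the ball and accounts for the
    factor 2; |h| <= e on the circle together with |h| >= 1 / e at the centre accounts for
    \<open>exp 2\<close>.\<close>
  have "cmod ((deriv ^^ 1) h z) \<le> fact 1 * exp 1 / (r / 2) ^ 1"
  proof (rule Cauchy_inequality)
    show "h holomorphic_on ball z (r / 2)"
      by (rule holomorphic_on_subset[OF h]) (use \<open>r > 0\<close> in auto)
    show "continuous_on (cball z (r / 2)) h"
      by (rule continuous_on_subset[OF holomorphic_on_imp_continuous_on[OF h]]) (use \<open>r > 0\<close> in auto)
    fix w assume "cmod (z - w) = r / 2"
    then have "\<bar>Im (g w)\<bar> \<le> M"
      using \<open>r > 0\<close> by (intro M) (simp add: dist_norm)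
    then show "cmod (h w) \<le> exp 1"
      using \<open>M > 0\<close> by (simp add: norm_h)
  qed (use \<open>r > 0\<close> in auto)
  then have "cmod (deriv h z) \<le> 2 * exp 1 / r"
    by (simp add: mult.commute)
  moreover have "deriv h z = - \<i> * deriv g z / of_real M * h z"
  proof (rule DERIV_imp_deriv)
    have "(g has_field_derivative deriv g z) (at z)"
      using g \<open>r > 0\<close> by (intro holomorphic_derivI[of _ "ball z r"]) auto
    note [derivative_intros] = this
    show "(h has_field_derivative - \<i> * deriv g z / of_real M * h z) (at z)"
      unfolding h_def by (rule derivative_eq_intros refl | use \<open>M > 0\<close> in simp)+
  qed
  then have "cmod (deriv h z) = cmod (deriv g z) / M * exp (Im (g z) / M)"
    using \<open>M > 0\<close> by (simp add: norm_mult norm_divide norm_h)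
  moreover have "exp (- 1) \<le> exp (Im (g z) / M)"
    using M[of z] \<open>r > 0\<close> \<open>M > 0\<close> by (simp add: field_simps)
  then have "cmod (deriv g z) / M * exp (- 1) \<le> cmod (deriv g z) / M * exp (Im (g z) / M)"
    using \<open>M > 0\<close> by (intro mult_left_mono) auto
  ultimately have "cmod (deriv g z) / M * exp (- 1) \<le> 2 * exp 1 / r"
    by linarith
  then have "cmod (deriv g z) \<le> 2 * (exp 1 * exp 1) * M / r"
    using \<open>M > 0\<close> \<open>r > 0\<close> by (simp add: exp_minus field_simps)
  also have "exp 1 * exp 1 = exp (2::real)"
    by (simp flip: exp_add)
  finally show ?thesis .
qed

text \<open>The radius \<open>r\<close> may depend on the point: it cancels in the derivative
  estimate, so the Lipschitz constant does not deteriorate where the available balls shrink.\<close>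

lemma Lipschitz_bound_Im:
  assumes g: "g holomorphic_on S" "open S" and T: "convex T" and "L \<ge> 0"
    and sub: "\<And>w. w \<in> T \<Longrightarrow> \<exists>r>0. ball w r \<subseteq> S \<and> (\<forall>v\<in>ball w r. \<bar>Im (g v)\<bar> \<le> L * r)"
    and "x \<in> T" "y \<in> T"
  shows "cmod (g x - g y) \<le> 2 * exp 2 * (L + 1) * cmod (x - y)"
proof (rule field_differentiable_bound[OF T _ _ \<open>x \<in> T\<close> \<open>y \<in> T\<close>])
  fix w assume "w \<in> T"
  then obtain r where r: "r > 0" "ball w r \<subseteq> S" "\<And>v. v \<in> ball w r \<Longrightarrow> \<bar>Im (g v)\<bar> \<le> L * r"
    using sub by meson
  then have "w \<in> S"
    by auto
  then show "(g has_field_derivative deriv g w) (at w within T)"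
    using g holomorphic_derivI has_field_derivative_at_within by blast
  \<comment> \<open>\<open>L + 1\<close> keeps the bound strictly positive, as
    \<open>deriv_bound_Im\<close> requires, even if \<open>L = 0\<close>.\<close>
  have "\<bar>Im (g v)\<bar> \<le> (L + 1) * r" if "v \<in> ball w r" for v
    using r(3)[OF that] r(1) by (simp add: algebra_simps)
  then have "cmod (deriv g w) \<le> 2 * exp 2 * ((L + 1) * r) / r"
    using r \<open>L \<ge> 0\<close> by (intro deriv_bound_Im holomorphic_on_subset[OF g(1)]) auto
  then show "cmod (deriv g w) \<le> 2 * exp 2 * (L + 1)"
    using r(1) by simp
qed

text \<open>The bound on \<open>Im (\<phi> s)\<close> is used twice: on balls of radius
  \<open>Im s\<close> it makes \<phi> Lipschitz up to the real axis, and it forces the boundary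
  values to be real, as reflection requires. The growth exponent \<open>k\<close> becomes the degree
  bound.\<close>

lemma half_plane_boundary_polynomial:
  assumes \<phi>: "\<phi> holomorphic_on {s. Im s > 0}" and "A \<ge> 0" "B \<ge> 0"
    and A: "\<And>s. Im s > 0 \<Longrightarrow> cmod (\<phi> s) \<le> A * (1 + cmod s) ^ k"
    and B: "\<And>s. Im s > 0 \<Longrightarrow> \<bar>Im (\<phi> s)\<bar> \<le> B * (1 + cmod s) ^ m * Im s"
  shows "\<exists>p :: real poly. degree p \<le> k \<and>
    (\<forall>u. ((\<lambda>\<epsilon>. \<phi> (of_real u + \<i> * of_real \<epsilon>)) \<longlongrightarrow> of_real (poly p u)) (at_right 0))"
proof -
  \<comment> \<open>In the ball of radius \<open>Im w\<close> about a point \<open>w\<close> with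
    |w| < R, moduli are at most 2 R and imaginary parts at most 2 Im w; this yields the factors
    \<open>1 + 2 * R\<close> and 2. The rest comes from \<open>Lipschitz_bound_Im\<close>.\<close>
  define L where "L R = 2 * exp 2 * (B * (1 + 2 * R) ^ m * 2 + 1)" for R :: real
  have opn: "open {s. Im s > 0}"
    by (rule open_halfspace_Im_gt)
  have lip: "cmod (\<phi> x - \<phi> y) \<le> L R * cmod (x - y)"
    if "Im x > 0" "Im y > 0" "cmod x < R" "cmod y < R" for x y R
    unfolding L_def
  proof (rule Lipschitz_bound_Im[OF \<phi> opn, where T = "{s. Im s > 0} \<inter> ball 0 R"])
    show "convex ({s. Im s > 0} \<inter> ball 0 R)"
      by (intro convex_Int convex_halfspace_Im_gt convex_ball)
    have "R > 0"
      using that norm_ge_zero[of x] by linarith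
    then show "0 \<le> B * (1 + 2 * R) ^ m * 2"
      using \<open>B \<ge> 0\<close> by simp
    fix w assume w: "w \<in> {s. Im s > 0} \<inter> ball 0 R"
    show "\<exists>r>0. ball w r \<subseteq> {s. Im s > 0} \<and> (\<forall>v\<in>ball w r. \<bar>Im (\<phi> v)\<bar> \<le> B * (1 + 2 * R) ^ m * 2 * r)"
    proof (intro exI[of _ "Im w"] conjI ballI subsetI CollectI)
      fix v assume v: "v \<in> ball w (Im w)"
      have Im: "\<bar>Im w - Im v\<bar> < Im w"
        using v abs_Im_le_cmod[of "w - v"] by (simp add: dist_norm)
      then show "Im v > 0"
        by simp
      have "Im w < R"
        using w abs_Im_le_cmod[of w] by simp
      then have "cmod v \<le> 2 * R"
        using v w norm_triangle_ineq2[of v w] by (simp add: dist_norm norm_minus_commute)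
      then have "B * (1 + cmod v) ^ m * Im v \<le> B * (1 + 2 * R) ^ m * (2 * Im w)"
        using Im \<open>B \<ge> 0\<close> \<open>R > 0\<close> by (intro mult_mono power_mono) auto
      then show "\<bar>Im (\<phi> v)\<bar> \<le> B * (1 + 2 * R) ^ m * 2 * Im w"
        using B[OF \<open>Im v > 0\<close>] by (simp add: mult_ac)
    qed (use w in simp)
  qed (use that in auto)
  define \<eta> where "\<eta> n = \<i> * of_real (1 / real (Suc n))" for n
  have Im_\<eta>: "Im (\<eta> n) = 1 / real (Suc n)" "cmod (\<eta> n) = 1 / real (Suc n)" for n
    by (auto simp: \<eta>_def norm_mult norm_divide simp del: of_nat_Suc)
  have \<eta>_pos: "Im (\<eta> n) > 0" and \<eta>_le: "cmod (\<eta> n) \<le> 1" for n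
    unfolding Im_\<eta> by (auto simp: divide_le_eq)
  have \<eta>: "\<eta> \<longlonglongrightarrow> 0"
    by (rule tendsto_norm_zero_cancel) (simp only: Im_\<eta> LIMSEQ_inverse_real_of_nat[unfolded inverse_eq_divide])
  \<comment> \<open>Approaching along \<open>s + \<eta> n\<close> defines the extension on the real
    axis; above it, continuity gives back \<phi>.\<close>
  define F where "F s = lim (\<lambda>n. \<phi> (s + \<eta> n))" for s
  have F: "(\<lambda>n. \<phi> (s + \<eta> n)) \<longlonglongrightarrow> F s" if "Im s \<ge> 0" for s
  proof -
    define R where "R = cmod s + 2"
    have R: "cmod (s + \<eta> n) < R" for n
      using norm_triangle_ineq[of s "\<eta> n"] \<eta>_le[of n] by (simp add: R_def)
    have "Cauchy (\<lambda>n. \<phi> (s + \<eta> n))"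
    proof (rule CauchyI)
      fix e :: real assume "e > 0"
      have L: "L R > 0"
        using \<open>B \<ge> 0\<close> by (auto simp: L_def R_def intro!: mult_pos_pos add_nonneg_pos)
      have "Cauchy \<eta>"
        using \<eta> by (rule LIMSEQ_imp_Cauchy)
      then obtain N where N: "\<And>m n. m \<ge> N \<Longrightarrow> n \<ge> N \<Longrightarrow> cmod (\<eta> m - \<eta> n) < e / L R"
        using CauchyD[of \<eta> "e / L R"] \<open>e > 0\<close> L by auto
      have "cmod (\<phi> (s + \<eta> m) - \<phi> (s + \<eta> n)) < e" if "m \<ge> N" "n \<ge> N" for m n
      proof -
        have "cmod (\<phi> (s + \<eta> m) - \<phi> (s + \<eta> n)) \<le> L R * cmod (\<eta> m - \<eta> n)"
          using lip[of "s + \<eta> m" "s + \<eta> n" R] R \<open>Im s \<ge> 0\<close> \<eta>_pos[of m] \<eta>_pos[of n] by simp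
        also have "\<dots> < e"
          using N[OF that] L by (simp add: field_simps)
        finally show ?thesis .
      qed
      then show "\<exists>N. \<forall>m\<ge>N. \<forall>n\<ge>N. cmod (\<phi> (s + \<eta> m) - \<phi> (s + \<eta> n)) < e"
        by blast
    qed
    then show ?thesis
      unfolding F_def by (simp add: Cauchy_convergent_iff convergent_LIMSEQ_iff)
  qed
  have F_eq: "F s = \<phi> s" if "Im s > 0" for s
  proof -
    have "isCont \<phi> s"
      using holomorphic_on_imp_continuous_on[OF \<phi>] that unfolding continuous_on_eq_continuous_at[OF opn] by simp
    moreover have "(\<lambda>n. s + \<eta> n) \<longlonglongrightarrow> s"
      using tendsto_add[OF tendsto_const \<eta>, of s] by simp
    ultimately have "(\<lambda>n. \<phi> (s + \<eta> n)) \<longlonglongrightarrow> \<phi> s"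
      using isCont_tendsto_compose by blast
    then show ?thesis
      using F[of s] that LIMSEQ_unique by force
  qed
  have F_lip: "cmod (F x - F y) \<le> L R * cmod (x - y)"
    if "Im x \<ge> 0" "Im y \<ge> 0" "cmod x + 1 < R" "cmod y + 1 < R" for x y R
  proof (rule tendsto_upperbound)
    show "(\<lambda>n. cmod (\<phi> (x + \<eta> n) - \<phi> (y + \<eta> n))) \<longlonglongrightarrow> cmod (F x - F y)"
      by (intro tendsto_intros F that)
    have "cmod (\<phi> (x + \<eta> n) - \<phi> (y + \<eta> n)) \<le> L R * cmod (x - y)" for n
      using lip[of "x + \<eta> n" "y + \<eta> n" R] \<eta>_pos[of n] \<eta>_le[of n] norm_triangle_ineq[of x "\<eta> n"]
        norm_triangle_ineq[of y "\<eta> n"] that by simp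
    then show "\<forall>\<^sub>F n in sequentially. cmod (\<phi> (x + \<eta> n) - \<phi> (y + \<eta> n)) \<le> L R * cmod (x - y)"
      by simp
  qed simp
  have contF: "continuous_on {s. Im s \<ge> 0} F"
  proof (rule continuous_onI)
    fix x e assume x: "x \<in> {s. Im s \<ge> 0}" and "0 < (e::real)"
    define R where "R = cmod x + 3"
    have L: "L R > 0"
      using \<open>B \<ge> 0\<close> by (auto simp: L_def R_def intro!: mult_pos_pos add_nonneg_pos)
    show "\<exists>d>0. \<forall>x'\<in>{s. 0 \<le> Im s}. dist x' x < d \<longrightarrow> dist (F x') (F x) \<le> e"
    proof (intro exI[of _ "min 1 (e / L R)"] conjI ballI impI)
      fix y assume y: "y \<in> {s. Im s \<ge> 0}" "dist y x < min 1 (e / L R)"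
      have "cmod y \<le> cmod x + 1"
        using y(2) norm_triangle_ineq2[of y x] by (simp add: dist_norm)
      then have "cmod (F y - F x) \<le> L R * cmod (y - x)"
        using x y by (intro F_lip) (auto simp: R_def)
      also have "\<dots> \<le> e"
        using y(2) L by (simp add: dist_norm field_simps)
      finally show "dist (F y) (F x) \<le> e"
        by (simp add: dist_norm)
    qed (use \<open>e > 0\<close> L in auto)
  qed
  have F_real: "F s \<in> \<real>" if "s \<in> \<real>" for s
  proof -
    have Ims: "Im s = 0"
      using that by (simp add: complex_is_Real_iff)
    have "(\<lambda>n. B * (1 + cmod (s + \<eta> n)) ^ m * Im (\<eta> n)) \<longlonglongrightarrow> B * (1 + cmod (s + 0)) ^ m * Im 0"
      by (intro tendsto_intros \<eta>)
    moreover have "\<bar>Im (\<phi> (s + \<eta> n))\<bar> \<le> B * (1 + cmod (s + \<eta> n)) ^ m * Im (\<eta> n)" for n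
      using B[of "s + \<eta> n"] \<eta>_pos[of n] Ims by simp
    ultimately have "(\<lambda>n. Im (\<phi> (s + \<eta> n))) \<longlonglongrightarrow> 0"
      by (rule_tac Lim_null_comparison[where g = "\<lambda>n. B * (1 + cmod (s + \<eta> n)) ^ m * Im (\<eta> n)"]) simp_all
    moreover have "(\<lambda>n. Im (\<phi> (s + \<eta> n))) \<longlonglongrightarrow> Im (F s)"
      by (intro tendsto_intros F) (simp add: Ims)
    ultimately show ?thesis
      using LIMSEQ_unique complex_is_Real_iff by blast
  qed
  define G where "G = (\<lambda>z. if 0 \<le> Im z then F z else cnj (F (cnj z)))"
  have G: "G holomorphic_on UNIV"
    unfolding G_def
  proof (rule Schwarz_reflection)
    show "F holomorphic_on UNIV \<inter> {z. 0 < Im z}"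
      unfolding Int_UNIV_left using \<phi> by (rule holomorphic_transform) (simp add: F_eq)
  qed (use contF F_real in auto)
  \<comment> \<open>For |s| >= 1 one has 1 + |s + \<eta> n| <= 3 |s|, which explains
    \<open>3 ^ k\<close>.\<close>
  have F_bound: "cmod (F s) \<le> A * 3 ^ k * cmod s ^ k" if "Im s \<ge> 0" "cmod s \<ge> 1" for s
  proof (rule tendsto_upperbound)
    show "(\<lambda>n. cmod (\<phi> (s + \<eta> n))) \<longlonglongrightarrow> cmod (F s)"
      by (intro tendsto_intros F that)
    have "cmod (\<phi> (s + \<eta> n)) \<le> A * 3 ^ k * cmod s ^ k" for n
    proof -
      have "cmod (\<phi> (s + \<eta> n)) \<le> A * (1 + cmod (s + \<eta> n)) ^ k"
        using that \<eta>_pos[of n] by (intro A) simp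
      also have "\<dots> \<le> A * (3 * cmod s) ^ k"
        using norm_triangle_ineq[of s "\<eta> n"] \<eta>_le[of n] that \<open>A \<ge> 0\<close>
        by (intro mult_left_mono power_mono) auto
      finally show ?thesis
        by (simp add: power_mult_distrib mult_ac)
    qed
    then show "\<forall>\<^sub>F n in sequentially. cmod (\<phi> (s + \<eta> n)) \<le> A * 3 ^ k * cmod s ^ k"
      by simp
  qed simp
  have G_bound: "cmod (G s) \<le> A * 3 ^ k * cmod s ^ k" if "1 \<le> cmod s" for s
    using F_bound[of s] F_bound[of "cnj s"] that by (auto simp: G_def)
  define c where "c j = (deriv ^^ j) G 0 / fact j" for j
  have G_poly: "G s = (\<Sum>j\<le>k. c j * s ^ j)" for s
    unfolding c_def using Liouville_polynomial[OF G G_bound] by simp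
  \<comment> \<open>\<open>G\<close> is real on the real axis, so replacing its coefficients by
    their real parts does not change the values there.\<close>
  define p where "p = (\<Sum>j\<le>k. monom (Re (c j)) j)"
  show ?thesis
  proof (intro exI[of _ p] conjI allI)
    show "degree p \<le> k"
      unfolding p_def by (intro degree_sum_le) (auto intro: order_trans[OF degree_monom_le])
    fix u :: real
    have "Re (G (of_real u)) = poly p u"
      by (simp add: G_poly p_def poly_sum poly_monom flip: of_real_power)
    moreover have "G (of_real u) = F (of_real u)"
      by (simp add: G_def)
    ultimately have Fu: "F (of_real u) = of_real (poly p u)"
      using F_real[of "of_real u"] by (simp add: complex_eq_iff complex_is_Real_iff)
    have "((\<lambda>\<epsilon>. F (of_real u + \<i> * of_real \<epsilon>)) \<longlongrightarrow> F (of_real u)) (at_right 0)"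
    proof (rule continuous_on_tendsto_compose[OF contF])
      have "((\<lambda>\<epsilon>. of_real u + \<i> * of_real \<epsilon>) \<longlongrightarrow> of_real u + \<i> * of_real 0) (at_right (0::real))"
        by (intro tendsto_intros)
      then show "((\<lambda>\<epsilon>. of_real u + \<i> * of_real \<epsilon>) \<longlongrightarrow> of_real u) (at_right (0::real))"
        by simp
      show "\<forall>\<^sub>F \<epsilon> in at_right 0. of_real u + \<i> * of_real \<epsilon> \<in> {s. Im s \<ge> 0}"
        by (auto simp: eventually_at_filter)
    qed simp
    moreover have "\<forall>\<^sub>F \<epsilon> in at_right 0. F (of_real u + \<i> * of_real \<epsilon>) = \<phi> (of_real u + \<i> * of_real \<epsilon>)"
      by (auto simp: eventually_at_filter F_eq)
    ultimately show "((\<lambda>\<epsilon>. \<phi> (of_real u + \<i> * of_real \<epsilon>)) \<longlongrightarrow> of_real (poly p u)) (at_right 0)"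
      using Fu Lim_transform_eventually by force
  qed
qed

section \<open>Holomorphic dependence of sums over the upper roots\<close>

lemma DERIV_prod_mset_linear:
  fixes A :: "complex multiset"
  assumes "\<And>r. r \<in># A \<Longrightarrow> t \<noteq> r"
  shows "((\<lambda>t. \<Prod>r\<in>#A. t - r) has_field_derivative (\<Prod>r\<in>#A. t - r) * (\<Sum>r\<in>#A. 1 / (t - r))) (at t)"
  using assms
proof (induction A)
  case (add x A)
  then have "t - x \<noteq> 0" and IH: "((\<lambda>t. \<Prod>r\<in>#A. t - r) has_field_derivative (\<Prod>r\<in>#A. t - r) * (\<Sum>r\<in>#A. 1 / (t - r))) (at t)"
    by auto
  show ?case
    by (auto intro!: derivative_eq_intros IH) (use \<open>t - x \<noteq> 0\<close> in \<open>auto simp: field_simps\<close>)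
qed simp

text \<open>A circle around \<open>i R\<close> of radius slightly less than \<open>R\<close> encloses exactly the roots in the upper half plane.\<close>

lemma upper_roots_sum_holomorphic:
  fixes A :: "complex \<Rightarrow> complex multiset" and c :: "nat \<Rightarrow> complex \<Rightarrow> complex"
  assumes D: "open D" "convex D" and c: "\<And>j. j \<le> d \<Longrightarrow> c j holomorphic_on D" and "C \<noteq> 0"
    and Q: "\<And>s t. s \<in> D \<Longrightarrow> (\<Sum>j\<le>d. c j s * t ^ j) = C * (\<Prod>r\<in>#A s. t - r)"
    and bd: "\<And>s r. s \<in> D \<Longrightarrow> r \<in># A s \<Longrightarrow> cmod r \<le> M \<and> \<delta> \<le> \<bar>Im r\<bar>" and "\<delta> > 0"
    and \<phi>: "\<phi> holomorphic_on {t. Im t > 0}"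
  shows "(\<lambda>s. \<Sum>r\<in>#filter_mset (\<lambda>r. Im r > 0) (A s). \<phi> r) holomorphic_on D"
proof -
  define N where "N = max M \<delta>"
  have N: "N \<ge> \<delta>" "N > 0" "\<And>s r. s \<in> D \<Longrightarrow> r \<in># A s \<Longrightarrow> cmod r \<le> N"
    using bd \<open>\<delta> > 0\<close> by (force simp: N_def)+
  \<comment> \<open>Chosen so that an upper root satisfies |r - i R|^2 <= N^2 - 2 R \<delta> + R^2 =
    R^2 - N^2, which is below the value R^2 - N^2 / 2 of \<open>\<rho>\<^sup>2\<close>. The circle
    thus encloses the root and, as \<rho> < R, stays away from the real axis.\<close>
  define R where "R = N\<^sup>2 / \<delta>"
  have "R \<ge> N"
    using N(1,2) \<open>\<delta> > 0\<close> by (simp add: R_def power2_eq_square field_simps)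
  then have "R > 0" "N\<^sup>2 \<le> R\<^sup>2"
    using N(2) by auto
  have N2: "N\<^sup>2 > 0"
    using N(2) by simp
  define \<rho> where "\<rho> = sqrt (R\<^sup>2 - N\<^sup>2 / 2)"
  have \<rho>2: "\<rho>\<^sup>2 = R\<^sup>2 - N\<^sup>2 / 2" and "\<rho> > 0"
  proof -
    have "R\<^sup>2 - N\<^sup>2 / 2 > 0"
      using \<open>N\<^sup>2 \<le> R\<^sup>2\<close> N2 by linarith
    then show "\<rho>\<^sup>2 = R\<^sup>2 - N\<^sup>2 / 2" "\<rho> > 0"
      by (simp_all add: \<rho>_def)
  qed
  have "\<rho> < R"
    by (rule power2_less_imp_less) (use \<rho>2 N2 \<open>R > 0\<close> in auto)
  let ?o = "\<i> * of_real R"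
  have ballH: "Im t > 0" if "t \<in> ball ?o R" for t
    using that abs_Im_le_cmod[of "?o - t"] by (simp add: dist_norm)
  have sphereball: "cball ?o \<rho> \<subseteq> ball ?o R"
    using \<open>\<rho> < R\<close> by auto
  have inside: "cmod (r - ?o) < \<rho>" if "s \<in> D" "r \<in># A s" "Im r > 0" for s r
  proof -
    have "(cmod (r - ?o))\<^sup>2 = (cmod r)\<^sup>2 - 2 * R * Im r + R\<^sup>2"
      unfolding cmod_power2 by (simp add: power2_eq_square algebra_simps)
    also have "\<dots> \<le> N\<^sup>2 - 2 * R * \<delta> + R\<^sup>2"
      using N(3)[OF that(1,2)] bd[OF that(1,2)] \<open>R > 0\<close> that(3)
      by (intro add_mono diff_mono power_mono) auto
    also have "\<dots> < \<rho>\<^sup>2"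
      using \<open>\<delta> > 0\<close> N2 by (simp add: \<rho>2 R_def)
    finally show ?thesis
      by (rule power2_less_imp_less) (use \<open>\<rho> > 0\<close> in simp)
  qed
  have outside: "cmod (r - ?o) > \<rho> \<and> r \<notin> ball ?o R" if "s \<in> D" "r \<in># A s" "\<not> Im r > 0" for s r
  proof -
    have "Im r < 0"
      using bd[OF that(1,2)] \<open>\<delta> > 0\<close> that(3) by force
    then have "cmod (r - ?o) > R"
      using abs_Im_le_cmod[of "r - ?o"] \<open>R > 0\<close> by simp
    then show ?thesis
      using \<open>\<rho> < R\<close> by (auto simp: dist_norm norm_minus_commute)
  qed
  let ?\<gamma> = "circlepath ?o \<rho>"
  have \<gamma>_sphere: "cmod (?\<gamma> x - ?o) = \<rho>" for x
    using \<open>\<rho> > 0\<close> by (simp add: circlepath norm_mult)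
  \<comment> \<open>\<open>q1\<close> and \<open>qs\<close> are the derivatives of \<open>q\<close>
    with respect to \<open>t\<close> and \<open>s\<close>, and \<open>q1s\<close> is the mixed
    one.\<close>
  define q where "q s t = (\<Sum>j\<le>d. c j s * t ^ j)" for s t
  define q1 where "q1 s t = (\<Sum>j\<le>d. c j s * (of_nat j * t ^ (j - 1)))" for s t
  define qs where "qs s t = (\<Sum>j\<le>d. deriv (c j) s * t ^ j)" for s t
  define q1s where "q1s s t = (\<Sum>j\<le>d. deriv (c j) s * (of_nat j * t ^ (j - 1)))" for s t
  have notroot: "t \<noteq> r" if "s \<in> D" "cmod (t - ?o) = \<rho>" "r \<in># A s" for s t r
    using inside[OF that(1,3)] outside[OF that(1,3)] that(2) by (cases "Im r > 0") auto
  have q_nz: "q s t \<noteq> 0" if "s \<in> D" "cmod (t - ?o) = \<rho>" for s t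
    using notroot[OF that] \<open>C \<noteq> 0\<close> by (auto simp: q_def Q[OF that(1)] prod_mset_zero_iff)
  have logderiv: "q1 s t / q s t = (\<Sum>r\<in>#A s. 1 / (t - r))" if "s \<in> D" "cmod (t - ?o) = \<rho>" for s t
  proof -
    have "((\<lambda>t. q s t) has_field_derivative q1 s t) (at t)"
      unfolding q_def q1_def by (auto intro!: derivative_eq_intros sum.cong)
    moreover have "((\<lambda>t. q s t) has_field_derivative C * ((\<Prod>r\<in>#A s. t - r) * (\<Sum>r\<in>#A s. 1 / (t - r)))) (at t)"
      unfolding q_def Q[OF that(1)] by (intro DERIV_cmult DERIV_prod_mset_linear notroot[OF that])
    ultimately have "q1 s t = q s t * (\<Sum>r\<in>#A s. 1 / (t - r))"
      using DERIV_unique by (fastforce simp: q_def Q[OF that(1)])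
    then show ?thesis
      using q_nz[OF that] by simp
  qed
  \<comment> \<open>Lower roots lie outside the ball of radius \<open>R\<close>, on which \<phi> is
    holomorphic, so they contribute 0; upper roots contribute by Cauchy's formula. Induction on a
    submultiset accounts for multiplicities.\<close>
  have root_int: "((\<lambda>t. \<Sum>r\<in>#B. \<phi> t / (t - r)) has_contour_integral
        2 * of_real pi * \<i> * (\<Sum>r\<in>#filter_mset (\<lambda>r. Im r > 0) B. \<phi> r)) ?\<gamma>"
    if "s \<in> D" "B \<subseteq># A s" for s B
    using that(2)
  proof (induction B)
    case (add r B)
    then have r: "r \<in># A s" and B: "B \<subseteq># A s"
      using insert_subset_eq_iff mset_subset_eq_insertD subset_mset.less_imp_le by (metis, metis)
    have "((\<lambda>t. \<phi> t / (t - r)) has_contour_integral 2 * of_real pi * \<i> * (if Im r > 0 then \<phi> r else 0)) ?\<gamma>"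
    proof (cases "Im r > 0")
      case True
      have "((\<lambda>t. \<phi> t / (t - r)) has_contour_integral 2 * of_real pi * \<i> * \<phi> r) ?\<gamma>"
      proof (rule Cauchy_integral_circlepath_simple)
        show "\<phi> holomorphic_on cball ?o \<rho>"
          by (rule holomorphic_on_subset[OF \<phi>]) (use ballH sphereball in blast)
      qed (use inside[OF \<open>s \<in> D\<close> r True] in simp)
      then show ?thesis
        using True by simp
    next
      case False
      have "((\<lambda>t. \<phi> t / (t - r)) has_contour_integral 0) ?\<gamma>"
      proof (rule Cauchy_theorem_disc_simple)
        show "(\<lambda>t. \<phi> t / (t - r)) holomorphic_on ball ?o R"
          by (intro holomorphic_intros holomorphic_on_subset[OF \<phi>])
             (use ballH outside[OF \<open>s \<in> D\<close> r False] in auto)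
        show "path_image ?\<gamma> \<subseteq> ball ?o R"
          using \<open>\<rho> > 0\<close> sphereball by (auto simp: path_image_circlepath)
      qed auto
      then show ?thesis
        using False by simp
    qed
    from has_contour_integral_add[OF this add.IH[OF B]] show ?case
      by (auto simp: algebra_simps)
  qed (simp add: has_contour_integral_0)
  \<comment> \<open>The sum over the roots is replaced by the logarithmic derivative
    \<open>q1 / q\<close>, which involves \<open>s\<close> only through the coefficients; holomorphy
    in \<open>s\<close> then follows by differentiating under the integral.\<close>
  define h where "h s x = \<phi> (?\<gamma> x) * (q1 s (?\<gamma> x) / q s (?\<gamma> x)) * vector_derivative ?\<gamma> (at x)" for s x
  have sum_eq: "(\<Sum>r\<in>#filter_mset (\<lambda>r. Im r > 0) (A s). \<phi> r) = 1 / (2 * of_real pi * \<i>) * integral (cbox 0 1) (h s)"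
    if "s \<in> D" for s
  proof -
    have "contour_integral ?\<gamma> (\<lambda>t. \<Sum>r\<in>#A s. \<phi> t / (t - r))
        = 2 * of_real pi * \<i> * (\<Sum>r\<in>#filter_mset (\<lambda>r. Im r > 0) (A s). \<phi> r)"
      by (rule contour_integral_unique[OF root_int[OF that]]) simp
    moreover have "contour_integral ?\<gamma> (\<lambda>t. \<Sum>r\<in>#A s. \<phi> t / (t - r)) = integral {0..1} (h s)"
      unfolding contour_integral_integral
    proof (rule Henstock_Kurzweil_Integration.integral_cong)
      fix x :: real
      have "(\<Sum>r\<in>#A s. \<phi> (?\<gamma> x) / (?\<gamma> x - r)) = \<phi> (?\<gamma> x) * (\<Sum>r\<in>#A s. 1 / (?\<gamma> x - r))"
        by (simp add: sum_mset_distrib_left)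
      then show "(\<Sum>r\<in>#A s. \<phi> (?\<gamma> x) / (?\<gamma> x - r)) * vector_derivative ?\<gamma> (at x) = h s x"
        by (simp add: h_def logderiv[OF that \<gamma>_sphere])
    qed
    ultimately show ?thesis
      by simp
  qed
  define hs where "hs s x = \<phi> (?\<gamma> x) * ((q1s s (?\<gamma> x) * q s (?\<gamma> x) - q1 s (?\<gamma> x) * qs s (?\<gamma> x)) / (q s (?\<gamma> x) * q s (?\<gamma> x)))
     * vector_derivative ?\<gamma> (at x)" for s x
  have cont\<gamma>: "continuous_on S (\<lambda>p. ?\<gamma> (g p))" if "continuous_on S g" for S :: "'z::topological_space set" and g
    unfolding circlepath by (intro continuous_intros that)
  have cont\<phi>: "continuous_on S (\<lambda>p. \<phi> (?\<gamma> (g p)))" if "continuous_on S g" for S :: "'z::topological_space set" and g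
  proof (rule continuous_on_compose2[OF holomorphic_on_imp_continuous_on[OF \<phi>] cont\<gamma>[OF that]])
    have "?\<gamma> x \<in> ball ?o R" for x
      using \<gamma>_sphere[of x] \<open>\<rho> < R\<close> by (simp add: dist_norm norm_minus_commute)
    then show "(\<lambda>p. ?\<gamma> (g p)) ` S \<subseteq> {t. 0 < Im t}"
      using ballH by blast
  qed
  have contc: "continuous_on (D \<times> T) (\<lambda>p. c j (fst p))" "continuous_on (D \<times> T) (\<lambda>p. deriv (c j) (fst p))"
    if "j \<le> d" for T :: "real set" and j
    by (rule continuous_on_compose2[OF holomorphic_on_imp_continuous_on[OF c[OF that]] continuous_on_fst[OF continuous_on_id]], force,
        rule continuous_on_compose2[OF holomorphic_on_imp_continuous_on[OF holomorphic_deriv[OF c[OF that] D(1)]]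
          continuous_on_fst[OF continuous_on_id]], force)
  have "(\<lambda>s. integral (cbox 0 1) (h s)) holomorphic_on D"
  proof (rule leibniz_rule_holomorphic[where fx = hs])
    fix s and x :: real assume s: "s \<in> D"
    have dc: "((\<lambda>s. c j s * a) has_field_derivative deriv (c j) s * a) (at s within D)" if "j \<le> d" for j a
      using holomorphic_derivI[OF c[OF that] D(1) s]
      by (intro DERIV_cmult_right) (rule has_field_derivative_at_within)
    have "((\<lambda>s. q1 s (?\<gamma> x)) has_field_derivative q1s s (?\<gamma> x)) (at s within D)"
      "((\<lambda>s. q s (?\<gamma> x)) has_field_derivative qs s (?\<gamma> x)) (at s within D)"
      unfolding q1_def q1s_def q_def qs_def by (intro DERIV_sum dc; simp)+
    then show "((\<lambda>s. h s x) has_field_derivative hs s x) (at s within D)"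
      unfolding h_def hs_def
      by (intro DERIV_cmult_right DERIV_cmult DERIV_divide q_nz[OF s \<gamma>_sphere])
  next
    fix s assume s: "s \<in> D"
    have "continuous_on (cbox 0 1) (h s)"
      unfolding h_def vector_derivative_circlepath q1_def q_def
      by (intro continuous_intros cont\<phi> cont\<gamma>) (use q_nz[OF s \<gamma>_sphere] in \<open>auto simp: q_def\<close>)
    then show "h s integrable_on cbox 0 1"
      by (rule integrable_continuous)
  next
    show "continuous_on (D \<times> cbox 0 1) (\<lambda>(s, x). hs s x)"
      unfolding hs_def vector_derivative_circlepath q1_def q_def qs_def q1s_def case_prod_beta
      by (intro continuous_intros cont\<phi> cont\<gamma> contc) (use q_nz[OF _ \<gamma>_sphere] in \<open>auto simp: q_def\<close>)
  qed (rule D)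
  then have "(\<lambda>s. 1 / (2 * of_real pi * \<i>) * integral (cbox 0 1) (h s)) holomorphic_on D"
    by (intro holomorphic_intros)
  then show ?thesis
    by (rule holomorphic_transform) (simp add: sum_eq)
qed

section \<open>The factor attached to a pair of hyperbolic directions\<close>

lemma Lagrange_interpolation:
  fixes p :: "real poly"
  assumes "degree p \<le> k"
  shows "poly p u = (\<Sum>a\<le>k. (\<Prod>b\<in>{..k} - {a}. (u - real b) / (real a - real b)) * poly p (real a))"
proof -
  define l where "l a = (\<Prod>b\<in>{..k} - {a}. smult (1 / (real a - real b)) [:- real b, 1:])" for a
  have pl: "poly (l a) u = (\<Prod>b\<in>{..k} - {a}. (u - real b) / (real a - real b))" for a u
    by (simp add: l_def poly_prod diff_divide_distrib)
  have deg: "degree (l a) \<le> k" if "a \<le> k" for a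
  proof -
    have "degree (l a) \<le> (\<Sum>b\<in>{..k} - {a}. 1)"
      unfolding l_def by (rule order_trans[OF degree_prod_sum_le sum_mono]) auto
    then show ?thesis
      using that by simp
  qed
  define q where "q = (\<Sum>a\<le>k. smult (poly p (real a)) (l a))"
  have "degree q \<le> k"
    unfolding q_def by (intro degree_sum_le) (use deg in auto)
  have "p = q"
  proof (rule poly_eqI_degree[where A = "real ` {..k}"])
    fix x assume "x \<in> real ` {..k}"
    then obtain c where c: "c \<le> k" "x = real c"
      by auto
    have "poly (l a) x = (if a = c then 1 else 0)" if "a \<le> k" for a
    proof (cases "a = c")
      case False
      then have "(\<Prod>b\<in>{..k} - {a}. (x - real b) / (real a - real b)) = 0"
        using c by (intro prod_zero) auto
      then show ?thesis
        using False by (simp add: pl)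
    qed (auto simp: pl c(2) intro!: prod.neutral)
    then have "poly q x = (\<Sum>a\<le>k. if a = c then poly p (real a) else 0)"
      unfolding q_def poly_sum by (intro sum.cong) auto
    then show "poly p x = poly q x"
      using c by simp
  qed (use assms \<open>degree q \<le> k\<close> in \<open>auto simp: card_image\<close>)
  then have "poly p u = poly q u"
    by simp
  then show ?thesis
    by (simp add: q_def poly_sum pl mult.commute)
qed

text \<open>The uniform degree bound makes induction possible: interpolation at the nodes 0, ..., k
  in direction \<open>v i\<close> leaves finitely many translates of \<open>g\<close> that involve
  one direction fewer. The arbitrary base point \<open>y\<close> absorbs the nodes.\<close>

lemma real_polynomial_function_on_lines:
  fixes g :: "'a::euclidean_space \<Rightarrow> real" and s :: "'i \<Rightarrow> 'a \<Rightarrow> real"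
  assumes "finite I" and s: "\<And>i. i \<in> I \<Longrightarrow> bounded_linear (s i)"
    and line: "\<And>i x. i \<in> I \<Longrightarrow> \<exists>p. degree p \<le> k \<and> (\<forall>u. g (x + u *\<^sub>R v i) = poly p u)"
  shows "real_polynomial_function (\<lambda>x. g (y + (\<Sum>i\<in>I. s i x *\<^sub>R v i)))"
  using assms
proof (induction I arbitrary: y rule: finite_induct)
  case empty
  then show ?case
    by auto
next
  case (insert i I)
  have eq: "g (y + (\<Sum>j\<in>insert i I. s j x *\<^sub>R v j)) =
      (\<Sum>a\<le>k. (\<Prod>b\<in>{..k} - {a}. (s i x - real b) / (real a - real b)) *
         g ((y + real a *\<^sub>R v i) + (\<Sum>j\<in>I. s j x *\<^sub>R v j)))" for x
  proof -
    obtain p where p: "degree p \<le> k" "\<And>u. g ((y + (\<Sum>j\<in>I. s j x *\<^sub>R v j)) + u *\<^sub>R v i) = poly p u"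
      using insert.prems(2)[of i "y + (\<Sum>j\<in>I. s j x *\<^sub>R v j)"] by auto
    have node: "poly p (real a) = g ((y + real a *\<^sub>R v i) + (\<Sum>j\<in>I. s j x *\<^sub>R v j))" for a
      using p(2)[of "real a"] by (simp add: algebra_simps)
    have "g (y + (\<Sum>j\<in>insert i I. s j x *\<^sub>R v j)) = poly p (s i x)"
      using p(2)[of "s i x"] insert.hyps by (simp add: algebra_simps)
    also have "\<dots> = (\<Sum>a\<le>k. (\<Prod>b\<in>{..k} - {a}. (s i x - real b) / (real a - real b)) * poly p (real a))"
      by (rule Lagrange_interpolation[OF p(1)])
    finally show ?thesis
      by (simp only: node)
  qed
  have "real_polynomial_function (s i)"
    using insert.prems(1) by (auto intro: real_polynomial_function.intros(1))
  then have "real_polynomial_function (\<lambda>x. (\<Prod>b\<in>{..k} - {a}. (s i x - real b) / (real a - real b)))" for a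
    by (intro real_polynomial_function_prod real_polynomial_function_divide real_polynomial_function_diff
          real_polynomial_function.intros(2)) auto
  then show ?case
    unfolding eq
    by (intro real_polynomial_function_sum real_polynomial_function.intros(4) insert.IH insert.prems) auto
qed

lemma coeff_line_poly_holomorphic:
  "(\<lambda>s. poly.coeff (line_poly f b (z + s *s w)) j) holomorphic_on S"
proof -
  have mult: "(\<lambda>s. poly.coeff (p s * q s) j) holomorphic_on S"
    if "\<And>j. (\<lambda>s. poly.coeff (p s) j) holomorphic_on S" "\<And>j. (\<lambda>s. poly.coeff (q s) j) holomorphic_on S"
    for p q :: "complex \<Rightarrow> complex poly" and j
    unfolding coeff_mult by (intro holomorphic_intros that)
  have pw: "(\<lambda>s. poly.coeff (p s ^ n) j) holomorphic_on S"
    if "\<And>j. (\<lambda>s. poly.coeff (p s) j) holomorphic_on S" for p :: "complex \<Rightarrow> complex poly" and n j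
  proof (induction n arbitrary: j)
    case (Suc n)
    then show ?case
      by (simp add: mult that)
  qed simp
  have pr: "(\<lambda>s. poly.coeff (\<Prod>i\<in>I. p i s) j) holomorphic_on S"
    if "\<And>i j. (\<lambda>s. poly.coeff (p i s) j) holomorphic_on S" for p :: "'b \<Rightarrow> complex \<Rightarrow> complex poly" and I j
  proof (induction I arbitrary: j rule: infinite_finite_induct)
    case (insert x F)
    then show ?case
      by (simp add: mult that)
  qed auto
  have lin: "(\<lambda>s. poly.coeff [:(z + s *s w) $ i, b $ i:] j) holomorphic_on S" for i j
    by (cases j) (auto intro!: holomorphic_intros)
  show ?thesis
    unfolding line_poly_def coeff_sum coeff_smult
    by (intro holomorphic_intros pr pw lin)
qed

lemma proots_prod_mset_linear:
  fixes B :: "complex multiset"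
  assumes "c \<noteq> 0"
  shows "proots (smult c (\<Prod>r\<in>#B. [:- r, 1:])) = B"
proof -
  have "proots (\<Prod>p\<in>#image_mset (\<lambda>r. [:- r, 1:]) B. p) = (\<Sum>p\<in>#image_mset (\<lambda>r. [:- r, 1:]) B. proots p)"
    by (rule proots_prod_mset) auto
  also have "\<dots> = (\<Sum>r\<in>#B. {#r#})"
    by (simp add: image_mset.compositionality o_def)
  finally show ?thesis
    using assms by simp
qed

lemma line_roots_unique:
  assumes b: "ceval f b \<noteq> 0" and "\<And>t. ceval f (z + t *s b) = ceval f b * (\<Prod>r\<in>#B. t - r)"
  shows "line_roots f b z = B"
proof -
  have "poly (line_poly f b z) t = poly (smult (ceval f b) (\<Prod>r\<in>#B. [:- r, 1:])) t" for t
    by (simp add: poly_line_poly assms(2) poly_prod_mset image_mset.compositionality o_def)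
  then have "line_poly f b z = smult (ceval f b) (\<Prod>r\<in>#B. [:- r, 1:])"
    by (simp add: poly_eq_poly_eq_iff[symmetric] fun_eq_iff)
  then show ?thesis
    using b by (simp only: line_roots_def proots_prod_mset_linear not_False_eq_True)
qed

lemma prod_mset_scale:
  fixes A :: "complex multiset"
  shows "(\<Prod>r\<in>#A. c * h r) = c ^ size A * (\<Prod>r\<in>#A. h r)"
  by (induction A) (auto simp: algebra_simps)

lemma line_roots_scale:
  assumes f: "homogeneous_deg f d" and b: "ceval f b \<noteq> 0" and "c \<noteq> 0"
  shows "line_roots f b (c *s z) = image_mset ((*) c) (line_roots f b z)"
proof (rule line_roots_unique[OF b])
  fix t
  have "c *s z + t *s b = c *s (z + (t / c) *s b)"
    using \<open>c \<noteq> 0\<close> by (simp add: vec_eq_iff algebra_simps)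
  then have "ceval f (c *s z + t *s b) = c ^ d * ceval f (z + (t / c) *s b)"
    by (simp only: ceval_scale[OF f])
  also have "\<dots> = ceval f b * (c ^ d * (\<Prod>r\<in>#line_roots f b z. t / c - r))"
    by (simp add: line_roots_factorization(2)[OF f b])
  also have "c ^ d * (\<Prod>r\<in>#line_roots f b z. t / c - r) = (\<Prod>r\<in>#line_roots f b z. c * (t / c - r))"
    by (simp only: prod_mset_scale line_roots_factorization(1)[OF f b])
  also have "\<dots> = (\<Prod>r\<in>#image_mset ((*) c) (line_roots f b z). t - r)"
    using \<open>c \<noteq> 0\<close> by (simp add: image_mset.compositionality o_def algebra_simps)
  finally show "ceval f (c *s z + t *s b) = ceval f b * (\<Prod>r\<in>#image_mset ((*) c) (line_roots f b z). t - r)" .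
qed

lemma cnj_prod_mset: "cnj (\<Prod>r\<in>#A. h r) = (\<Prod>r\<in>#A. cnj (h r))"
  by (induction A) auto

lemma line_roots_cnj:
  assumes f: "homogeneous_deg f d" and e: "ceval f (cvec e) \<noteq> 0"
  shows "line_roots f (cvec e) (\<chi> i. cnj (z $ i)) = image_mset cnj (line_roots f (cvec e) z)"
proof (rule line_roots_unique[OF e])
  fix t
  have "(\<chi> i. cnj (z $ i)) + t *s cvec e = (\<chi> i. cnj ((z + cnj t *s cvec e) $ i))"
    by (simp add: vec_eq_iff cvec_def)
  then have "ceval f ((\<chi> i. cnj (z $ i)) + t *s cvec e) = cnj (ceval f (z + cnj t *s cvec e))"
    by (simp only: ceval_cnj)
  also have "\<dots> = ceval f (cvec e) * (\<Prod>r\<in>#image_mset cnj (line_roots f (cvec e) z). t - r)"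
    using ceval_cvec_real[of f e]
    by (simp add: line_roots_factorization(2)[OF f e] cnj_prod_mset image_mset.compositionality o_def Reals_cnj_iff)
  finally show "ceval f ((\<chi> i. cnj (z $ i)) + t *s cvec e)
      = ceval f (cvec e) * (\<Prod>r\<in>#image_mset cnj (line_roots f (cvec e) z). t - r)" .
qed

section \<open>Roots in the upper half plane and their product\<close>

definition imvec :: "complex ^ 'n \<Rightarrow> real ^ 'n" where
  "imvec z = (\<chi> i. Im (z $ i))"

definition upper_roots :: "'n::finite rpoly \<Rightarrow> real ^ 'n \<Rightarrow> complex ^ 'n \<Rightarrow> complex multiset" where
  "upper_roots f e z = filter_mset (\<lambda>r. Im r > 0) (line_roots f (cvec e) z)"

text \<open>The factor \<open>- r\<close> is t - r at t = 0; taken over all roots the product would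
  be f(z) / f(e).\<close>

definition upper_prod :: "'n::finite rpoly \<Rightarrow> real ^ 'n \<Rightarrow> complex ^ 'n \<Rightarrow> complex" where
  "upper_prod f e z = (\<Prod>r\<in>#upper_roots f e z. - r)"

lemma imvec_add: "imvec (z + w) = imvec z + imvec w"
  and imvec_cvec [simp]: "imvec (cvec x) = 0"
  and imvec_scale_cvec: "imvec (s *s cvec x) = Im s *\<^sub>R x"
  by (simp_all add: imvec_def vec_eq_iff cvec_def)

lemma norm_imvec_le: "norm (imvec z) \<le> norm (z :: complex ^ 'n::finite)"
  unfolding norm_vec_def imvec_def
  by (intro L2_set_mono) (auto simp: abs_Im_le_cmod)

lemma norm_cvec: "norm (cvec (x :: real ^ 'n::finite)) = norm x"
  by (simp add: norm_vec_def cvec_def)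

lemma complex_vec_decomp: "z = cvec (\<chi> i. Re (z $ i)) + \<i> *s cvec (imvec z)"
  by (simp add: vec_eq_iff cvec_def imvec_def complex_eq_iff)

text \<open>The zero in question has imaginary part \<open>imvec z + Im r e\<close>, which therefore
  lies in the imaginary projection.\<close>

lemma root_imp_not_hyperbolic:
  assumes f: "homogeneous_deg f d" and "ceval f (z + r *s cvec e) = 0"
  shows "\<not> hyperbolic f (imvec z + Im r *\<^sub>R e)"
proof -
  have "z + r *s cvec e = cvec (\<chi> i. Re ((z + r *s cvec e) $ i)) + \<i> *s cvec (imvec z + Im r *\<^sub>R e)"
    using complex_vec_decomp[of "z + r *s cvec e"] by (simp only: imvec_add imvec_scale_cvec)
  then show ?thesis
    using assms(2) unfolding hyperbolic_iff_nonzero[OF f] by metis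
qed

lemma hyp_cone_scaleR:
  assumes f: "homogeneous_deg f d" and x: "x \<in> hyp_cone f e" and "c > 0"
  shows "c *\<^sub>R x \<in> hyp_cone f e"
  unfolding hyp_cone_def
proof (intro CollectI allI impI)
  fix t assume t: "ceval f (cvec (c *\<^sub>R x + t *\<^sub>R e)) = 0"
  have "c *\<^sub>R x + t *\<^sub>R e = c *\<^sub>R (x + (t / c) *\<^sub>R e)"
    using \<open>c > 0\<close> by (simp add: algebra_simps)
  then have "of_real c ^ d * ceval f (cvec (x + (t / c) *\<^sub>R e)) = 0"
    using t by (simp only: cvec_scaleR[of c] ceval_scale[OF f])
  then have "t / c < 0"
    using \<open>c > 0\<close> x by (simp add: hyp_cone_def)
  then show "t < 0"
    using \<open>c > 0\<close> by (simp add: divide_less_0_iff)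
qed

lemma norm_prod_mset_le:
  fixes A :: "complex multiset"
  assumes "\<And>r. r \<in># A \<Longrightarrow> cmod r \<le> M" "M \<ge> 0"
  shows "cmod (\<Prod>r\<in>#A. - r) \<le> M ^ size A"
  using assms(1)
proof (induction A)
  case (add x A)
  then show ?case
    using assms(2) by (auto simp: norm_mult intro!: mult_mono)
qed simp

text \<open>Each term in the expansion of the imaginary part of a product contains some Im r,
  bounded by \<open>y\<close>; the other factors are bounded by \<open>M\<close>.\<close>

lemma Im_prod_mset_le:
  fixes A :: "complex multiset"
  assumes "\<And>r. r \<in># A \<Longrightarrow> cmod r \<le> M \<and> \<bar>Im r\<bar> \<le> y" "M \<ge> 1" "y \<ge> 0"
  shows "\<bar>Im (\<Prod>r\<in>#A. - r)\<bar> \<le> real (size A) * M ^ size A * y"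
  using assms(1)
proof (induction A)
  case (add x A)
  let ?P = "\<Prod>r\<in>#A. - r"
  have P: "cmod ?P \<le> M ^ size A"
    using norm_prod_mset_le[of A M] add.prems assms(2) by auto
  have IH: "\<bar>Im ?P\<bar> \<le> real (size A) * M ^ size A * y"
    using add by auto
  have "\<bar>Im (- x * ?P)\<bar> \<le> \<bar>Re x\<bar> * \<bar>Im ?P\<bar> + \<bar>Im x\<bar> * \<bar>Re ?P\<bar>"
    by (simp flip: abs_mult)
  also have "\<bar>Re x\<bar> * \<bar>Im ?P\<bar> \<le> M * (real (size A) * M ^ size A * y)"
    using IH add.prems[of x] abs_Re_le_cmod[of x] assms(2) by (intro mult_mono) auto
  also have "\<bar>Im x\<bar> * \<bar>Re ?P\<bar> \<le> y * (M * M ^ size A)"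
  proof (rule mult_mono)
    show "\<bar>Re ?P\<bar> \<le> M * M ^ size A"
      by (rule order_trans[OF abs_Re_le_cmod order_trans[OF P]]) (use mult_right_mono[OF assms(2), of "M ^ size A"] assms(2) in simp)
  qed (use add.prems[of x] assms in auto)
  finally show ?case
    by (simp add: algebra_simps)
qed simp

text \<open>The roots are those in direction \<open>e\<close>, whereas the imaginary part of the
  base point ranges over the cone of \<open>a\<close>.\<close>

locale hyperbolic_pair =
  fixes f :: "'n::finite rpoly" and d :: nat and e a :: "real ^ 'n"
  assumes f: "homogeneous_deg f d" and e: "hyperbolic f e" and a: "hyperbolic f a"
begin

abbreviation Cone :: "(real ^ 'n) set" where
  "Cone \<equiv> hyp_cone f a"

lemma fe: "ceval f (cvec e) \<noteq> 0"
  using hyperbolic_nonzero[OF e] .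

lemma fa: "ceval f (cvec a) \<noteq> 0"
  using hyperbolic_nonzero[OF a] .

lemma open_cone: "open Cone"
  using open_hyp_cone[OF f fa] .

lemma cone_hyperbolic: "x \<in> Cone \<Longrightarrow> hyperbolic f x"
  using hyp_cone_imp_hyperbolic[OF f a] .

lemma a_in_cone: "a \<in> Cone"
  using hyp_cone_self[OF f fa] .

lemma root_iff: "r \<in># line_roots f (cvec e) z \<longleftrightarrow> ceval f (z + r *s cvec e) = 0"
  using line_roots_factorization(3)[OF f fe] .

text \<open>If Im r \<noteq> 0, then \<open>imvec z / Im r + e\<close> is not hyperbolic, while a
  ball of radius \<rho> about \<open>e\<close> consists of hyperbolic directions; so |imvec z| / |Im
  r| >= \<rho>.\<close>

lemma Im_root_bound:
  obtains K where "K \<ge> 1"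
    "\<And>z r. ceval f (z + r *s cvec e) = 0 \<Longrightarrow> cmod r \<le> K * norm z"
    "\<And>z r. ceval f (z + r *s cvec e) = 0 \<Longrightarrow> \<bar>Im r\<bar> \<le> K * norm (imvec z)"
proof -
  obtain K1 where K1: "K1 > 0" "\<And>z t. ceval f (z + t *s cvec e) = 0 \<Longrightarrow> cmod t \<le> K1 * norm z"
    using line_root_bound[OF f fe] by metis
  obtain \<rho> where \<rho>: "\<rho> > 0" "\<And>w. dist w e < \<rho> \<Longrightarrow> hyperbolic f w"
    using open_hyperbolic[OF f] e unfolding open_dist by auto
  have K2: "\<bar>Im r\<bar> \<le> 1 / \<rho> * norm (imvec z)" if r: "ceval f (z + r *s cvec e) = 0" for z r
  proof (cases "Im r = 0")
    case False
    have "Im r *\<^sub>R ((1 / Im r) *\<^sub>R imvec z + e) = imvec z + Im r *\<^sub>R e"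
      using False by (simp add: scaleR_add_right)
    then have "\<not> hyperbolic f ((1 / Im r) *\<^sub>R imvec z + e)"
      using root_imp_not_hyperbolic[OF f r] hyperbolic_scaleR[OF f _ False] by metis
    then have "\<rho> \<le> dist ((1 / Im r) *\<^sub>R imvec z + e) e"
      using \<rho>(2) not_less by blast
    then show ?thesis
      using False \<rho>(1) by (simp add: dist_norm field_simps)
  qed (use \<rho> in simp)
  show thesis
  proof (rule that[of "max 1 (max K1 (1 / \<rho>))"])
    fix z r assume r: "ceval f (z + r *s cvec e) = 0"
    show "cmod r \<le> max 1 (max K1 (1 / \<rho>)) * norm z"
      by (rule order_trans[OF K1(2)[OF r]]) (intro mult_right_mono, auto)
    show "\<bar>Im r\<bar> \<le> max 1 (max K1 (1 / \<rho>)) * norm (imvec z)"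
      by (rule order_trans[OF K2[OF r]]) (intro mult_right_mono, auto)
  qed simp
qed

text \<open>The vector \<open>imvec z + Im r e\<close> is not hyperbolic, hence outside the ball.
  Adding 1 to \<open>norm e\<close> keeps the divisor positive.\<close>

lemma Im_root_lower_bound:
  assumes "ball (imvec z) \<delta> \<subseteq> Cone" "ceval f (z + r *s cvec e) = 0"
  shows "\<delta> / (norm e + 1) \<le> \<bar>Im r\<bar>"
proof -
  have "imvec z + Im r *\<^sub>R e \<notin> ball (imvec z) \<delta>"
    using root_imp_not_hyperbolic[OF f assms(2)] cone_hyperbolic assms(1) by blast
  then have "\<delta> \<le> \<bar>Im r\<bar> * norm e"
    by (simp add: dist_norm)
  also have "\<dots> \<le> \<bar>Im r\<bar> * (norm e + 1)"
    by (intro mult_left_mono) auto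
  finally show ?thesis
    by (simp add: divide_le_eq add_nonneg_pos)
qed

lemma root_not_real:
  assumes "imvec z \<in> Cone" "ceval f (z + r *s cvec e) = 0"
  shows "Im r \<noteq> 0"
proof -
  obtain \<delta> where "\<delta> > 0" "ball (imvec z) \<delta> \<subseteq> Cone"
    using open_cone assms(1) open_contains_ball by blast
  then have "0 < \<delta> / (norm e + 1)" "\<delta> / (norm e + 1) \<le> \<bar>Im r\<bar>"
    using Im_root_lower_bound[OF _ assms(2)] by (auto simp: add_nonneg_pos)
  then show ?thesis
    by linarith
qed

text \<open>The contour lemma applies on a small disc about each point: there the roots stay bounded
  and, since a ball of fixed radius about the imaginary part remains in the cone, they keep a fixed
  distance from the real axis.\<close>

lemma upper_sum_holomorphic:
  assumes "open D" and D: "\<And>s. s \<in> D \<Longrightarrow> imvec (z + s *s w) \<in> Cone"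
    and \<phi>: "\<phi> holomorphic_on {t. Im t > 0}"
  shows "(\<lambda>s. \<Sum>r\<in>#upper_roots f e (z + s *s w). \<phi> r) holomorphic_on D"
  unfolding holomorphic_on_def
proof
  fix s0 assume s0: "s0 \<in> D"
  obtain K where K: "K \<ge> 1" "\<And>z r. ceval f (z + r *s cvec e) = 0 \<Longrightarrow> cmod r \<le> K * norm z"
    using Im_root_bound by metis
  obtain \<delta> where \<delta>: "\<delta> > 0" "ball (imvec (z + s0 *s w)) \<delta> \<subseteq> Cone"
    using open_cone D[OF s0] open_contains_ball by blast
  \<comment> \<open>Moving \<open>s\<close> by less than \<eta> shifts the imaginary part by less
    than \<delta> / 2, which leaves a ball of radius \<delta> / 2 inside the cone.\<close>
  define \<eta> where "\<eta> = \<delta> / 2 / (norm w + 1)"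
  have nw: "norm w + 1 > 0"
    by (simp add: add_nonneg_pos)
  have "\<eta> > 0"
    using \<delta> nw by (simp add: \<eta>_def)
  have close: "dist (imvec (z + s0 *s w)) (imvec (z + s *s w)) < \<delta> / 2" if "dist s0 s < \<eta>" for s
  proof -
    have "imvec (z + s0 *s w) - imvec (z + s *s w) = imvec ((s0 - s) *s w)"
      by (simp add: imvec_def vec_eq_iff algebra_simps)
    then have "dist (imvec (z + s0 *s w)) (imvec (z + s *s w)) \<le> cmod (s0 - s) * norm w"
      using norm_imvec_le[of "(s0 - s) *s w"] by (simp only: dist_norm vector_norm_scale)
    also have "\<dots> \<le> cmod (s0 - s) * (norm w + 1)"
      by (intro mult_left_mono) auto
    also have "\<dots> < \<delta> / 2"
      using that nw by (simp add: \<eta>_def dist_norm field_simps)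
    finally show ?thesis .
  qed
  have bd: "cmod r \<le> K * (norm z + (cmod s0 + \<eta>) * norm w) \<and> \<delta> / 2 / (norm e + 1) \<le> \<bar>Im r\<bar>"
    if "s \<in> ball s0 \<eta>" "r \<in># line_roots f (cvec e) (z + s *s w)" for s r
  proof
    have r: "ceval f (z + s *s w + r *s cvec e) = 0"
      using that(2) by (simp add: root_iff)
    have "cmod s \<le> cmod s0 + \<eta>"
      using that(1) norm_triangle_ineq2[of s s0] by (simp add: dist_norm norm_minus_commute)
    then have "norm (z + s *s w) \<le> norm z + (cmod s0 + \<eta>) * norm w"
      using norm_triangle_ineq[of z "s *s w"] mult_right_mono[of "cmod s" "cmod s0 + \<eta>" "norm w"]
      by (simp add: vector_norm_scale)
    then show "cmod r \<le> K * (norm z + (cmod s0 + \<eta>) * norm w)"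
      using order_trans[OF K(2)[OF r] mult_left_mono] K(1) by simp
    have "ball (imvec (z + s *s w)) (\<delta> / 2) \<subseteq> ball (imvec (z + s0 *s w)) \<delta>"
    proof
      fix y assume "y \<in> ball (imvec (z + s *s w)) (\<delta> / 2)"
      then show "y \<in> ball (imvec (z + s0 *s w)) \<delta>"
        using close[of s] that(1) dist_triangle_half_r[of "imvec (z + s *s w)" _ \<delta>]
        by (auto simp: dist_commute)
    qed
    then show "\<delta> / 2 / (norm e + 1) \<le> \<bar>Im r\<bar>"
      using \<delta>(2) by (intro Im_root_lower_bound[OF _ r]) blast
  qed
  have "(\<lambda>s. \<Sum>r\<in>#upper_roots f e (z + s *s w). \<phi> r) holomorphic_on ball s0 \<eta>"
    unfolding upper_roots_def
  proof (rule upper_roots_sum_holomorphic[where c = "\<lambda>j s. poly.coeff (line_poly f (cvec e) (z + s *s w)) j" and d = d])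
    fix s t
    have "(\<Sum>j\<le>d. poly.coeff (line_poly f (cvec e) (z + s *s w)) j * t ^ j) = poly (line_poly f (cvec e) (z + s *s w)) t"
      using arg_cong[OF poly_as_sum_of_monoms'[OF line_poly_degree(1)[OF f, of "cvec e" "z + s *s w"]], of "\<lambda>p. poly p t"]
      by (simp add: poly_sum poly_monom)
    then show "(\<Sum>j\<le>d. poly.coeff (line_poly f (cvec e) (z + s *s w)) j * t ^ j)
        = ceval f (cvec e) * (\<Prod>r\<in>#line_roots f (cvec e) (z + s *s w). t - r)"
      by (simp add: poly_line_poly line_roots_factorization(2)[OF f fe])
    show "0 < \<delta> / 2 / (norm e + 1)"
      using \<delta>(1) by (simp add: add_nonneg_pos)
  qed (use bd fe \<phi> in \<open>auto intro: coeff_line_poly_holomorphic\<close>)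
  then have "(\<lambda>s. \<Sum>r\<in>#upper_roots f e (z + s *s w). \<phi> r) field_differentiable at s0"
    using \<open>\<eta> > 0\<close> by (intro holomorphic_on_imp_differentiable_at[of _ "ball s0 \<eta>"]) auto
  then show "(\<lambda>s. \<Sum>r\<in>#upper_roots f e (z + s *s w). \<phi> r) field_differentiable at s0 within D"
    by (rule field_differentiable_at_within)
qed

text \<open>For an upper root \<open>- r\<close> lies in the lower half plane, off the branch cut of
  \<open>Ln\<close>, so the product is the exponential of a root sum with weight
  \<open>Ln (- r)\<close>.\<close>

lemma upper_prod_holomorphic:
  assumes "open D" and D: "\<And>s. s \<in> D \<Longrightarrow> imvec (z + s *s w) \<in> Cone"
  shows "(\<lambda>s. upper_prod f e (z + s *s w)) holomorphic_on D"
proof -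
  have Ln: "(\<lambda>t. Ln (- t)) holomorphic_on {t. Im t > 0}"
    by (intro holomorphic_intros) (auto simp: complex_nonpos_Reals_iff)
  have exp_sum: "exp (\<Sum>r\<in>#A. Ln (- r)) = (\<Prod>r\<in>#A. - r)" if "\<And>r. r \<in># A \<Longrightarrow> Im r > 0" for A
    using that
  proof (induction A)
    case (add x A)
    then have "- x \<noteq> 0"
      by force
    then show ?case
      using add by (simp add: exp_add)
  qed simp
  have eq: "exp (\<Sum>r\<in>#upper_roots f e z. Ln (- r)) = upper_prod f e z" for z
    unfolding upper_prod_def by (rule exp_sum) (simp add: upper_roots_def)
  have "(\<lambda>s. exp (\<Sum>r\<in>#upper_roots f e (z + s *s w). Ln (- r))) holomorphic_on D"
    by (intro holomorphic_on_exp' upper_sum_holomorphic assms Ln)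
  then show ?thesis
    by (simp add: eq)
qed

definition k :: nat where
  "k = size (upper_roots f e (\<i> *s cvec a))"

text \<open>With weight 1 the root sum is continuous and integer-valued, so it is constant on
  segments; convexity of the cone allows joining \<open>z\<close> to the base point i a.\<close>

lemma size_upper_roots:
  assumes z: "imvec z \<in> Cone"
  shows "size (upper_roots f e z) = k"
proof -
  define w where "w = z - \<i> *s cvec a"
  define D where "D = {s. imvec (\<i> *s cvec a + s *s w) \<in> Cone}"
  define g where "g s = (\<Sum>r\<in>#upper_roots f e (\<i> *s cvec a + s *s w). (1::complex))" for s
  have "continuous_on UNIV (\<lambda>s. imvec (\<i> *s cvec a + s *s w))"
    unfolding imvec_def vector_scalar_mult_def by (intro continuous_intros)
  then have "open D"
    unfolding D_def using open_vimage[OF open_cone] by (auto simp: vimage_def)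
  then have "g holomorphic_on D"
    unfolding g_def by (intro upper_sum_holomorphic holomorphic_intros) (auto simp: D_def)
  have seg: "closed_segment 0 1 \<subseteq> D"
  proof
    fix s :: complex assume "s \<in> closed_segment 0 1"
    then obtain u where u: "0 \<le> u" "u \<le> 1" "s = of_real u"
      by (auto simp: in_segment scaleR_conv_of_real)
    have "imvec (\<i> *s cvec a + s *s w) = (1 - u) *\<^sub>R a + u *\<^sub>R imvec z"
      by (simp add: u w_def imvec_def cvec_def vec_eq_iff algebra_simps)
    moreover have "\<dots> \<in> Cone"
      using convexD_alt[OF convex_hyp_cone[OF f a] a_in_cone z] u by blast
    ultimately show "s \<in> D"
      by (simp add: D_def)
  qed
  have gn: "g s = of_nat (size (upper_roots f e (\<i> *s cvec a + s *s w)))" for s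
    by (simp add: g_def)
  have "g constant_on closed_segment 0 1"
  proof (rule continuous_discrete_range_constant)
    show "continuous_on (closed_segment 0 1) g"
      using holomorphic_on_imp_continuous_on[OF \<open>g holomorphic_on D\<close>] seg continuous_on_subset by blast
    fix s
    have "1 \<le> cmod (of_nat m - of_nat n)" if "of_nat m \<noteq> (of_nat n :: complex)" for m n
    proof -
      have "cmod (of_nat m - of_nat n) = \<bar>real m - real n\<bar>"
        by (metis norm_of_real of_real_diff of_real_of_nat_eq)
      then show ?thesis
        using that by auto
    qed
    then show "\<exists>e>0. \<forall>y. y \<in> closed_segment 0 1 \<and> g y \<noteq> g s \<longrightarrow> e \<le> cmod (g y - g s)"
      unfolding gn by (intro exI[of _ 1]) auto
  qed simp
  then have "g 0 = g 1"
    unfolding constant_on_def by (metis ends_in_segment)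
  then show ?thesis
    by (simp add: gn k_def w_def)
qed

lemma upper_prod_bounds:
  obtains K where "K \<ge> 1"
    "\<And>z. imvec z \<in> Cone \<Longrightarrow> cmod (upper_prod f e z) \<le> (K * (1 + norm z)) ^ k"
    "\<And>z. imvec z \<in> Cone \<Longrightarrow> \<bar>Im (upper_prod f e z)\<bar> \<le> real k * (K * (1 + norm z)) ^ k * (K * norm (imvec z))"
proof -
  obtain K where K: "K \<ge> 1" "\<And>z r. ceval f (z + r *s cvec e) = 0 \<Longrightarrow> cmod r \<le> K * norm z"
    "\<And>z r. ceval f (z + r *s cvec e) = 0 \<Longrightarrow> \<bar>Im r\<bar> \<le> K * norm (imvec z)"
    using Im_root_bound by metis
  have M: "K * (1 + norm z) \<ge> 1" for z :: "complex ^ 'n"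
    using mult_mono[of 1 K 1 "1 + norm z"] K(1) by simp
  have r: "cmod r \<le> K * (1 + norm z) \<and> \<bar>Im r\<bar> \<le> K * norm (imvec z)" if "r \<in># upper_roots f e z" for r z
    using that K(2)[of z r] K(3)[of z r] K(1) by (auto simp: upper_roots_def root_iff algebra_simps)
  show thesis
  proof (rule that[OF K(1)])
    fix z assume z: "imvec z \<in> Cone"
    show "cmod (upper_prod f e z) \<le> (K * (1 + norm z)) ^ k"
      using norm_prod_mset_le[of "upper_roots f e z" "K * (1 + norm z)"] r M[of z]
      by (simp add: upper_prod_def size_upper_roots[OF z])
    show "\<bar>Im (upper_prod f e z)\<bar> \<le> real k * (K * (1 + norm z)) ^ k * (K * norm (imvec z))"
      using Im_prod_mset_le[of "upper_roots f e z" "K * (1 + norm z)" "K * norm (imvec z)"] r M[of z] K(1)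
      by (simp add: upper_prod_def size_upper_roots[OF z])
  qed
qed

text \<open>The imaginary part of x + s v is a positive multiple of \<open>v\<close> for every
  \<open>s\<close> in the upper half plane and hence stays in the cone, so the one-variable result
  applies.\<close>

lemma boundary_polynomial_on_line:
  assumes v: "v \<in> Cone"
  shows "\<exists>p. degree p \<le> k \<and> (\<forall>u. ((\<lambda>\<epsilon>. upper_prod f e (cvec (x + u *\<^sub>R v) + (\<i> * of_real \<epsilon>) *s cvec v)) \<longlongrightarrow> of_real (poly p u)) (at_right 0))"
proof -
  obtain K where K: "K \<ge> 1"
    "\<And>z. imvec z \<in> Cone \<Longrightarrow> cmod (upper_prod f e z) \<le> (K * (1 + norm z)) ^ k"
    "\<And>z. imvec z \<in> Cone \<Longrightarrow> \<bar>Im (upper_prod f e z)\<bar> \<le> real k * (K * (1 + norm z)) ^ k * (K * norm (imvec z))"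
    using upper_prod_bounds by metis
  let ?z = "\<lambda>s. cvec x + s *s cvec v"
  define \<phi> where "\<phi> s = upper_prod f e (?z s)" for s
  have Cone: "imvec (?z s) \<in> Cone" if "Im s > 0" for s
    using hyp_cone_scaleR[OF f v that] by (simp add: imvec_add imvec_scale_cvec)
  define N where "N = 1 + norm x + norm v"
  have N: "1 + norm (?z s) \<le> N * (1 + cmod s)" for s
  proof -
    have "norm (?z s) \<le> norm x + cmod s * norm v"
      using norm_triangle_ineq[of "cvec x" "s *s cvec v"] by (simp add: norm_cvec vector_norm_scale)
    moreover have "N * (1 + cmod s) = 1 + norm x + cmod s * norm v + (cmod s + cmod s * norm x + norm v)"
      by (simp add: N_def algebra_simps)
    moreover have "0 \<le> cmod s + cmod s * norm x + norm v"
      by simp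
    ultimately show ?thesis
      by linarith
  qed
  have pow: "(K * (1 + norm (?z s))) ^ k \<le> (K * N) ^ k * (1 + cmod s) ^ k" for s
    using power_mono[OF mult_left_mono[OF N[of s], of K], of k] K(1)
    by (simp add: power_mult_distrib mult.assoc)
  have "\<exists>p :: real poly. degree p \<le> k \<and>
    (\<forall>u. ((\<lambda>\<epsilon>. \<phi> (of_real u + \<i> * of_real \<epsilon>)) \<longlongrightarrow> of_real (poly p u)) (at_right 0))"
  proof (rule half_plane_boundary_polynomial)
    show "\<phi> holomorphic_on {s. 0 < Im s}"
      unfolding \<phi>_def by (intro upper_prod_holomorphic open_halfspace_Im_gt) (use Cone in auto)
    show "0 \<le> (K * N) ^ k" "0 \<le> real k * (K * N) ^ k * (K * norm v)"
      using K(1) by (auto simp: N_def)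
    fix s assume s: "Im s > 0"
    show "cmod (\<phi> s) \<le> (K * N) ^ k * (1 + cmod s) ^ k"
      using K(2)[OF Cone[OF s]] pow[of s] by (simp add: \<phi>_def)
    have "\<bar>Im (\<phi> s)\<bar> \<le> real k * (K * (1 + norm (?z s))) ^ k * (K * norm (imvec (?z s)))"
      using K(3)[OF Cone[OF s]] by (simp add: \<phi>_def)
    also have "\<dots> \<le> real k * ((K * N) ^ k * (1 + cmod s) ^ k) * (K * (Im s * norm v))"
      using s K(1) by (intro mult_mono pow) (auto simp: imvec_add imvec_scale_cvec N_def)
    finally show "\<bar>Im (\<phi> s)\<bar> \<le> real k * (K * N) ^ k * (K * norm v) * (1 + cmod s) ^ k * Im s"
      by (simp add: mult_ac)
  qed
  moreover have "\<phi> (of_real u + \<i> * of_real \<epsilon>) = upper_prod f e (cvec (x + u *\<^sub>R v) + (\<i> * of_real \<epsilon>) *s cvec v)" for u \<epsilon>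
    unfolding \<phi>_def by (rule arg_cong[where f = "upper_prod f e"]) (simp add: vec_eq_iff cvec_def algebra_simps)
  ultimately show ?thesis
    by simp
qed

text \<open>Boundary values may a priori depend on the direction of approach. On a disc of radius 2
  \<epsilon> in the parameter joining the two points the imaginary part is O(\<epsilon>), so on the
  disc of radius \<epsilon> the derivative is O(1) and the two values differ by
  O(\<epsilon>).\<close>

lemma boundary_value_direction:
  assumes w: "\<And>\<tau>. \<bar>\<tau>\<bar> < 2 \<Longrightarrow> a + \<tau> *\<^sub>R w \<in> Cone"
  shows "((\<lambda>\<epsilon>. upper_prod f e (cvec x + (\<i> * of_real \<epsilon>) *s cvec (a + w))
               - upper_prod f e (cvec x + (\<i> * of_real \<epsilon>) *s cvec a)) \<longlongrightarrow> 0) (at_right 0)"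
proof -
  obtain K where K: "K \<ge> 1"
    "\<And>z. imvec z \<in> Cone \<Longrightarrow> \<bar>Im (upper_prod f e z)\<bar> \<le> real k * (K * (1 + norm z)) ^ k * (K * norm (imvec z))"
    using upper_prod_bounds by metis
  define N where "N = norm a + 2 * norm w"
  define L where "L = real k * (K * (1 + (norm x + N))) ^ k * (K * N)"
  have "L \<ge> 0" "N \<ge> 0"
    using K(1) by (auto simp: L_def N_def)
  have est: "cmod (upper_prod f e (cvec x + (\<i> * of_real \<epsilon>) *s cvec (a + w))
               - upper_prod f e (cvec x + (\<i> * of_real \<epsilon>) *s cvec a)) \<le> 2 * exp 2 * (L + 1) * \<epsilon>"
    if \<epsilon>: "0 < \<epsilon>" "\<epsilon> < 1" for \<epsilon>
  proof -
    \<comment> \<open>The two points to be compared are the values at 0 and at i \<epsilon>. For |s|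
      < 2 \<epsilon> the quotient Im s / \<epsilon> stays below 2 in absolute value, the range
      granted by the hypothesis on \<open>w\<close>.\<close>
    define z where "z s = (cvec x + (\<i> * of_real \<epsilon>) *s cvec a) + s *s cvec w" for s
    have im: "imvec (z s) = \<epsilon> *\<^sub>R a + Im s *\<^sub>R w" for s
      by (simp add: z_def imvec_def cvec_def vec_eq_iff)
    have Cone: "imvec (z s) \<in> Cone" if "s \<in> ball 0 (2 * \<epsilon>)" for s
    proof -
      have "\<bar>Im s\<bar> < 2 * \<epsilon>"
        using that abs_Im_le_cmod[of s] by simp
      then have "\<bar>Im s / \<epsilon>\<bar> < 2"
        using \<epsilon> by (simp add: abs_divide pos_divide_less_eq)
      then have "\<epsilon> *\<^sub>R (a + (Im s / \<epsilon>) *\<^sub>R w) \<in> Cone"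
        using hyp_cone_scaleR[OF f w] \<epsilon> by blast
      then show ?thesis
        using \<epsilon> by (simp add: im scaleR_add_right)
    qed
    have bound: "\<bar>Im (upper_prod f e (z s))\<bar> \<le> L * \<epsilon>" if s: "s \<in> ball 0 (2 * \<epsilon>)" for s
    proof -
      have s2: "cmod s \<le> 2 * \<epsilon>" "\<bar>Im s\<bar> \<le> 2 * \<epsilon>"
        using s abs_Im_le_cmod[of s] by auto
      have "norm (imvec (z s)) \<le> \<epsilon> * norm a + \<bar>Im s\<bar> * norm w"
        unfolding im using norm_triangle_ineq[of "\<epsilon> *\<^sub>R a" "Im s *\<^sub>R w"] \<epsilon> by simp
      also have "\<dots> \<le> \<epsilon> * N"
        using mult_right_mono[OF s2(2), of "norm w"] by (simp add: N_def algebra_simps)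
      finally have 1: "norm (imvec (z s)) \<le> \<epsilon> * N" .
      have "norm (z s) \<le> norm x + \<epsilon> * norm a + cmod s * norm w"
        unfolding z_def using \<epsilon>
        by (intro order_trans[OF norm_triangle_ineq] add_mono) (auto simp: norm_cvec vector_norm_scale norm_mult)
      also have "\<dots> \<le> norm x + \<epsilon> * N"
        using mult_right_mono[OF s2(1), of "norm w"] by (simp add: N_def algebra_simps)
      also have "\<dots> \<le> norm x + N"
        using \<epsilon> \<open>N \<ge> 0\<close> by (simp add: mult_left_le_one_le)
      finally have 2: "norm (z s) \<le> norm x + N" .
      have "real k * (K * (1 + norm (z s))) ^ k * (K * norm (imvec (z s)))
          \<le> real k * (K * (1 + (norm x + N))) ^ k * (K * (\<epsilon> * N))"
        using 1 2 K(1) \<open>N \<ge> 0\<close> \<epsilon> by (intro mult_mono power_mono add_mono mult_nonneg_nonneg) auto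
      then show ?thesis
        using K(2)[OF Cone[OF s]] by (simp add: L_def mult_ac)
    qed
    have "cmod (upper_prod f e (z (\<i> * of_real \<epsilon>)) - upper_prod f e (z 0)) \<le> 2 * exp 2 * (L + 1) * cmod (\<i> * of_real \<epsilon> - 0)"
    proof (rule Lipschitz_bound_Im[where S = "ball 0 (2 * \<epsilon>)" and T = "cball 0 \<epsilon>"])
      show "(\<lambda>s. upper_prod f e (z s)) holomorphic_on ball 0 (2 * \<epsilon>)"
        using Cone unfolding z_def by (intro upper_prod_holomorphic) auto
      fix s assume "s \<in> cball (0::complex) \<epsilon>"
      then have "ball s \<epsilon> \<subseteq> ball 0 (2 * \<epsilon>)"
        by (intro ball_subset_ball_iff[THEN iffD2]) (auto simp: dist_norm)
      then show "\<exists>r>0. ball s r \<subseteq> ball 0 (2 * \<epsilon>) \<and> (\<forall>v\<in>ball s r. \<bar>Im (upper_prod f e (z v))\<bar> \<le> L * r)"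
        using \<epsilon> bound by (intro exI[of _ \<epsilon>]) blast
    qed (use \<epsilon> \<open>L \<ge> 0\<close> in \<open>auto simp: norm_mult\<close>)
    moreover have "z (\<i> * of_real \<epsilon>) = cvec x + (\<i> * of_real \<epsilon>) *s cvec (a + w)"
      "z 0 = cvec x + (\<i> * of_real \<epsilon>) *s cvec a"
      by (simp_all add: z_def vec_eq_iff cvec_def algebra_simps)
    ultimately show ?thesis
      using \<epsilon> by (simp add: norm_mult)
  qed
  show ?thesis
  proof (rule Lim_null_comparison)
    show "\<forall>\<^sub>F \<epsilon> in at_right 0. norm (upper_prod f e (cvec x + (\<i> * of_real \<epsilon>) *s cvec (a + w))
               - upper_prod f e (cvec x + (\<i> * of_real \<epsilon>) *s cvec a)) \<le> 2 * exp 2 * (L + 1) * \<epsilon>"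
      unfolding eventually_at_right_field using est by (intro exI[of _ 1]) auto
    have "((\<lambda>\<epsilon>. 2 * exp 2 * (L + 1) * \<epsilon>) \<longlongrightarrow> 2 * exp 2 * (L + 1) * 0) (at_right 0)"
      by (intro tendsto_intros)
    then show "((\<lambda>\<epsilon>. 2 * exp 2 * (L + 1) * \<epsilon>) \<longlongrightarrow> 0) (at_right 0)"
      by simp
  qed
qed

text \<open>The boundary value along \<open>a\<close> agrees with the one along every direction
  close to \<open>a\<close>, so it is polynomial on the lines in all these directions; they span,
  which gives polynomiality in all variables. Scaling by 2 multiplies each of the \<open>k\<close>
  roots by 2.\<close>

lemma boundary_rpoly:
  obtains G :: "'n rpoly" where
    "\<And>x. ((\<lambda>\<epsilon>. upper_prod f e (cvec x + (\<i> * of_real \<epsilon>) *s cvec a)) \<longlongrightarrow> ceval G (cvec x)) (at_right 0)"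
    "\<And>x. ceval G (cvec (2 *\<^sub>R x)) = 2 ^ k * ceval G (cvec x)"
proof -
  let ?P = "\<lambda>v x \<epsilon>. upper_prod f e (cvec x + (\<i> * complex_of_real \<epsilon>) *s cvec v)"
  have "\<exists>y. (?P a x \<longlongrightarrow> of_real y) (at_right 0)" for x
    using boundary_polynomial_on_line[OF a_in_cone, of x] by (metis add_0_right scaleR_zero_left)
  then obtain g where g: "\<And>x. (?P a x \<longlongrightarrow> of_real (g x)) (at_right 0)"
    by metis
  obtain \<delta> where \<delta>: "\<delta> > 0" "ball a \<delta> \<subseteq> Cone"
    using open_cone a_in_cone open_contains_ball by blast
  \<comment> \<open>\<open>boundary_value_direction\<close> asks for a + \<tau> w in the cone
    whenever |\<tau>| < 2; halving \<delta> leaves that room for w = \<rho> b with |b| <= 1.\<close>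
  define \<rho> where "\<rho> = \<delta> / 2"
  have "\<rho> > 0"
    using \<delta> by (simp add: \<rho>_def)
  have dir: "a + \<tau> *\<^sub>R (\<rho> *\<^sub>R b) \<in> Cone" if "\<bar>\<tau>\<bar> < 2" "norm b \<le> 1" for \<tau> b
  proof -
    have "\<bar>\<tau>\<bar> * (\<rho> * norm b) \<le> \<bar>\<tau>\<bar> * \<rho>"
      using that \<open>\<rho> > 0\<close> by (intro mult_left_mono) auto
    also have "\<dots> < 2 * \<rho>"
      using that \<open>\<rho> > 0\<close> by simp
    finally have "dist a (a + \<tau> *\<^sub>R (\<rho> *\<^sub>R b)) < 2 * \<rho>"
      using \<open>\<rho> > 0\<close> by (simp add: dist_norm abs_mult)
    then have "a + \<tau> *\<^sub>R (\<rho> *\<^sub>R b) \<in> ball a \<delta>"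
      by (simp add: \<rho>_def)
    then show ?thesis
      using \<delta>(2) by blast
  qed
  have line: "\<exists>p. degree p \<le> k \<and> (\<forall>u. g (x + u *\<^sub>R (a + \<rho> *\<^sub>R b)) = poly p u)" if b: "norm b \<le> 1" for x b
  proof -
    have v: "a + \<rho> *\<^sub>R b \<in> Cone"
      using dir[of 1 b] b by simp
    obtain p where p: "degree p \<le> k"
      "\<And>u. (?P (a + \<rho> *\<^sub>R b) (x + u *\<^sub>R (a + \<rho> *\<^sub>R b)) \<longlongrightarrow> of_real (poly p u)) (at_right 0)"
      using boundary_polynomial_on_line[OF v, of x] by blast
    have "g (x + u *\<^sub>R (a + \<rho> *\<^sub>R b)) = poly p u" for u
    proof -
      let ?x = "x + u *\<^sub>R (a + \<rho> *\<^sub>R b)"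
      have "((\<lambda>\<epsilon>. (?P (a + \<rho> *\<^sub>R b) ?x \<epsilon> - ?P a ?x \<epsilon>) + ?P a ?x \<epsilon>) \<longlongrightarrow> 0 + of_real (g ?x)) (at_right 0)"
        by (intro tendsto_add boundary_value_direction g) (use dir b in auto)
      then have "(?P (a + \<rho> *\<^sub>R b) ?x \<longlongrightarrow> of_real (g ?x)) (at_right 0)"
        by simp
      then have "complex_of_real (g ?x) = of_real (poly p u)"
        using p(2)[of u] by (intro tendsto_unique[of "at_right (0::real)"]) auto
      then show ?thesis
        by simp
    qed
    then show ?thesis
      using p(1) by blast
  qed
  \<comment> \<open>Coordinates of \<open>x\<close> in the family of \<open>a\<close> (index 0) and
    the vectors a + \<rho> b: each basis vector needs the coefficient (x \<bullet> b) / \<rho>, and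
    the coefficient of \<open>a\<close> cancels the copies of \<open>a\<close> thereby
    introduced.\<close>
  define s where "s b x = (if b = 0 then - (\<Sum>c\<in>Basis. (x \<bullet> c) / \<rho>) else (x \<bullet> b) / \<rho>)" for b x :: "real ^ 'n"
  have "real_polynomial_function (\<lambda>x. g (0 + (\<Sum>b\<in>insert 0 Basis. s b x *\<^sub>R (a + \<rho> *\<^sub>R b))))"
  proof (rule real_polynomial_function_on_lines)
    fix b :: "real ^ 'n"
    show "bounded_linear (s b)"
      unfolding s_def linear_conv_bounded_linear[symmetric]
      by (rule linearI) (auto simp: inner_add_left sum.distrib add_divide_distrib sum_distrib_left)
    assume "b \<in> insert 0 Basis"
    then show "\<exists>p. degree p \<le> k \<and> (\<forall>u. g (x + u *\<^sub>R (a + \<rho> *\<^sub>R b)) = poly p u)" for x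
      by (intro line) auto
  qed simp
  also have "(\<lambda>x. g (0 + (\<Sum>b\<in>insert 0 Basis. s b x *\<^sub>R (a + \<rho> *\<^sub>R b)))) = g"
  proof
    fix x :: "real ^ 'n"
    have "(\<Sum>b\<in>Basis. s b x *\<^sub>R (a + \<rho> *\<^sub>R b)) = (\<Sum>b\<in>Basis. ((x \<bullet> b) / \<rho>) *\<^sub>R a + (x \<bullet> b) *\<^sub>R b)"
      by (intro sum.cong refl) (use \<open>\<rho> > 0\<close> nonzero_Basis in \<open>auto simp: s_def scaleR_add_right\<close>)
    also have "\<dots> = (\<Sum>b\<in>Basis. (x \<bullet> b) / \<rho>) *\<^sub>R a + x"
      by (simp add: sum.distrib scaleR_sum_left euclidean_representation)
    finally have "(\<Sum>b\<in>insert 0 Basis. s b x *\<^sub>R (a + \<rho> *\<^sub>R b)) = x"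
      by (simp add: s_def)
    then show "g (0 + (\<Sum>b\<in>insert 0 Basis. s b x *\<^sub>R (a + \<rho> *\<^sub>R b))) = g x"
      by simp
  qed
  finally obtain G where G: "\<And>x. ceval G (cvec x) = of_real (g x)"
    using real_polynomial_function_imp_rpoly by blast
  have g2: "complex_of_real (g (2 *\<^sub>R x)) = 2 ^ k * of_real (g x)" for x
  proof (rule tendsto_unique)
    have "filterlim (\<lambda>\<epsilon>::real. \<epsilon> / 2) (at_right 0) (at_right 0)"
    proof (rule tendsto_imp_filterlim_at_right)
      have "((\<lambda>\<epsilon>::real. \<epsilon> / 2) \<longlongrightarrow> 0 / 2) (at_right 0)"
        by (intro tendsto_intros) simp
      then show "((\<lambda>\<epsilon>::real. \<epsilon> / 2) \<longlongrightarrow> 0) (at_right 0)"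
        by simp
    qed (auto simp: eventually_at_filter)
    then have "((\<lambda>\<epsilon>. ?P a x (\<epsilon> / 2)) \<longlongrightarrow> of_real (g x)) (at_right 0)"
      using filterlim_compose[OF g[of x]] by blast
    then have "((\<lambda>\<epsilon>. 2 ^ k * ?P a x (\<epsilon> / 2)) \<longlongrightarrow> 2 ^ k * of_real (g x)) (at_right 0)"
      by (intro tendsto_intros)
    moreover have "?P a (2 *\<^sub>R x) \<epsilon> = 2 ^ k * ?P a x (\<epsilon> / 2)" if "\<epsilon> > 0" for \<epsilon>
    proof -
      let ?z = "cvec x + (\<i> * of_real (\<epsilon> / 2)) *s cvec a"
      have z: "cvec (2 *\<^sub>R x) + (\<i> * of_real \<epsilon>) *s cvec a = 2 *s ?z"
        by (simp add: vec_eq_iff cvec_def)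
      have Cone: "imvec ?z \<in> Cone"
        using hyp_cone_scaleR[OF f a_in_cone, of "\<epsilon> / 2"] that by (simp add: imvec_add imvec_scale_cvec)
      have "upper_roots f e (2 *s ?z) = image_mset ((*) 2) (upper_roots f e ?z)"
        unfolding upper_roots_def line_roots_scale[OF f fe, of 2, OF zero_neq_numeral[symmetric]] filter_mset_image_mset by simp
      then have "upper_prod f e (2 *s ?z) = (\<Prod>r\<in>#upper_roots f e ?z. 2 * (- r))"
        by (simp add: upper_prod_def image_mset.compositionality o_def)
      also have "\<dots> = 2 ^ k * upper_prod f e ?z"
        by (simp only: prod_mset_scale upper_prod_def size_upper_roots[OF Cone])
      finally show ?thesis
        by (simp only: z)
    qed
    ultimately show "(?P a (2 *\<^sub>R x) \<longlongrightarrow> 2 ^ k * of_real (g x)) (at_right 0)"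
      by (elim Lim_transform_eventually) (auto simp: eventually_at_filter)
    show "(?P a (2 *\<^sub>R x) \<longlongrightarrow> of_real (g (2 *\<^sub>R x))) (at_right 0)"
      by (rule g)
  qed simp
  show thesis
  proof (rule that[of G])
    show "(?P a x \<longlongrightarrow> ceval G (cvec x)) (at_right 0)" for x
      using g[of x] by (simp add: G)
    show "ceval G (cvec (2 *\<^sub>R x)) = 2 ^ k * ceval G (cvec x)" for x
      by (simp add: G g2)
  qed
qed

end

section \<open>Splitting off a factor\<close>

context hyperbolic_pair
begin

text \<open>A root i \<tau> with \<tau> > 0 over the imaginary part \<open>a\<close> is what would
  make a + \<tau> e non-hyperbolic. Without upper roots the whole ray from \<open>a\<close> is
  hyperbolic, and rescaling its points covers the segment from \<open>e\<close> to
  \<open>a\<close>.\<close>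

lemma no_upper_roots_imp_same_cone:
  assumes "k = 0"
  shows "a \<in> hyp_cone f e"
proof -
  have ray: "hyperbolic f (a + \<tau> *\<^sub>R e)" if "\<tau> \<ge> 0" for \<tau>
    unfolding hyperbolic_iff_nonzero[OF f]
  proof (intro allI notI)
    fix x assume zero: "ceval f (cvec x + \<i> *s cvec (a + \<tau> *\<^sub>R e)) = 0"
    let ?z = "cvec x + \<i> *s cvec a"
    have "cvec x + \<i> *s cvec (a + \<tau> *\<^sub>R e) = ?z + (\<i> * of_real \<tau>) *s cvec e"
      by (simp add: vec_eq_iff cvec_def algebra_simps)
    then have root: "ceval f (?z + (\<i> * of_real \<tau>) *s cvec e) = 0"
      using zero by metis
    have z: "imvec ?z \<in> Cone"
      using a_in_cone by (simp add: imvec_add imvec_scale_cvec)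
    have "\<tau> \<noteq> 0"
      using root_not_real[OF z root] by simp
    then have "\<i> * of_real \<tau> \<in># upper_roots f e ?z"
      using that root by (simp add: upper_roots_def root_iff)
    then show False
      using size_upper_roots[OF z] assms by simp
  qed
  have "closed_segment e a \<subseteq> {e. hyperbolic f e}"
  proof
    fix y assume "y \<in> closed_segment e a"
    then obtain u where u: "0 \<le> u" "u \<le> 1" "y = (1 - u) *\<^sub>R e + u *\<^sub>R a"
      by (auto simp: in_segment)
    show "y \<in> {e. hyperbolic f e}"
    proof (cases "u = 0")
      case False
      then have "y = u *\<^sub>R (a + ((1 - u) / u) *\<^sub>R e)"
        by (simp add: u scaleR_add_right)
      then show ?thesis
        using hyperbolic_scaleR[OF f ray False] u by simp
    qed (use u e in simp)
  qed
  then show ?thesis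
    by (intro hyp_cone_eq_of_connected[OF f e connected_segment]) auto
qed

end

text \<open>Applying the construction to \<open>a\<close> and to \<open>- a\<close> gives both
  factors: complex conjugation turns the upper roots over \<open>- a\<close> into the lower roots
  over \<open>a\<close>. Since \<open>H\<close> has real values at real points, the conjugation
  disappears in the limit.\<close>

lemma hyperbolic_split:
  fixes f :: "'n::finite rpoly"
  assumes f: "homogeneous_deg f d" and e: "hyperbolic f e" and a: "hyperbolic f a"
    and "a \<notin> hyp_cone f e" "- a \<notin> hyp_cone f e"
  obtains g h k l where "f = g * h" "homogeneous_deg g k" "homogeneous_deg h l" "k \<ge> 1" "l \<ge> 1" "k + l = d"
proof -
  interpret A: hyperbolic_pair f d e a
    by unfold_locales (fact f e a)+
  interpret B: hyperbolic_pair f d e "- a"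
    by unfold_locales (fact f e hyperbolic_uminus[OF f a])+
  obtain G where G: "\<And>x. ((\<lambda>\<epsilon>. upper_prod f e (cvec x + (\<i> * of_real \<epsilon>) *s cvec a)) \<longlongrightarrow> ceval G (cvec x)) (at_right 0)"
    "\<And>x. ceval G (cvec (2 *\<^sub>R x)) = 2 ^ A.k * ceval G (cvec x)"
    using A.boundary_rpoly by metis
  obtain H where H: "\<And>x. ((\<lambda>\<epsilon>. upper_prod f e (cvec x + (\<i> * of_real \<epsilon>) *s cvec (- a))) \<longlongrightarrow> ceval H (cvec x)) (at_right 0)"
    "\<And>x. ceval H (cvec (2 *\<^sub>R x)) = 2 ^ B.k * ceval H (cvec x)"
    using B.boundary_rpoly by metis
  define z where "z x \<epsilon> = cvec x + (\<i> * complex_of_real \<epsilon>) *s cvec a" for x \<epsilon>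
  define z' where "z' x \<epsilon> = cvec x + (\<i> * complex_of_real \<epsilon>) *s cvec (- a)" for x \<epsilon>
  have z': "z' x \<epsilon> = (\<chi> i. cnj (z x \<epsilon> $ i))" for x \<epsilon>
    by (simp add: z_def z'_def vec_eq_iff cvec_def)
  have cone: "imvec (z x \<epsilon>) \<in> A.Cone" and cone': "imvec (z' x \<epsilon>) \<in> B.Cone" if "\<epsilon> > 0" for x \<epsilon>
    using hyp_cone_scaleR[OF f A.a_in_cone that] hyp_cone_scaleR[OF f B.a_in_cone that]
    by (simp_all add: z_def z'_def imvec_add imvec_scale_cvec)
  define lower where "lower w = filter_mset (\<lambda>r. \<not> Im r > 0) (line_roots f (cvec e) w)" for w
  have upper': "upper_roots f e (z' x \<epsilon>) = image_mset cnj (lower (z x \<epsilon>))" if "\<epsilon> > 0" for x \<epsilon>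
  proof -
    have "0 < Im (cnj r) \<longleftrightarrow> \<not> Im r > 0" if "r \<in># line_roots f (cvec e) (z x \<epsilon>)" for r
      using A.root_not_real[OF cone[OF \<open>\<epsilon> > 0\<close>]] that by (force simp: A.root_iff)
    then have "filter_mset (\<lambda>r. 0 < Im (cnj r)) (line_roots f (cvec e) (z x \<epsilon>)) = lower (z x \<epsilon>)"
      unfolding lower_def by (intro filter_mset_cong) auto
    then show ?thesis
      by (simp add: upper_roots_def z' line_roots_cnj[OF f A.fe] filter_mset_image_mset)
  qed
  have part: "line_roots f (cvec e) w = upper_roots f e w + lower w" for w
    unfolding upper_roots_def lower_def by (rule multiset_partition)
  have "size (line_roots f (cvec e) (z 0 1)) = A.k + B.k"
    using A.size_upper_roots[OF cone, of 1 0] B.size_upper_roots[OF cone', of 1 0] upper'[of 1 0]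
    by (simp add: part)
  then have kl: "A.k + B.k = d"
    by (simp add: line_roots_factorization(1)[OF f A.fe])
  have "A.k \<noteq> 0" "B.k \<noteq> 0"
    using A.no_upper_roots_imp_same_cone B.no_upper_roots_imp_same_cone assms(4,5) by auto
  have fac: "ceval f (z x \<epsilon>) = ceval f (cvec e) * (upper_prod f e (z x \<epsilon>) * cnj (upper_prod f e (z' x \<epsilon>)))"
    if "\<epsilon> > 0" for x \<epsilon>
  proof -
    have "ceval f (z x \<epsilon>) = ceval f (cvec e) * (\<Prod>r\<in>#line_roots f (cvec e) (z x \<epsilon>). - r)"
      using line_roots_factorization(2)[OF f A.fe, of "z x \<epsilon>" 0] by simp
    moreover have "cnj (upper_prod f e (z' x \<epsilon>)) = (\<Prod>r\<in>#lower (z x \<epsilon>). - r)"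
      by (simp add: upper_prod_def upper'[OF that] cnj_prod_mset image_mset.compositionality o_def)
    ultimately show ?thesis
      by (simp add: part upper_prod_def)
  qed
  have GH: "ceval f (cvec x) = ceval f (cvec e) * (ceval G (cvec x) * ceval H (cvec x))" for x
  proof (rule tendsto_unique)
    have "continuous_on UNIV (\<lambda>\<epsilon>. ceval f (z x \<epsilon>))"
      unfolding z_def vector_scalar_mult_def by (intro continuous_intros)
    then have "((\<lambda>\<epsilon>. ceval f (z x \<epsilon>)) \<longlongrightarrow> ceval f (z x 0)) (at_right 0)"
      unfolding continuous_on_def by (metis UNIV_I at_le subset_UNIV tendsto_mono)
    then show "((\<lambda>\<epsilon>. ceval f (z x \<epsilon>)) \<longlongrightarrow> ceval f (cvec x)) (at_right 0)"
      by (simp add: z_def)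
    have "((\<lambda>\<epsilon>. ceval f (cvec e) * (upper_prod f e (z x \<epsilon>) * cnj (upper_prod f e (z' x \<epsilon>)))) \<longlongrightarrow>
        ceval f (cvec e) * (ceval G (cvec x) * cnj (ceval H (cvec x)))) (at_right 0)"
      unfolding z_def z'_def by (intro tendsto_intros G H)
    moreover have "cnj (ceval H (cvec x)) = ceval H (cvec x)"
      using ceval_cvec_real by (simp add: Reals_cnj_iff)
    ultimately show "((\<lambda>\<epsilon>. ceval f (z x \<epsilon>)) \<longlongrightarrow> ceval f (cvec e) * (ceval G (cvec x) * ceval H (cvec x))) (at_right 0)"
      by (simp add: Lim_transform_eventually eventually_at_filter fac)
  qed simp
  obtain c where c: "ceval f (cvec e) = of_real c"
    using ceval_cvec_real by (metis Reals_cases)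
  have eq: "f = (Poly_Mapping.single 0 c * G) * H"
    by (rule rpoly_eqI, subst GH) (simp add: ceval_mult ceval_single c)
  have "f \<noteq> 0"
    using f by (simp add: homogeneous_deg_def)
  then have "Poly_Mapping.single 0 c * G \<noteq> 0" "H \<noteq> 0"
    using eq by auto
  then have "homogeneous_deg (Poly_Mapping.single 0 c * G) A.k" "homogeneous_deg H B.k"
    by (auto intro!: homogeneous_degI simp: ceval_mult ceval_single G(2) H(2))
  with eq kl \<open>A.k \<noteq> 0\<close> \<open>B.k \<noteq> 0\<close> show thesis
    by (intro that) auto
qed

text \<open>Takes the place of irreducibility: if it fails, every hyperbolic \<open>e\<close> has a
  partner \<open>a\<close> to which \<open>hyperbolic_split\<close> applies.\<close>

definition two_cones :: "'n::finite rpoly \<Rightarrow> bool" where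
  "two_cones f \<longleftrightarrow> (\<exists>e. hyperbolic f e \<and> (\<forall>a. hyperbolic f a \<longrightarrow> a \<in> hyp_cone f e \<or> - a \<in> hyp_cone f e))"

lemma hyperbolic_mult: "hyperbolic (g * h) e \<longleftrightarrow> hyperbolic g e \<and> hyperbolic h e"
  by (auto simp: hyperbolic_def ceval_mult)

text \<open>The clause on \<open>length L = d\<close> survives concatenation: lengths bounded by
  \<open>k\<close> and \<open>l\<close> can add up to \<open>k + l\<close> only if both bounds are
  attained.\<close>

lemma hyperbolic_factorization:
  assumes "homogeneous_deg f d" "d \<ge> 1" "hyperbolic f e"
  shows "\<exists>L. f = prod_list L \<and> (\<forall>g\<in>set L. two_cones g \<and> (\<exists>m\<ge>1. homogeneous_deg g m)) \<and>
    length L \<le> d \<and> (length L = d \<longrightarrow> (\<forall>g\<in>set L. homogeneous_deg g 1))"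
  using assms
proof (induction d arbitrary: f rule: less_induct)
  case (less d)
  show ?case
  proof (cases "two_cones f")
    case True
    then show ?thesis
      using less.prems by (intro exI[of _ "[f]"]) auto
  next
    case False
    then obtain a where a: "hyperbolic f a" "a \<notin> hyp_cone f e" "- a \<notin> hyp_cone f e"
      using less.prems(3) by (auto simp: two_cones_def)
    obtain g h k l where gh: "f = g * h" "homogeneous_deg g k" "homogeneous_deg h l" "k \<ge> 1" "l \<ge> 1" "k + l = d"
      using hyperbolic_split[OF less.prems(1,3) a] by metis
    have "hyperbolic g e" "hyperbolic h e"
      using less.prems(3) gh(1) by (auto simp: hyperbolic_mult)
    then obtain L M where "g = prod_list L" "\<forall>g\<in>set L. two_cones g \<and> (\<exists>m\<ge>1. homogeneous_deg g m)"
      "length L \<le> k" "length L = k \<longrightarrow> (\<forall>g\<in>set L. homogeneous_deg g 1)"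
      "h = prod_list M" "\<forall>g\<in>set M. two_cones g \<and> (\<exists>m\<ge>1. homogeneous_deg g m)"
      "length M \<le> l" "length M = l \<longrightarrow> (\<forall>g\<in>set M. homogeneous_deg g 1)"
      using less.IH[of k g] less.IH[of l h] gh by auto
    then show ?thesis
      using gh by (intro exI[of _ "L @ M"]) auto
  qed
qed

lemma homogeneous_deg_1_imp_linform:
  fixes g :: "'n::finite rpoly"
  assumes "homogeneous_deg g 1"
  shows "g = linform (\<chi> i. Poly_Mapping.lookup g (Poly_Mapping.single i 1))"
proof (rule poly_mapping_eqI)
  fix m :: "'n \<Rightarrow>\<^sub>0 nat"
  let ?s = "\<lambda>i::'n. Poly_Mapping.single i (1::nat)"
  have "Poly_Mapping.lookup (linform (\<chi> i. Poly_Mapping.lookup g (?s i))) m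
      = (\<Sum>i\<in>UNIV. if ?s i = m then Poly_Mapping.lookup g m else 0)"
    unfolding linform_def lookup_sum lookup_single when_def by (intro sum.cong) auto
  also have "\<dots> = Poly_Mapping.lookup g m"
  proof (cases "m \<in> Poly_Mapping.keys g")
    case True
    then have "(\<Sum>i\<in>UNIV. Poly_Mapping.lookup m i) = 1"
      using assms by (simp add: homogeneous_deg_def)
    then obtain i where i: "Poly_Mapping.lookup m i = 1" "\<And>j. j \<noteq> i \<Longrightarrow> Poly_Mapping.lookup m j = 0"
      using sum_eq_1_iff[of UNIV "Poly_Mapping.lookup m"] by (metis finite UNIV_I)
    have "?s j = m \<longleftrightarrow> j = i" for j
    proof
      assume "?s j = m"
      then have "Poly_Mapping.lookup (?s j) i = 1"
        using i by simp
      then show "j = i"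
        by (simp add: lookup_single when_def split: if_splits)
    next
      assume "j = i"
      then show "?s j = m"
        using i by (intro poly_mapping_eqI) (auto simp: lookup_single when_def)
    qed
    then show ?thesis
      by simp
  next
    case False
    then have "Poly_Mapping.lookup g m = 0"
      by (simp add: in_keys_iff)
    then show ?thesis
      by (simp cong: if_cong)
  qed
  finally show "Poly_Mapping.lookup g m = Poly_Mapping.lookup (linform (\<chi> i. Poly_Mapping.lookup g (?s i))) m"
    by simp
qed

lemma hyp_cone_linform:
  assumes "l \<bullet> e \<noteq> 0"
  shows "hyp_cone (linform l) e = {x. (l \<bullet> x) * (l \<bullet> e) > 0}"
proof -
  have "(\<forall>t. l \<bullet> x + t * (l \<bullet> e) = 0 \<longrightarrow> t < 0) \<longleftrightarrow> (l \<bullet> x) * (l \<bullet> e) > 0" for x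
  proof -
    have "l \<bullet> x + t * (l \<bullet> e) = 0 \<longleftrightarrow> t = - (l \<bullet> x) / (l \<bullet> e)" for t
      using assms by (auto simp: field_simps)
    then have "(\<forall>t. l \<bullet> x + t * (l \<bullet> e) = 0 \<longrightarrow> t < 0) \<longleftrightarrow> - (l \<bullet> x) / (l \<bullet> e) < 0"
      by simp
    also have "\<dots> \<longleftrightarrow> (l \<bullet> x) * (l \<bullet> e) > 0"
      using assms by (auto simp: zero_less_divide_iff zero_less_mult_iff)
    finally show ?thesis .
  qed
  then show ?thesis
    by (simp add: hyp_cone_def ceval_linform_cvec inner_add_right del: of_real_add)
qed

text \<open>The two cones of \<open>g\<close> are opposite, convex and open, and avoid 0, so the
  side of a separating hyperplane tells them apart. A linear \<open>g\<close> has to serve as its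
  own form in order to recover \<open>f\<close> in the case of equality.\<close>

lemma separating_linform:
  fixes g :: "'n::finite rpoly"
  assumes "two_cones g" and g: "homogeneous_deg g m" "m \<ge> 1"
  shows "\<exists>l. (\<forall>e a. hyperbolic g e \<longrightarrow> hyperbolic g a \<longrightarrow> l \<bullet> e \<noteq> 0 \<and>
      ((l \<bullet> e > 0) = (l \<bullet> a > 0) \<longrightarrow> hyp_cone g e = hyp_cone g a)) \<and> (homogeneous_deg g 1 \<longrightarrow> g = linform l)"
proof (cases "homogeneous_deg g 1")
  case True
  then obtain l where l: "g = linform l"
    using homogeneous_deg_1_imp_linform by blast
  have nz: "l \<bullet> e \<noteq> 0" if "hyperbolic g e" for e
    using hyperbolic_nonzero[OF that] by (simp add: l ceval_linform_cvec)
  have "hyp_cone g e = hyp_cone g a" if "hyperbolic g e" "hyperbolic g a" "(l \<bullet> e > 0) = (l \<bullet> a > 0)" for e a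
    using nz[OF that(1)] nz[OF that(2)] that(3) unfolding l by (auto simp: hyp_cone_linform zero_less_mult_iff)
  then show ?thesis
    using nz l by blast
next
  case False
  obtain e0 where e0: "hyperbolic g e0" and two: "\<And>a. hyperbolic g a \<Longrightarrow> a \<in> hyp_cone g e0 \<or> - a \<in> hyp_cone g e0"
    using assms(1) by (auto simp: two_cones_def)
  let ?C = "hyp_cone g e0"
  note ne0 = hyperbolic_nonzero[OF e0]
  have "0 \<notin> ?C"
    using hyp_cone_nonzero[OF g(1) ne0, of 0] ceval_scale[OF g(1), of 0 0] g(2) by (auto simp: power_0_left)
  then obtain l where l: "l \<noteq> 0" "\<And>x. x \<in> ?C \<Longrightarrow> 0 \<le> l \<bullet> x"
    using separating_hyperplane_set_0_inspan[OF convex_hyp_cone[OF g(1) e0]] hyp_cone_self[OF g(1) ne0] by blast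
  \<comment> \<open>Separation only gives a weak inequality; a small step against \<open>l\<close>
    inside the open cone makes it strict.\<close>
  have pos: "l \<bullet> x > 0" if x: "x \<in> ?C" for x
  proof -
    obtain r where r: "r > 0" "ball x r \<subseteq> ?C"
      using open_hyp_cone[OF g(1) ne0] x open_contains_ball by blast
    let ?y = "x - (r / 2 / norm l) *\<^sub>R l"
    have "?y \<in> ball x r"
      using l(1) r(1) by (simp add: dist_norm)
    then have "0 \<le> l \<bullet> ?y"
      using r(2) l(2) by blast
    moreover have "(r / 2 / norm l) * (l \<bullet> l) > 0"
      using r(1) l(1) by simp
    ultimately show ?thesis
      by (simp add: inner_diff_right)
  qed
  have cone: "l \<bullet> e > 0 \<and> hyp_cone g e = ?C \<or> l \<bullet> e < 0 \<and> hyp_cone g e = {x. - x \<in> ?C}" if e: "hyperbolic g e" for e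
    using two[OF e]
  proof
    assume "e \<in> ?C"
    then show ?thesis
      using pos hyp_cone_eqI[OF g(1) e0] by blast
  next
    assume "- e \<in> ?C"
    then have "l \<bullet> e < 0" "hyp_cone g (- e) = ?C"
      using pos[of "- e"] hyp_cone_eqI[OF g(1) e0] by auto
    moreover have "hyp_cone g e = {x. - x \<in> hyp_cone g (- e)}"
      using hyp_cone_uminus[OF g(1) hyperbolic_nonzero[OF e]] by auto
    ultimately show ?thesis
      by simp
  qed
  have "l \<bullet> e \<noteq> 0 \<and> ((l \<bullet> e > 0) = (l \<bullet> a > 0) \<longrightarrow> hyp_cone g e = hyp_cone g a)"
    if "hyperbolic g e" "hyperbolic g a" for e a
    using cone[OF that(1)] cone[OF that(2)] by auto
  then show ?thesis
    using False by blast
qed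

section \<open>Regions of central hyperplane arrangements\<close>

text \<open>A region of the central arrangement cut out by the \<open>a i\<close> is coded by its
  set of positive indices. The subspace \<open>W\<close> is a parameter so that restriction to a
  hyperplane stays within the definition.\<close>

definition sign_patterns :: "('i \<Rightarrow> 'a::euclidean_space) \<Rightarrow> 'i set \<Rightarrow> 'a set \<Rightarrow> 'i set set" where
  "sign_patterns a I W = {X. X \<subseteq> I \<and> (\<exists>x\<in>W. (\<forall>i\<in>X. a i \<bullet> x > 0) \<and> (\<forall>i\<in>I - X. a i \<bullet> x < 0))}"

text \<open>Linear independence of the functionals given by the \<open>a j\<close> on
  \<open>W\<close>, as an indexed family: a repeated vector counts as a dependence.\<close>

definition indep_on :: "('i \<Rightarrow> 'a::euclidean_space) \<Rightarrow> 'i set \<Rightarrow> 'a set \<Rightarrow> bool" where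
  "indep_on a J W \<longleftrightarrow> (\<forall>c. (\<forall>x\<in>W. (\<Sum>j\<in>J. c j * (a j \<bullet> x)) = 0) \<longrightarrow> (\<forall>j\<in>J. c j = (0::real)))"

text \<open>The number of regions of \<open>k\<close> generic central hyperplanes in dimension
  \<open>n\<close>, uniformly for k <= n and k > n because the surplus binomials vanish. The case k
  = 0 is separate since truncated subtraction would give 2 instead of 1 for n >= 1.\<close>

definition region_bound :: "nat \<Rightarrow> nat \<Rightarrow> nat" where
  "region_bound n k = (if k = 0 then 1 else 2 * (\<Sum>j<n. (k - 1) choose j))"

lemma finite_sign_patterns: "finite I \<Longrightarrow> finite (sign_patterns a I W)"
  by (rule finite_subset[of _ "Pow I"]) (auto simp: sign_patterns_def)

text \<open>Pascal's rule, the numerical form of deletion and restriction.\<close>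

lemma region_bound_Suc:
  assumes "n \<ge> 1"
  shows "region_bound n (Suc k) = region_bound n k + region_bound (n - 1) k"
proof -
  obtain m where m: "n = Suc m"
    using assms by (cases n) auto
  show ?thesis
  proof (cases k)
    case 0
    have "(\<Sum>j<Suc m. 0 choose j) = 1"
      by (subst sum.lessThan_Suc_shift) simp
    then show ?thesis
      by (simp only: region_bound_def m 0) simp
  next
    case (Suc l)
    have "(\<Sum>j<Suc m. Suc l choose j) = (\<Sum>j<Suc m. l choose j) + (\<Sum>j<m. l choose j)"
      unfolding sum.lessThan_Suc_shift by (simp add: sum.distrib)
    then show ?thesis
      by (simp add: region_bound_def m Suc)
  qed
qed

lemma region_bound_pos: "n \<ge> 1 \<Longrightarrow> region_bound n k > 0"
  by (cases n) (auto simp: region_bound_def sum.lessThan_Suc_shift simp del: sum.lessThan_Suc)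

lemma region_bound_eq_power:
  assumes "k \<le> n"
  shows "region_bound n k = 2 ^ k"
proof (cases k)
  case (Suc l)
  have "(\<Sum>j<n. l choose j) = (\<Sum>j\<le>l. l choose j)"
    using assms Suc by (intro sum.mono_neutral_right) (auto simp: binomial_eq_0)
  then show ?thesis
    by (simp add: region_bound_def Suc choose_row_sum)
qed (simp add: region_bound_def)

lemma cone_bound_eq_region_bound:
  assumes "n \<ge> 1" "d \<ge> 1"
  shows "cone_bound n d = region_bound n d"
proof -
  have "{0..n - 1} = {..<n}"
    using assms by auto
  then have "region_bound n d = 2 * (\<Sum>k=0..n-1. (d - 1) choose k)"
    using assms(2) unfolding region_bound_def by simp
  then show ?thesis
    using region_bound_eq_power[of d n] by (auto simp: cone_bound_def)
qed

lemma region_bound_mono: "n \<ge> 1 \<Longrightarrow> k \<le> m \<Longrightarrow> region_bound n k \<le> region_bound n m"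
  by (rule lift_Suc_mono_le[of "region_bound n"]) (auto simp: region_bound_Suc)

lemma region_bound_strict_mono:
  assumes "n \<ge> 2" "k < m"
  shows "region_bound n k < region_bound n m"
  by (rule lift_Suc_mono_less[of "region_bound n"])
     (use assms region_bound_pos[of "n - 1"] in \<open>auto simp: region_bound_Suc\<close>)

section \<open>Deletion and restriction\<close>

lemma sign_condition_perturb:
  fixes a :: "'i \<Rightarrow> 'a::euclidean_space"
  assumes "finite I" "X \<subseteq> I" and x: "\<forall>i\<in>X. a i \<bullet> x > 0" "\<forall>i\<in>I - X. a i \<bullet> x < 0"
  obtains t where "t > 0"
    "\<And>s. \<bar>s\<bar> \<le> t \<Longrightarrow> (\<forall>i\<in>X. a i \<bullet> (x + s *\<^sub>R w) > 0) \<and> (\<forall>i\<in>I - X. a i \<bullet> (x + s *\<^sub>R w) < 0)"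
proof -
  let ?U = "(\<Inter>i\<in>X. {y. a i \<bullet> y > 0}) \<inter> (\<Inter>i\<in>I - X. {y. a i \<bullet> y < 0})"
  have "finite X"
    using assms finite_subset by blast
  then have opn: "open ?U"
    using \<open>finite I\<close> by (intro open_Int open_INT ballI open_halfspace_gt open_halfspace_lt) auto
  have "x \<in> ?U"
    using x by auto
  then obtain r where r: "r > 0" "ball x r \<subseteq> ?U"
    by (rule openE[OF opn])
  define t where "t = r / 2 / (norm w + 1)"
  have nw: "norm w + 1 > 0"
    by (simp add: add_nonneg_pos)
  show thesis
  proof (rule that[of t])
    show "t > 0"
      using r nw by (simp add: t_def)
    fix s assume "\<bar>s\<bar> \<le> t"
    then have "\<bar>s\<bar> * norm w \<le> t * (norm w + 1)"
      by (intro mult_mono) auto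
    also have "\<dots> = r / 2"
      unfolding t_def using nw by (intro nonzero_divide_eq_eq[THEN iffD1, symmetric]) auto
    also have "\<dots> < r"
      using r by simp
    finally have "x + s *\<^sub>R w \<in> ball x r"
      by (simp add: dist_norm)
    then show "(\<forall>i\<in>X. a i \<bullet> (x + s *\<^sub>R w) > 0) \<and> (\<forall>i\<in>I - X. a i \<bullet> (x + s *\<^sub>R w) < 0)"
      using r(2) by auto
  qed
qed

text \<open>With N and P the patterns on \<open>I\<close> realized on the negative and the positive
  side of hyperplane \<open>i\<close>, the count is |N| + |P| = |N \<union> P| + |N \<inter> P|. The
  union is the deletion, the intersection the restriction; \<open>w\<close> ensures that the
  hyperplane is proper in \<open>W\<close>.\<close>

lemma card_sign_patterns_insert:
  fixes a :: "'i \<Rightarrow> 'a::euclidean_space"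
  assumes "finite I" "i \<notin> I" and W: "subspace W" and w: "w \<in> W" "a i \<bullet> w \<noteq> 0"
  shows "card (sign_patterns a (insert i I) W)
       = card (sign_patterns a I W) + card (sign_patterns a I (W \<inter> {x. a i \<bullet> x = 0}))"
proof -
  define sat where "sat X x \<longleftrightarrow> (\<forall>j\<in>X. a j \<bullet> x > 0) \<and> (\<forall>j\<in>I - X. a j \<bullet> x < 0)" for X x
  define S where "S P = {X. X \<subseteq> I \<and> (\<exists>x\<in>W. sat X x \<and> P (a i \<bullet> x))}" for P :: "real \<Rightarrow> bool"
  let ?N = "S (\<lambda>y. y < 0)" and ?P = "S (\<lambda>y. y > 0)"
  have finS: "finite (S P)" for P
    by (rule finite_subset[of _ "Pow I"]) (use \<open>finite I\<close> in \<open>auto simp: S_def\<close>)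
  have pat: "sign_patterns a (insert i I) W = ?N \<union> insert i ` ?P"
  proof (intro set_eqI iffI)
    fix X assume "X \<in> sign_patterns a (insert i I) W"
    then obtain x where x: "X \<subseteq> insert i I" "x \<in> W" "\<forall>j\<in>X. a j \<bullet> x > 0" "\<forall>j\<in>insert i I - X. a j \<bullet> x < 0"
      by (auto simp: sign_patterns_def)
    show "X \<in> ?N \<union> insert i ` ?P"
    proof (cases "i \<in> X")
      case True
      then have "X - {i} \<in> ?P" "X = insert i (X - {i})"
        using x \<open>i \<notin> I\<close> by (auto simp: S_def sat_def)
      then show ?thesis
        by blast
    next
      case False
      then have "X \<in> ?N"
        using x by (auto simp: S_def sat_def)
      then show ?thesis
        by blast
    qed
  next
    fix X assume "X \<in> ?N \<union> insert i ` ?P"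
    then consider "X \<in> ?N" | Y where "X = insert i Y" "Y \<in> ?P"
      by blast
    then show "X \<in> sign_patterns a (insert i I) W"
    proof cases
      case 1
      then obtain x where "X \<subseteq> I" "x \<in> W" "sat X x" "a i \<bullet> x < 0"
        by (auto simp: S_def)
      then show ?thesis
        unfolding sign_patterns_def sat_def by blast
    next
      case 2
      then obtain x where "Y \<subseteq> I" "x \<in> W" "sat Y x" "a i \<bullet> x > 0"
        by (auto simp: S_def)
      then show ?thesis
        unfolding sign_patterns_def sat_def 2 by blast
    qed
  qed
  \<comment> \<open>A point on the hyperplane can be pushed along \<open>w\<close> to either side
    without changing the other signs.\<close>
  have perturb: "X \<in> S (\<lambda>y. y < 0)" "X \<in> S (\<lambda>y. y > 0)"
    if X: "X \<subseteq> I" "x \<in> W" "sat X x" "a i \<bullet> x = 0" for X x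
  proof -
    obtain t where t: "t > 0" "\<And>s. \<bar>s\<bar> \<le> t \<Longrightarrow> sat X (x + s *\<^sub>R w)"
      using sign_condition_perturb[OF \<open>finite I\<close> X(1), of a x w] X(3) unfolding sat_def by metis
    define s where "s = t * sgn (a i \<bullet> w)"
    have s: "\<bar>s\<bar> \<le> t" "\<bar>- s\<bar> \<le> t" "s * (a i \<bullet> w) > 0"
      using t(1) w(2) by (auto simp: s_def abs_mult sgn_if mult_pos_neg)
    have "x + s *\<^sub>R w \<in> W" "x + (- s) *\<^sub>R w \<in> W"
      using W X(2) w(1) by (auto intro: subspace_add subspace_diff subspace_scale)
    moreover have "a i \<bullet> (x + s *\<^sub>R w) > 0" "a i \<bullet> (x + (- s) *\<^sub>R w) < 0"
      using s(3) X(4) by (auto simp: inner_add_right inner_diff_right)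
    ultimately show "X \<in> S (\<lambda>y. y < 0)" "X \<in> S (\<lambda>y. y > 0)"
      using X(1) t(2)[OF s(1)] t(2)[OF s(2)] unfolding S_def by blast+
  qed
  have un: "?N \<union> ?P = sign_patterns a I W"
  proof (intro set_eqI iffI)
    fix X assume "X \<in> sign_patterns a I W"
    then obtain x where x: "X \<subseteq> I" "x \<in> W" "sat X x"
      by (auto simp: sign_patterns_def sat_def)
    then show "X \<in> ?N \<union> ?P"
      using perturb(1)[OF x] by (cases "a i \<bullet> x" "0::real" rule: linorder_cases) (auto simp: S_def)
  qed (auto simp: S_def sign_patterns_def sat_def)
  have int: "?N \<inter> ?P = sign_patterns a I (W \<inter> {x. a i \<bullet> x = 0})"
  proof (intro set_eqI iffI)
    fix X assume "X \<in> ?N \<inter> ?P"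
    then obtain x y where xy: "X \<subseteq> I" "x \<in> W" "sat X x" "a i \<bullet> x < 0" "y \<in> W" "sat X y" "a i \<bullet> y > 0"
      by (auto simp: S_def)
    \<comment> \<open>Both coefficients are positive, so the combination keeps the signs shared by
      \<open>x\<close> and \<open>y\<close> while landing on the hyperplane.\<close>
    define z where "z = (a i \<bullet> y) *\<^sub>R x + (- (a i \<bullet> x)) *\<^sub>R y"
    have "a i \<bullet> z = 0"
      by (simp add: z_def inner_add_right inner_diff_right)
    moreover have "z \<in> W"
      using W xy unfolding z_def by (intro subspace_add subspace_scale) auto
    moreover have "sat X z"
      unfolding sat_def
    proof (intro conjI ballI)
      fix j assume "j \<in> X"
      then have "(a i \<bullet> y) * (a j \<bullet> x) > 0" "(a i \<bullet> x) * (a j \<bullet> y) < 0"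
        using xy by (auto simp: sat_def mult_neg_pos)
      then show "a j \<bullet> z > 0"
        by (simp add: z_def inner_add_right inner_diff_right)
    next
      fix j assume "j \<in> I - X"
      then have "(a i \<bullet> y) * (a j \<bullet> x) < 0" "(a i \<bullet> x) * (a j \<bullet> y) > 0"
        using xy by (auto simp: sat_def mult_pos_neg mult_neg_neg)
      then show "a j \<bullet> z < 0"
        by (simp add: z_def inner_add_right inner_diff_right)
    qed
    ultimately show "X \<in> sign_patterns a I (W \<inter> {x. a i \<bullet> x = 0})"
      using xy(1) unfolding sign_patterns_def sat_def by blast
  next
    fix X assume "X \<in> sign_patterns a I (W \<inter> {x. a i \<bullet> x = 0})"
    then obtain x where x: "X \<subseteq> I" "x \<in> W" "sat X x" "a i \<bullet> x = 0"
      unfolding sign_patterns_def sat_def by blast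
    then show "X \<in> ?N \<inter> ?P"
      using perturb[OF x] by blast
  qed
  have "card (sign_patterns a (insert i I) W) = card ?N + card (insert i ` ?P)"
    unfolding pat by (rule card_Un_disjoint) (use finS \<open>i \<notin> I\<close> in \<open>auto simp: S_def\<close>)
  also have "card (insert i ` ?P) = card ?P"
    by (rule card_image, rule inj_onI) (use \<open>i \<notin> I\<close> in \<open>auto simp: S_def dest!: insert_ident[THEN iffD1, rotated 2]\<close>)
  also have "card ?N + card ?P = card (?N \<union> ?P) + card (?N \<inter> ?P)"
    by (rule card_Un_Int) (rule finS)+
  finally show ?thesis
    by (simp only: un int)
qed

lemma dim_Int_hyperplane:
  fixes W :: "'a::euclidean_space set"
  assumes W: "subspace W" and w: "w \<in> W" "v \<bullet> w \<noteq> 0"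
  shows "dim W = Suc (dim (W \<inter> {x. v \<bullet> x = 0}))"
proof -
  let ?H = "W \<inter> {x. v \<bullet> x = 0}"
  have H: "subspace ?H"
    using W by (intro subspace_inter subspace_hyperplane)
  have "span (insert w ?H) = W"
  proof
    show "span (insert w ?H) \<subseteq> W"
      using W w by (intro span_minimal) auto
    show "W \<subseteq> span (insert w ?H)"
    proof
      fix x assume x: "x \<in> W"
      let ?c = "(v \<bullet> x) / (v \<bullet> w)"
      have "x - ?c *\<^sub>R w \<in> ?H"
        using W w x by (auto simp: inner_diff_right intro!: subspace_diff subspace_scale)
      then have "(x - ?c *\<^sub>R w) + ?c *\<^sub>R w \<in> span (insert w ?H)"
        by (intro span_add span_scale span_base) auto
      then show "x \<in> span (insert w ?H)"
        by simp
    qed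
  qed
  then have "dim W = dim (insert w ?H)"
    by (metis dim_span)
  moreover have "w \<notin> span ?H"
    using w H by (simp add: span_eq_iff[THEN iffD2])
  ultimately show ?thesis
    by (simp add: dim_insert)
qed

lemma sign_patterns_vanishing: "(\<And>w. w \<in> W \<Longrightarrow> a i \<bullet> w = 0) \<Longrightarrow> sign_patterns a (insert i I) W = {}"
  by (force simp: sign_patterns_def)

lemma sign_patterns_empty: "subspace W \<Longrightarrow> sign_patterns a {} W = {{}}"
  by (auto simp: sign_patterns_def dest: subspace_0)

lemma card_sign_patterns_le:
  fixes a :: "'i \<Rightarrow> 'a::euclidean_space"
  assumes "finite I" "subspace W"
  shows "card (sign_patterns a I W) \<le> region_bound (dim W) (card I)"
  using assms
proof (induction I arbitrary: W rule: finite_induct)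
  case empty
  then show ?case
    by (simp add: sign_patterns_empty region_bound_def)
next
  case (insert i I)
  show ?case
  proof (cases "\<forall>w\<in>W. a i \<bullet> w = 0")
    case True
    then show ?thesis
      by (simp add: sign_patterns_vanishing)
  next
    case False
    then obtain w where w: "w \<in> W" "a i \<bullet> w \<noteq> 0"
      by blast
    have "subspace (W \<inter> {x. a i \<bullet> x = 0})"
      using insert.prems by (intro subspace_inter subspace_hyperplane)
    then show ?thesis
      using insert.IH[OF insert.prems] insert.IH[of "W \<inter> {x. a i \<bullet> x = 0}"] insert.hyps
        dim_Int_hyperplane[OF insert.prems w]
      by (simp add: card_sign_patterns_insert[where a = a, OF insert.hyps insert.prems w] region_bound_Suc)
  qed
qed

text \<open>Deleting an index outside \<open>J\<close> preserves equality, since both terms of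
  deletion and restriction are bounded. What remains is I = J, where all sign patterns occur and one
  of them refutes any given nontrivial relation.\<close>

lemma max_sign_patterns_imp_indep:
  fixes a :: "'i \<Rightarrow> 'a::euclidean_space"
  assumes "finite I" "subspace W" "card (sign_patterns a I W) = region_bound (dim W) (card I)"
    and "J \<subseteq> I" "card J \<le> dim W"
  shows "indep_on a J W"
  using assms
proof (induction I rule: finite_psubset_induct)
  case (psubset I)
  note W = psubset.prems(1)
  show ?case
  proof (cases "J = I")
    case True
    have fin: "finite (Pow I)"
      using psubset.hyps by simp
    have "card (sign_patterns a I W) = card (Pow I)"
      using psubset True by (simp add: region_bound_eq_power card_Pow)
    moreover have "sign_patterns a I W \<subseteq> Pow I"
      by (auto simp: sign_patterns_def)
    ultimately have all: "sign_patterns a I W = Pow I"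
      using card_subset_eq[OF fin] by blast
    show ?thesis
      unfolding indep_on_def True
    proof (intro allI impI ballI)
      fix c j assume c: "\<forall>x\<in>W. (\<Sum>j\<in>I. c j * (a j \<bullet> x)) = 0" and j: "j \<in> I"
      \<comment> \<open>A point positive exactly where the coefficient is positive makes every term
        of the relation nonnegative, hence zero, although no \<open>a j \<bullet> x\<close>
        vanishes.\<close>
      have "{i\<in>I. c i > 0} \<in> sign_patterns a I W"
        using all by auto
      then obtain x where x: "x \<in> W" "\<forall>i\<in>{i\<in>I. c i > 0}. a i \<bullet> x > 0" "\<forall>i\<in>I - {i\<in>I. c i > 0}. a i \<bullet> x < 0"
        by (auto simp: sign_patterns_def)
      have nonneg: "c i * (a i \<bullet> x) \<ge> 0" if "i \<in> I" for i
      proof (cases "c i > 0")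
        case True
        then show ?thesis
          using x that by (simp add: less_imp_le)
      next
        case False
        then have "a i \<bullet> x < 0"
          using x that by simp
        then show ?thesis
          using False by (intro mult_nonpos_nonpos) auto
      qed
      then have "c j * (a j \<bullet> x) = 0"
        using sum_nonneg_eq_0_iff[OF psubset.hyps, of "\<lambda>i. c i * (a i \<bullet> x)"] c x(1) j by auto
      moreover have "a j \<bullet> x \<noteq> 0"
        using x j by (cases "c j > 0") force+
      ultimately show "c j = 0"
        by simp
    qed
  next
    case False
    then obtain i where i: "i \<in> I" "i \<notin> J"
      using psubset.prems by blast
    define I' where "I' = I - {i}"
    have I': "I = insert i I'" "i \<notin> I'" "finite I'" "J \<subseteq> I'" "I' \<subset> I"
      using i psubset by (auto simp: I'_def)
    show ?thesis
    proof (cases "\<forall>w\<in>W. a i \<bullet> w = 0")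
      case True
      \<comment> \<open>There are no patterns at all, so equality makes the bound 0, which only
        happens in dimension 0; then \<open>J\<close> is empty.\<close>
      then have "region_bound (dim W) (card I) = 0"
        using sign_patterns_vanishing[of W a i I'] psubset.prems(2) by (simp add: I'(1))
      then have "dim W = 0"
        using region_bound_pos[of "dim W" "card I"] by (cases "dim W") auto
      then have "J = {}"
        using psubset.prems(4) finite_subset[OF psubset.prems(3) psubset.hyps(1)] by (simp only: le_zero_eq card_0_eq)
      then show ?thesis
        by (simp add: indep_on_def)
    next
      case False
      then obtain w where w: "w \<in> W" "a i \<bullet> w \<noteq> 0"
        by blast
      let ?H = "W \<inter> {x. a i \<bullet> x = 0}"
      have H: "subspace ?H"
        using W by (intro subspace_inter subspace_hyperplane)
      have "card (sign_patterns a I' W) + card (sign_patterns a I' ?H)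
          = region_bound (dim W) (card I') + region_bound (dim ?H) (card I')"
        using card_sign_patterns_insert[where a = a, OF I'(3,2) W w] psubset.prems(2) I'(1,2,3) dim_Int_hyperplane[OF W w]
        by (simp add: region_bound_Suc)
      then have "card (sign_patterns a I' W) = region_bound (dim W) (card I')"
        using card_sign_patterns_le[OF I'(3) W, of a] card_sign_patterns_le[OF I'(3) H, of a] by linarith
      then show ?thesis
        using psubset.IH[OF I'(5) W _ I'(4)] psubset.prems(4) by blast
    qed
  qed
qed

lemma indep_on_subset:
  assumes "indep_on a J W" "J' \<subseteq> J" "finite J"
  shows "indep_on a J' W"
  unfolding indep_on_def
proof (intro allI impI ballI)
  fix c j assume c: "\<forall>x\<in>W. (\<Sum>j\<in>J'. c j * (a j \<bullet> x)) = 0" and j: "j \<in> J'"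
  let ?c = "\<lambda>j. if j \<in> J' then c j else 0"
  have "(\<Sum>j\<in>J. ?c j * (a j \<bullet> x)) = (\<Sum>j\<in>J'. c j * (a j \<bullet> x))" for x
    using assms(2,3) by (intro sum.mono_neutral_cong_right) auto
  then have "\<forall>j\<in>J. ?c j = 0"
    using assms(1)[unfolded indep_on_def, rule_format, of ?c] c by simp
  then show "c j = 0"
    using j assms(2) by (metis subsetD)
qed

text \<open>Both smaller arrangements inherit independence: the deletion as a subfamily, the
  restriction because a relation on the hyperplane extends to one on \<open>W\<close> involving
  \<open>a i\<close>.\<close>

lemma indep_imp_max_sign_patterns:
  fixes a :: "'i \<Rightarrow> 'a::euclidean_space"
  assumes "finite I" "subspace W"
    and "\<And>J. J \<subseteq> I \<Longrightarrow> card J = min (dim W) (card I) \<Longrightarrow> indep_on a J W"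
  shows "card (sign_patterns a I W) = region_bound (dim W) (card I)"
  using assms
proof (induction I arbitrary: W rule: finite_induct)
  case empty
  then show ?case
    by (simp add: sign_patterns_empty region_bound_def)
next
  case (insert i I)
  note W = insert.prems(1)
  have fin: "finite J" if "J \<subseteq> I" for J
    using that insert.hyps finite_subset by blast
  have ind: "indep_on a (insert i J) W" if "J \<subseteq> I" "Suc (card J) = min (dim W) (Suc (card I))" for J
  proof -
    have "i \<notin> J"
      using that(1) insert.hyps by blast
    then show ?thesis
      using insert.prems(2)[of "insert i J"] that insert.hyps fin[OF that(1)] by auto
  qed
  show ?case
  proof (cases "dim W = 0")
    case True
    then have "W \<subseteq> {0}"
      by simp
    then have "a i \<bullet> w = 0" if "w \<in> W" for w
      using that by auto
    moreover have "region_bound (dim W) (Suc (card I)) = 0"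
      unfolding True region_bound_def by simp
    ultimately show ?thesis
      using insert.hyps by (simp add: sign_patterns_vanishing)
  next
    case False
    then have "dim W \<ge> 1"
      by linarith
    \<comment> \<open>An admissible index set containing \<open>i\<close> shows that
      \<open>a i\<close> does not vanish on \<open>W\<close>.\<close>
    obtain J0 where J0: "J0 \<subseteq> I" "card J0 = min (dim W - 1) (card I)"
      using obtain_subset_with_card_n[of "min (dim W - 1) (card I)" I] by auto
    have "\<exists>w\<in>W. a i \<bullet> w \<noteq> 0"
    proof (rule ccontr)
      assume "\<not> (\<exists>w\<in>W. a i \<bullet> w \<noteq> 0)"
      moreover have "indep_on a (insert i J0) W"
        using J0 \<open>dim W \<ge> 1\<close> by (intro ind) (auto simp: min_def)
      ultimately have "\<forall>j\<in>insert i J0. (if j = i then 1 else 0) = (0::real)"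
        unfolding indep_on_def by (elim allE[of _ "\<lambda>j. if j = i then 1 else 0"] impE) (auto intro!: sum.neutral)
      then show False
        by simp
    qed
    then obtain w where w: "w \<in> W" "a i \<bullet> w \<noteq> 0"
      by blast
    let ?H = "W \<inter> {x. a i \<bullet> x = 0}"
    note dimH = dim_Int_hyperplane[OF W w]
    have H: "subspace ?H"
      using W by (intro subspace_inter subspace_hyperplane)
    have "card (sign_patterns a I W) = region_bound (dim W) (card I)"
    proof (rule insert.IH[OF W])
      fix J assume J: "J \<subseteq> I" "card J = min (dim W) (card I)"
      show "indep_on a J W"
      \<comment> \<open>The prescribed size for \<open>I\<close> is one less than that for
        \<open>insert i I\<close> exactly when card I < dim W; then \<open>i\<close> is added to
        \<open>J\<close> and removed again.\<close>
      proof (cases "card I < dim W")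
        case True
        then have "indep_on a (insert i J) W"
          using J by (intro ind) auto
        then show ?thesis
          by (rule indep_on_subset) (use fin J in auto)
      next
        case False
        then show ?thesis
          using J insert.hyps by (intro insert.prems(2)) auto
      qed
    qed
    moreover have "card (sign_patterns a I ?H) = region_bound (dim ?H) (card I)"
    proof (rule insert.IH[OF H])
      fix J assume J: "J \<subseteq> I" "card J = min (dim ?H) (card I)"
      have indJ: "indep_on a (insert i J) W"
        using J dimH by (intro ind) auto
      have iJ: "i \<notin> J"
        using J insert.hyps by auto
      show "indep_on a J ?H"
        unfolding indep_on_def
      proof (intro allI impI ballI)
        fix c j assume c: "\<forall>x\<in>?H. (\<Sum>j\<in>J. c j * (a j \<bullet> x)) = 0" and j: "j \<in> J"
        define F where "F x = (\<Sum>j\<in>J. c j * (a j \<bullet> x))" for x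
        \<comment> \<open>Along \<open>w\<close> the relation fails by \<open>F w\<close>; this
          coefficient of \<open>a i\<close> compensates for it, so that the relation holds on all of
          \<open>W\<close>.\<close>
        let ?c = "\<lambda>j. if j = i then - F w / (a i \<bullet> w) else c j"
        have "(\<Sum>j\<in>insert i J. ?c j * (a j \<bullet> x)) = 0" if x: "x \<in> W" for x
        proof -
          let ?t = "(a i \<bullet> x) / (a i \<bullet> w)"
          have "x - ?t *\<^sub>R w \<in> ?H"
            using W w x by (auto simp: inner_diff_right intro!: subspace_diff subspace_scale)
          then have "F (x - ?t *\<^sub>R w) = 0"
            using c by (simp add: F_def)
          moreover have "F (x - ?t *\<^sub>R w) = F x - ?t * F w"
            by (simp add: F_def inner_diff_right algebra_simps sum_subtractf sum_distrib_left)
          moreover have "(\<Sum>j\<in>J. ?c j * (a j \<bullet> x)) = F x"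
            unfolding F_def using iJ by (intro sum.cong) auto
          ultimately show ?thesis
            using iJ fin[OF J(1)] by (simp add: algebra_simps)
        qed
        then have "\<forall>j\<in>insert i J. ?c j = 0"
          using indJ[unfolded indep_on_def, rule_format, of ?c] by blast
        then show "c j = 0"
          using j iJ by (metis insertCI)
      qed
    qed
    ultimately show ?thesis
      using card_sign_patterns_insert[where a = a, OF insert.hyps W w] insert.hyps dimH by (simp add: region_bound_Suc)
  qed
qed

lemma indep_on_UNIV_iff:
  fixes a :: "'i \<Rightarrow> 'a::euclidean_space"
  assumes "finite J"
  shows "indep_on a J UNIV \<longleftrightarrow> inj_on a J \<and> independent (a ` J)"
proof -
  have sum0: "(\<forall>x. (\<Sum>j\<in>J. c j * (a j \<bullet> x)) = 0) \<longleftrightarrow> (\<Sum>j\<in>J. c j *\<^sub>R a j) = 0" for c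
  proof -
    have "(\<Sum>j\<in>J. c j * (a j \<bullet> x)) = (\<Sum>j\<in>J. c j *\<^sub>R a j) \<bullet> x" for x
      by (simp add: inner_sum_left)
    then show ?thesis
      by (metis inner_eq_zero_iff inner_zero_left)
  qed
  have ind: "indep_on a J UNIV \<longleftrightarrow> (\<forall>c. (\<Sum>j\<in>J. c j *\<^sub>R a j) = 0 \<longrightarrow> (\<forall>j\<in>J. c j = 0))"
    unfolding indep_on_def by (simp add: sum0)
  show ?thesis
  proof
    assume "indep_on a J UNIV"
    then have c0: "\<And>c j. (\<Sum>j\<in>J. c j *\<^sub>R a j) = 0 \<Longrightarrow> j \<in> J \<Longrightarrow> c j = 0"
      unfolding ind by blast
    have inj: "inj_on a J"
    proof (rule inj_onI, rule ccontr)
      fix i j assume ij: "i \<in> J" "j \<in> J" "a i = a j" "i \<noteq> j"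
      let ?c = "\<lambda>l. if l = i then 1 else if l = j then - 1 else (0::real)"
      have "(\<Sum>l\<in>J. ?c l *\<^sub>R a l) = (\<Sum>l\<in>{i, j}. ?c l *\<^sub>R a l)"
        using ij assms by (intro sum.mono_neutral_right) auto
      also have "\<dots> = 0"
        using ij by simp
      finally have "?c i = 0"
        using ij(1) by (rule c0)
      then show False
        by simp
    qed
    have "independent (a ` J)"
    proof
      assume "dependent (a ` J)"
      then obtain u v where u: "(\<Sum>v\<in>a ` J. u v *\<^sub>R v) = 0" and v: "v \<in> a ` J" "u v \<noteq> 0"
        using dependent_finite[of "a ` J"] assms by auto
      have "(\<Sum>j\<in>J. u (a j) *\<^sub>R a j) = 0"
        using u by (simp add: sum.reindex[OF inj])
      then show False
        using c0[of "\<lambda>j. u (a j)"] v by auto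
    qed
    with inj show "inj_on a J \<and> independent (a ` J)"
      by simp
  next
    assume *: "inj_on a J \<and> independent (a ` J)"
    show "indep_on a J UNIV"
      unfolding ind
    proof (intro allI impI ballI)
      fix c j assume c: "(\<Sum>j\<in>J. c j *\<^sub>R a j) = 0" and j: "j \<in> J"
      let ?u = "\<lambda>v. c (inv_into J a v)"
      have "(\<Sum>v\<in>a ` J. ?u v *\<^sub>R v) = (\<Sum>j\<in>J. c j *\<^sub>R a j)"
        using * by (simp add: sum.reindex)
      then have "(\<Sum>v\<in>a ` J. ?u v *\<^sub>R v) = 0"
        using c by simp
      then have "dependent (a ` J)" if "c j \<noteq> 0"
        unfolding dependent_finite[OF finite_imageI[OF assms]]
        using that j * by (intro exI[of _ ?u] conjI bexI[of _ "a j"]) auto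
      then show "c j = 0"
        using * by blast
    qed
  qed
qed

section \<open>Counting hyperbolicity cones\<close>

lemma hyperbolic_prod_list: "L \<noteq> [] \<Longrightarrow> hyperbolic (prod_list L) e \<longleftrightarrow> (\<forall>g\<in>set L. hyperbolic g e)"
proof (induction L rule: list_nonempty_induct)
  case (cons x xs)
  then show ?case
    by (simp add: hyperbolic_mult)
qed simp

lemma hyp_cone_prod_list: "hyp_cone (prod_list L) e = (\<Inter>g\<in>set L. hyp_cone g e)"
proof -
  have "ceval (prod_list L) z = 0 \<longleftrightarrow> (\<exists>g\<in>set L. ceval g z = 0)" for z
    by (induction L) (auto simp: ceval_mult)
  then show ?thesis
    by (auto simp: hyp_cone_def)
qed

text \<open>The cone of a product is the intersection of the cones of its factors, so the sides of
  \<open>e\<close> with respect to the separating forms determine its cone. If m = d, every factor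
  is linear and is its own separating form.\<close>

lemma hyp_cones_le_sign_patterns:
  fixes f :: "'n::finite rpoly"
  assumes f: "homogeneous_deg f d" "d \<ge> 1" and e: "hyperbolic f e"
  obtains m and a :: "nat \<Rightarrow> real ^ 'n" where "m \<le> d" "finite (hyp_cones f)"
    "card (hyp_cones f) \<le> card (sign_patterns a {..<m} UNIV)"
    "m = d \<Longrightarrow> f = (\<Prod>j<d. linform (a j))"
proof -
  obtain L where L: "f = prod_list L" "\<forall>g\<in>set L. two_cones g \<and> (\<exists>m\<ge>1. homogeneous_deg g m)"
    "length L \<le> d" "length L = d \<longrightarrow> (\<forall>g\<in>set L. homogeneous_deg g 1)"
    using hyperbolic_factorization[OF f e] by blast
  have "\<forall>g\<in>set L. \<exists>l. (\<forall>e a. hyperbolic g e \<longrightarrow> hyperbolic g a \<longrightarrow> l \<bullet> e \<noteq> 0 \<and>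
      ((l \<bullet> e > 0) = (l \<bullet> a > 0) \<longrightarrow> hyp_cone g e = hyp_cone g a)) \<and> (homogeneous_deg g 1 \<longrightarrow> g = linform l)"
    using L(2) separating_linform by blast
  then obtain l where l: "\<And>g e a. g \<in> set L \<Longrightarrow> hyperbolic g e \<Longrightarrow> hyperbolic g a \<Longrightarrow> l g \<bullet> e \<noteq> 0 \<and>
      ((l g \<bullet> e > 0) = (l g \<bullet> a > 0) \<longrightarrow> hyp_cone g e = hyp_cone g a)"
    "\<And>g. g \<in> set L \<Longrightarrow> homogeneous_deg g 1 \<Longrightarrow> g = linform (l g)"
    by (metis (no_types, lifting))
  define m where "m = length L"
  define a where "a i = l (L ! i)" for i
  have "L \<noteq> []"
  proof
    assume "L = []"
    then have "ceval f (0 *s 0) = 1"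
      using L(1) by simp
    then show False
      using ceval_scale[OF f(1), of 0 0] f(2) by (simp add: power_0_left)
  qed
  have hyp: "hyperbolic g e" if "hyperbolic f e" "g \<in> set L" for g e
    using that L(1) hyperbolic_prod_list[OF \<open>L \<noteq> []\<close>] by blast
  define X where "X e = {i. i < m \<and> a i \<bullet> e > 0}" for e
  have X: "X e \<in> sign_patterns a {..<m} UNIV" if "hyperbolic f e" for e
  proof -
    have "a i \<bullet> e \<noteq> 0" if "i < m" for i
      using l(1)[of "L ! i" e e] hyp[OF \<open>hyperbolic f e\<close>, of "L ! i"] that by (simp add: a_def m_def)
    then show ?thesis
      unfolding sign_patterns_def by (intro CollectI conjI bexI[of _ e]) (auto simp: X_def not_less order_le_less)
  qed
  have same: "hyp_cone f e = hyp_cone f e'" if "hyperbolic f e" "hyperbolic f e'" "X e = X e'" for e e'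
  proof -
    have "hyp_cone g e = hyp_cone g e'" if g: "g \<in> set L" for g
    proof -
      obtain i where i: "i < m" "g = L ! i"
        using g by (metis in_set_conv_nth m_def)
      have "(l g \<bullet> e > 0) = (l g \<bullet> e' > 0)"
        using \<open>X e = X e'\<close> i by (auto simp: X_def a_def)
      then show ?thesis
        using l(1)[OF g hyp[OF \<open>hyperbolic f e\<close> g] hyp[OF \<open>hyperbolic f e'\<close> g]] by blast
    qed
    then show ?thesis
      by (simp add: L(1) hyp_cone_prod_list)
  qed
  define h where "h Y = hyp_cone f (SOME e. hyperbolic f e \<and> X e = Y)" for Y
  have "hyp_cones f \<subseteq> h ` sign_patterns a {..<m} UNIV"
  proof
    fix C assume "C \<in> hyp_cones f"
    then obtain e where e: "hyperbolic f e" "C = hyp_cone f e"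
      by (auto simp: hyp_cones_def)
    let ?e = "SOME e'. hyperbolic f e' \<and> X e' = X e"
    have "hyperbolic f ?e \<and> X ?e = X e"
      by (rule someI[of _ e]) (use e in simp)
    then have "C = h (X e)"
      using same[of ?e e] e by (simp add: h_def)
    then show "C \<in> h ` sign_patterns a {..<m} UNIV"
      using X[OF e(1)] by blast
  qed
  moreover have "finite (sign_patterns a {..<m} UNIV)"
    by (rule finite_sign_patterns) simp
  ultimately have "finite (hyp_cones f)" "card (hyp_cones f) \<le> card (sign_patterns a {..<m} UNIV)"
    by (auto intro: finite_surj surj_card_le)
  moreover have "f = (\<Prod>j<d. linform (a j))" if "m = d"
  proof -
    have "linform (a j) = L ! j" if "j < d" for j
      using l(2)[of "L ! j"] L(4) that \<open>m = d\<close> by (simp add: a_def m_def)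
    then have "(\<Prod>j<d. linform (a j)) = (\<Prod>j<length L. L ! j)"
      using that by (simp add: m_def)
    also have "\<dots> = prod_list L"
      by (simp add: prod.list_conv_set_nth atLeast0LessThan)
    finally show ?thesis
      using L(1) by simp
  qed
  ultimately show thesis
    using that[of m a] L(3) m_def by blast
qed

text \<open>Every point off the hyperplanes is hyperbolic and its cone is the open region containing
  it, so distinct patterns give distinct cones.\<close>

lemma sign_patterns_le_hyp_cones:
  fixes a :: "nat \<Rightarrow> real ^ 'n::finite"
  assumes "c \<noteq> 0" and f: "f = Poly_Mapping.single 0 c * (\<Prod>j<d. linform (a j))" and "finite (hyp_cones f)"
  shows "card (sign_patterns a {..<d} UNIV) \<le> card (hyp_cones f)"
proof -
  define sat where "sat Y x \<longleftrightarrow> (\<forall>i\<in>Y. a i \<bullet> x > 0) \<and> (\<forall>i\<in>{..<d} - Y. a i \<bullet> x < 0)" for Y x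
  define h where "h Y = hyp_cone f (SOME x. sat Y x)" for Y
  have zero_iff: "ceval f z = 0 \<longleftrightarrow> (\<exists>j<d. ceval (linform (a j)) z = 0)" for z
    using \<open>c \<noteq> 0\<close> by (auto simp: f ceval_mult ceval_prod ceval_single)
  have hyp: "hyperbolic f x" if "\<And>i. i < d \<Longrightarrow> a i \<bullet> x \<noteq> 0" for x
    unfolding hyperbolic_def zero_iff
  proof (intro conjI allI impI)
    show "\<not> (\<exists>j<d. ceval (linform (a j)) (cvec x) = 0)"
      using that by (simp add: ceval_linform_cvec)
    fix y t assume "\<exists>j<d. ceval (linform (a j)) (cvec y + t *s cvec x) = 0"
    then obtain j where j: "j < d" "ceval (linform (a j)) (cvec y + t *s cvec x) = 0"
      by blast
    have "ceval (linform (a j)) (cvec y + t *s cvec x) = of_real (a j \<bullet> y) + t * of_real (a j \<bullet> x)"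
      by (simp add: ceval_linform cvec_def inner_vec_def algebra_simps sum.distrib sum_distrib_left)
    then have "t = of_real (- (a j \<bullet> y) / (a j \<bullet> x))"
      using j that[OF j(1)] by (simp add: field_simps add_eq_0_iff)
    then show "t \<in> \<real>"
      by simp
  qed
  have cone: "hyp_cone f x = {y. \<forall>j<d. (a j \<bullet> y) * (a j \<bullet> x) > 0}" if "\<And>i. i < d \<Longrightarrow> a i \<bullet> x \<noteq> 0" for x
  proof -
    have "hyp_cone f x = {y. \<forall>j<d. y \<in> hyp_cone (linform (a j)) x}"
      unfolding hyp_cone_def zero_iff by auto
    then show ?thesis
      using that by (simp add: hyp_cone_linform)
  qed
  have some: "sat Y (SOME x. sat Y x)" "Y \<subseteq> {..<d}" if "Y \<in> sign_patterns a {..<d} UNIV" for Y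
  proof -
    from that have "\<exists>x. sat Y x" "Y \<subseteq> {..<d}"
      unfolding sign_patterns_def sat_def by blast+
    then show "sat Y (SOME x. sat Y x)" "Y \<subseteq> {..<d}"
      by (auto intro: someI_ex)
  qed
  have nz: "a i \<bullet> x \<noteq> 0" if "sat Y x" "i < d" for Y x i
    using that unfolding sat_def by (cases "i \<in> Y") force+
  have "inj_on h (sign_patterns a {..<d} UNIV)"
  proof (rule inj_onI)
    fix Y Z assume Y: "Y \<in> sign_patterns a {..<d} UNIV" and Z: "Z \<in> sign_patterns a {..<d} UNIV" and "h Y = h Z"
    define y z where "y = (SOME x. sat Y x)" and "z = (SOME x. sat Z x)"
    have y: "sat Y y" and z: "sat Z z"
      using some(1) Y Z by (auto simp: y_def z_def)
    have "y \<in> hyp_cone f y"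
      using cone[of y] nz[OF y] by (auto simp: zero_less_mult_iff linorder_neq_iff)
    then have "y \<in> hyp_cone f z"
      using \<open>h Y = h Z\<close> by (simp add: h_def y_def z_def)
    then have yz: "(a j \<bullet> y) * (a j \<bullet> z) > 0" if "j < d" for j
      using cone[of z] nz[OF z] that by simp
    have "j \<in> Y \<longleftrightarrow> j \<in> Z" if "j < d" for j
      using yz[OF that] y z that unfolding sat_def by (cases "j \<in> Y"; cases "j \<in> Z") (force simp: zero_less_mult_iff)+
    then show "Y = Z"
      using some(2)[OF Y] some(2)[OF Z] by blast
  qed
  moreover have "h ` sign_patterns a {..<d} UNIV \<subseteq> hyp_cones f"
    using some(1) nz hyp unfolding h_def hyp_cones_def by blast
  ultimately show ?thesis
    using assms(3) by (rule card_inj_on_le)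
qed

text \<open>In dimension one the bound is 2 for all d >= 1, so counting cannot show that
  \<open>d\<close> linear factors occur; the product form is read off from homogeneity
  instead.\<close>

lemma homogeneous_one_variable:
  fixes f :: "'n::finite rpoly"
  assumes f: "homogeneous_deg f d" and "CARD('n) = 1"
  obtains c and v :: "real ^ 'n" where "c \<noteq> 0" "v \<noteq> 0" "f = Poly_Mapping.single 0 c * (\<Prod>j<d. linform v)"
proof -
  obtain i :: 'n where UNIV: "UNIV = {i}"
    using assms(2) card_1_singletonE by blast
  then have all: "j = i" for j
    by (metis UNIV_I singletonD)
  let ?v = "\<chi> j. 1 :: real ^ 'n"
  have ev: "ceval f (cvec x) = of_real (x $ i) ^ d * ceval f (cvec ?v)" for x
  proof -
    have "cvec x = of_real (x $ i) *s cvec ?v"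
      using all by (simp add: cvec_def vec_eq_iff) metis
    then show ?thesis
      by (simp only: ceval_scale[OF f])
  qed
  obtain c where c: "ceval f (cvec ?v) = of_real c"
    using ceval_cvec_real by (metis Reals_cases)
  show thesis
  proof (rule that[of c ?v])
    show eq: "f = Poly_Mapping.single 0 c * (\<Prod>j<d. linform ?v)"
      by (rule rpoly_eqI, subst ev)
         (simp only: ceval_mult ceval_single ceval_prod ceval_linform_cvec c, simp add: inner_vec_def UNIV)
    show "c \<noteq> 0"
      using eq f by (auto simp: homogeneous_deg_def)
    show "?v \<noteq> 0"
      by (simp add: vec_eq_iff)
  qed
qed

theorem theorem1p2:
  fixes f :: "'n::finite rpoly" and d :: nat
  assumes "d \<ge> 1" and "homogeneous_deg f d"
  shows "finite (hyp_cones f) \<and> card (hyp_cones f) \<le> cone_bound CARD('n) d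
       \<and> finite (components (UNIV - imag_proj f))
       \<and> card (components (UNIV - imag_proj f)) \<le> cone_bound CARD('n) d
       \<and> (card (hyp_cones f) = cone_bound CARD('n) d \<longleftrightarrow>
          (\<exists>(c::real) (a::nat \<Rightarrow> real ^ 'n). c \<noteq> 0 \<and>
             f = Poly_Mapping.single 0 c * (\<Prod>j<d. linform (a j)) \<and>
             (\<forall>J\<subseteq>{..<d}. card J = min CARD('n) d \<longrightarrow> inj_on a J \<and> independent (a ` J))))"
proof -
  note d = assms(1) and f = assms(2)
  let ?n = "CARD('n)"
  have n: "?n \<ge> 1"
    by (simp add: Suc_le_eq)
  have bound: "cone_bound ?n d = region_bound ?n d"
    using cone_bound_eq_region_bound[OF n d] .
  have le: "card (sign_patterns a {..<m} UNIV) \<le> region_bound ?n m" for a :: "nat \<Rightarrow> real ^ 'n" and m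
    using card_sign_patterns_le[of "{..<m}" "UNIV :: (real ^ 'n) set" a] by simp
  have cones: "finite (hyp_cones f) \<and> card (hyp_cones f) \<le> region_bound ?n d"
  proof (cases "\<exists>e. hyperbolic f e")
    case True
    then obtain e where "hyperbolic f e" ..
    then obtain m and a :: "nat \<Rightarrow> real ^ 'n" where m: "m \<le> d" "finite (hyp_cones f)"
      "card (hyp_cones f) \<le> card (sign_patterns a {..<m} UNIV)"
      using hyp_cones_le_sign_patterns[OF f d] by metis
    then show ?thesis
      using le[of a m] region_bound_mono[OF n m(1)] by linarith
  qed (simp add: hyp_cones_def)
  have "card (hyp_cones f) = region_bound ?n d \<longleftrightarrow>
          (\<exists>(c::real) (a::nat \<Rightarrow> real ^ 'n). c \<noteq> 0 \<and>
             f = Poly_Mapping.single 0 c * (\<Prod>j<d. linform (a j)) \<and>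
             (\<forall>J\<subseteq>{..<d}. card J = min ?n d \<longrightarrow> inj_on a J \<and> independent (a ` J)))"
    (is "?L \<longleftrightarrow> ?R")
  proof
    assume ?L
    show ?R
    \<comment> \<open>Recovering m = d rests on strict monotonicity of the bound in the number of
      hyperplanes, available from dimension 2 on.\<close>
    proof (cases "?n = 1")
      case True
      obtain c and v :: "real ^ 'n" where cv: "c \<noteq> 0" "v \<noteq> 0" "f = Poly_Mapping.single 0 c * (\<Prod>j<d. linform v)"
        using homogeneous_one_variable[OF f True] by metis
      have "inj_on (\<lambda>_. v) J \<and> independent ((\<lambda>_. v) ` J)" if J: "J \<subseteq> {..<d}" "card J = min ?n d" for J
      proof -
        have "card J = 1"
          using J(2) True d by simp
        then obtain j where "J = {j}"
          using card_1_singletonE by blast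
        then show ?thesis
          using cv(2) by simp
      qed
      then show ?thesis
        using cv by (intro exI[of _ c] exI[of _ "\<lambda>_. v"]) auto
    next
      case False
      then have n2: "?n \<ge> 2"
        using n by linarith
      have "hyp_cones f \<noteq> {}"
        using \<open>?L\<close> region_bound_pos[OF n, of d] by auto
      then obtain e where "hyperbolic f e"
        by (auto simp: hyp_cones_def)
      then obtain m and a :: "nat \<Rightarrow> real ^ 'n" where m: "m \<le> d"
        "card (hyp_cones f) \<le> card (sign_patterns a {..<m} UNIV)"
        "m = d \<Longrightarrow> f = (\<Prod>j<d. linform (a j))"
        using hyp_cones_le_sign_patterns[OF f d] by metis
      have "m = d"
      proof (rule ccontr)
        assume "m \<noteq> d"
        then have "region_bound ?n m < region_bound ?n d"
          using m(1) n2 by (intro region_bound_strict_mono) auto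
        then show False
          using \<open>?L\<close> m(2) le[of a m] by linarith
      qed
      then have max: "card (sign_patterns a {..<d} UNIV) = region_bound ?n d"
        using \<open>?L\<close> m(2) le[of a d] by simp
      have "inj_on a J \<and> independent (a ` J)" if J: "J \<subseteq> {..<d}" "card J = min ?n d" for J
      proof -
        have "indep_on a J UNIV"
          using max_sign_patterns_imp_indep[of "{..<d}" "UNIV :: (real ^ 'n) set" a J] max J by simp
        then show ?thesis
          using indep_on_UNIV_iff finite_subset[OF J(1)] by auto
      qed
      then show ?thesis
        using m(3)[OF \<open>m = d\<close>] by (intro exI[of _ 1] exI[of _ a]) simp
    qed
  next
    assume ?R
    then obtain c and a :: "nat \<Rightarrow> real ^ 'n" where ca: "c \<noteq> 0" "f = Poly_Mapping.single 0 c * (\<Prod>j<d. linform (a j))"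
      "\<And>J. J \<subseteq> {..<d} \<Longrightarrow> card J = min ?n d \<Longrightarrow> inj_on a J \<and> independent (a ` J)"
      by blast
    have "indep_on a J UNIV" if "J \<subseteq> {..<d}" "card J = min ?n d" for J
      using ca(3)[OF that] indep_on_UNIV_iff finite_subset[OF that(1)] by auto
    then have "card (sign_patterns a {..<d} UNIV) = region_bound ?n d"
      using indep_imp_max_sign_patterns[of "{..<d}" "UNIV :: (real ^ 'n) set" a] by simp
    then show ?L
      using sign_patterns_le_hyp_cones[OF ca(1,2)] cones by simp
  qed
  moreover have "finite (components (UNIV - imag_proj f)) \<and> card (components (UNIV - imag_proj f)) \<le> region_bound ?n d"
    using cones card_components_le_hyp_cones[OF f] by (meson order_trans)
  ultimately show ?thesis
    using cones unfolding bound by blast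
qed

end
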